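(* Let $I\subset\mathbb{R}$ be an interval containing $0$, let $\ell>0$, and let $\gamma:I\times(\mathbb{R}/\ell\mathbb{Z})\to\mathbb{R}^3$ be a smooth classical solution of $\partial_t\gamma=\partial_s\gamma\times\partial_{ss}\gamma$ with $|\partial_s\gamma|=1$, such that for every $t\in I$ the curve $\gamma_t:=\gamma(t,\cdot)$ has no self-intersection (i.e. $\gamma(t,\cdot)$ is injective). Define $T_{\gamma,t}(X):=\int_0^\ell X(\gamma(t,s))\cdot\partial_s\gamma(t,s)\,ds$ for $X\in\mathcal{D}(\mathbb{R}^3,\mathbb{R}^3)$. Then $(T_{\gamma,t})_{t\in I}$ is the unique weak binormal curvature flow on $I$ with initial datum $T_{\gamma,0}$.
   Context: A simple closed oriented curve is a distribution $T\in\mathcal{D}'(\mathbb{R}^3,\mathbb{R}^3)$ of the form $T(X)=\int_{\mathbb{T}^1}X(\gamma(s))\cdot\gamma'(s)\,ds$ for a Lipschitz one-to-one $\gamma:\mathbb{T}^1\to\mathbb{R}^3$; its length is $L(T)=\int|\gamma'|$. The set $\mathcal{T}$ of integral 1-currents in $\mathbb{R}^3$ without boundary consists of all $T=\sum_{j\in\mathbb{N}}T_j$ (in $\mathcal{D}'$) with $T_j$ simple closed oriented curves and $\sum_j L(T_j)<\infty$. The mass of $T$ is $\|T\|:=\sup\{T(X): X\in\mathcal{D}(\mathbb{R}^3,\mathbb{R}^3),\ \|X\|_\infty\le1\}$. An oriented integral 1-varifold without boundary is a finite nonnegative Radon measure $V$ on $\mathbb{R}^3\times S^2$ whose first moment $T_V(X):=\int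 X(x)\cdot\xi\,dV(x,\xi)$ belongs to $\mathcal{T}$; its mass $\|V\|$ is its total mass. A family $(V_t)_{t\in I}$ is measurable if $t\mapsto V_t(\mathcal{O})$ is measurable for every Borel $\mathcal{O}\subset\mathbb{R}^3\times S^2$. A generalized binormal curvature flow on $I$ is a measurable family $(V_t)_{t\in I}$ of oriented integral 1-varifolds without boundary such that for every $X\in\mathcal{D}(\mathbb{R}^3,\mathbb{R}^3)$ the map $t\mapsto\int X\cdot\xi\,dV_t$ is Lipschitz on $I$ and $\frac{d}{dt}\int X\cdot\xi\,dV_t=-\int D(\mathrm{curl}\,X):\xi\otimes\xi\,dV_t$ for a.e. $t\in I$, where $D(\mathrm{curl}X):\xi\otimes\xi=\sum_{k,l}\partial_l(\mathrm{curl}X)^k\xi^k\xi^l$. A weak binormal curvature flow on $I$ with initial datum $T_0$ is a family $(T_t)_{t\in I}$ in $\mathcal{T}$, continuous from $I$ to $\mathcal{D}'(\mathbb{R}^3,\mathbb{R}^3)$, for which there exists a generalized binormal curvature flow $(V_t)_{t\in I}$ with $T_{V_t}=T_t$ and $\|V_t\|\le\|T_0\|$ for every $t\in I$. *)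

theory Defs
  imports "HOL-Analysis.Analysis"
begin

definition dir_deriv :: "'a::real_normed_vector set \<Rightarrow> 'a \<Rightarrow> ('a \<Rightarrow> 'b::real_normed_vector) \<Rightarrow> 'a \<Rightarrow> 'b" where
  "dir_deriv S v f x = frechet_derivative f (at x within S) v"

fun iter_deriv :: "'a::real_normed_vector set \<Rightarrow> 'a list \<Rightarrow> ('a \<Rightarrow> 'b::real_normed_vector) \<Rightarrow> 'a \<Rightarrow> 'b" where
  "iter_deriv S [] f = f"
| "iter_deriv S (v # vs) f = dir_deriv S v (iter_deriv S vs f)"

definition smooth_on :: "'a::real_normed_vector set \<Rightarrow> ('a \<Rightarrow> 'b::real_normed_vector) \<Rightarrow> bool" where
  "smooth_on S f \<longleftrightarrow> (\<forall>vs. continuous_on S (iter_deriv S vs f) \<and>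
      (\<forall>x\<in>S. iter_deriv S vs f differentiable (at x within S)))"

definition test_field :: "(real^3 \<Rightarrow> real^3) \<Rightarrow> bool" where
  "test_field X \<longleftrightarrow> smooth_on UNIV X \<and> bounded {x. X x \<noteq> 0}"

text \<open>Vector-valued distributions are represented as functionals on vector fields;
  only their values on test fields are meaningful.\<close>
type_synonym current = "(real^3 \<Rightarrow> real^3) \<Rightarrow> real"

definition same_current :: "current \<Rightarrow> current \<Rightarrow> bool" where
  "same_current S T \<longleftrightarrow> (\<forall>X. test_field X \<longrightarrow> S X = T X)"

definition mass :: "current \<Rightarrow> ereal" where
  "mass T = (SUP X\<in>{X. test_field X \<and> (\<forall>x. norm (X x) \<le> 1)}. ereal (T X))"

definition simple_closed_param :: "(real \<Rightarrow> real^3) \<Rightarrow> bool" where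
  "simple_closed_param g \<longleftrightarrow> (\<exists>C. C-lipschitz_on UNIV g) \<and> (\<forall>s. g (s + 1) = g s)
      \<and> inj_on g {0..<1}"

definition curve_current :: "(real \<Rightarrow> real^3) \<Rightarrow> current" where
  "curve_current g X = integral {0..1} (\<lambda>s. X (g s) \<bullet> vector_derivative g (at s))"

definition curve_length :: "(real \<Rightarrow> real^3) \<Rightarrow> real" where
  "curve_length g = integral {0..1} (\<lambda>s. norm (vector_derivative g (at s)))"

definition integral_current :: "current \<Rightarrow> bool" where
  "integral_current T \<longleftrightarrow> (\<exists>g :: nat \<Rightarrow> real \<Rightarrow> real^3.
      (\<forall>j. simple_closed_param (g j)) \<and> summable (\<lambda>j. curve_length (g j)) \<and>
      (\<forall>X. test_field X \<longrightarrow> (\<lambda>j. curve_current (g j) X) sums T X))"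

definition varifold_space :: "((real^3) \<times> (real^3)) set" where
  "varifold_space = Sigma UNIV (\<lambda>_. sphere 0 1)"

definition varifold_sets :: "((real^3) \<times> (real^3)) set set" where
  "varifold_sets = sets (restrict_space borel varifold_space)"

definition first_moment :: "((real^3) \<times> (real^3)) measure \<Rightarrow> current" where
  "first_moment V X = (\<integral>p. X (fst p) \<bullet> snd p \<partial>V)"

definition vmass :: "((real^3) \<times> (real^3)) measure \<Rightarrow> real" where
  "vmass V = measure V (space V)"

definition oriented_varifold :: "((real^3) \<times> (real^3)) measure \<Rightarrow> bool" where
  "oriented_varifold V \<longleftrightarrow> space V = varifold_space \<and> sets V = varifold_sets
     \<and> finite_measure V \<and> integral_current (first_moment V)"

definition pd :: "(real^3 \<Rightarrow> real^3) \<Rightarrow> 3 \<Rightarrow> real^3 \<Rightarrow> real^3" where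
  "pd F l x = frechet_derivative F (at x) (axis l 1)"

definition curl :: "(real^3 \<Rightarrow> real^3) \<Rightarrow> real^3 \<Rightarrow> real^3" where
  "curl X x = vector [pd X 2 x $ 3 - pd X 3 x $ 2,
                      pd X 3 x $ 1 - pd X 1 x $ 3,
                      pd X 1 x $ 2 - pd X 2 x $ 1]"

text \<open>D(curl X)(x) : xi (x) xi = sum over k l of d_l (curl X)^k xi^k xi^l.\<close>
definition Dcurl_xi :: "(real^3 \<Rightarrow> real^3) \<Rightarrow> real^3 \<Rightarrow> real^3 \<Rightarrow> real" where
  "Dcurl_xi X x \<xi> = (\<Sum>k\<in>UNIV. \<Sum>l\<in>UNIV. pd (curl X) l x $ k * \<xi> $ k * \<xi> $ l)"

definition generalized_BCF :: "real set \<Rightarrow> (real \<Rightarrow> ((real^3) \<times> (real^3)) measure) \<Rightarrow> bool" where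
  "generalized_BCF I V \<longleftrightarrow>
     (\<forall>t\<in>I. oriented_varifold (V t)) \<and>
     (\<forall>B\<in>varifold_sets. (\<lambda>t. emeasure (V t) B) \<in> borel_measurable (lebesgue_on I)) \<and>
     (\<forall>X. test_field X \<longrightarrow>
        (\<exists>C. C-lipschitz_on I (\<lambda>t. first_moment (V t) X)) \<and>
        (AE t in lebesgue_on I.
           ((\<lambda>\<tau>. first_moment (V \<tau>) X) has_real_derivative
              - (\<integral>p. Dcurl_xi X (fst p) (snd p) \<partial>(V t))) (at t within I)))"

definition weak_BCF :: "real set \<Rightarrow> (real \<Rightarrow> current) \<Rightarrow> current \<Rightarrow> bool" where
  "weak_BCF I T T0 \<longleftrightarrow>
     (\<forall>t\<in>I. integral_current (T t)) \<and>
     (\<forall>X. test_field X \<longrightarrow> continuous_on I (\<lambda>t. T t X)) \<and>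
     same_current (T 0) T0 \<and>
     (\<exists>V. generalized_BCF I V \<and>
        (\<forall>t\<in>I. same_current (first_moment (V t)) (T t) \<and> ereal (vmass (V t)) \<le> mass T0))"

definition d_s :: "(real \<Rightarrow> real \<Rightarrow> real^3) \<Rightarrow> real \<Rightarrow> real \<Rightarrow> real^3" where
  "d_s \<gamma> t s = vector_derivative (\<gamma> t) (at s)"

definition d_ss :: "(real \<Rightarrow> real \<Rightarrow> real^3) \<Rightarrow> real \<Rightarrow> real \<Rightarrow> real^3" where
  "d_ss \<gamma> t s = vector_derivative (d_s \<gamma> t) (at s)"

definition curve_current_t :: "(real \<Rightarrow> real \<Rightarrow> real^3) \<Rightarrow> real \<Rightarrow> real \<Rightarrow> current" where
  "curve_current_t \<gamma> L t X = integral {0..L} (\<lambda>s. X (\<gamma> t s) \<bullet> d_s \<gamma> t s)"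

end

theory Submission
  imports Defs
begin

text \<open>
  Let \<open>\<tau>\<close> and \<open>\<kappa>\<close> be the tangent and curvature vectors of the curve, \<open>F(x, s) = (x - \<gamma>(s)) \<bullet> \<tau>(s)\<close> and
  \<open>\<nu> = - \<partial>\<^sub>s F\<close>. Instead of the nearest point projection we average over the curve with the weight \<open>\<rho>(F) \<nu>\<close>,
  where \<open>\<rho>\<close> is a bump function of width \<open>\<epsilon>\<close>: the field \<open>X = \<integral> \<rho>(F) \<nu> f(|x - \<gamma>|\<^sup>2) \<tau> ds\<close> is a test field with
  \<open>|X| \<le> 1\<close> which is \<open>O(\<epsilon>)\<close>-close to \<open>\<tau>\<close> on the curve. If the curve moves by the flow, then
  \<open>|D(curl X) : \<xi> \<otimes> \<xi> - \<partial>\<^sub>t X \<bullet> \<xi>| \<le> K (1 - X \<bullet> \<xi>)\<close> for unit \<open>\<xi>\<close>, with \<open>K\<close> independent of \<open>\<epsilon>\<close>. For a weak flow \<open>V\<close>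
  the nonnegative quantity \<open>G(t) = L - \<integral> X\<^sub>t \<bullet> \<xi> dV\<^sub>t\<close> thus obeys Gronwall's inequality with \<open>G(0) = O(\<epsilon>)\<close>, so
  \<open>V\<^sub>t\<close> concentrates on the curve and its tangents. A test field \<open>Z\<close> differs there from \<open>m X\<close>, where \<open>m\<close> is
  the mean of \<open>Z \<bullet> \<tau>\<close>, by a gradient, on which the first moment of \<open>V\<^sub>t\<close> is constant in time and vanishes
  initially; hence \<open>\<integral> Z \<bullet> \<xi> dV\<^sub>t = m L\<close>. The same field \<open>X\<close> shows that the mass of the curve is \<open>L\<close>, which
  is what the smooth flow needs in order to be a weak flow.
\<close>

section \<open>Preliminaries from real analysis\<close>

text \<open>The average replaces the projection because test fields must be smooth on all of space:
  smoothness is then differentiation under the integral sign, with no implicit function theorem. The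
  price is a weight whose derivatives blow up as \<epsilon> tends to 0. They stay out of the
  estimates because \<open>\<rho>(F) dF\<close>, with \<open>dF = \<tau> \<bullet> dx - \<nu> ds +
  (\<partial>\<^sub>t F) dt\<close>, is a closed form in \<open>(x, s, t)\<close>: space and time
  derivatives of the weight are exact s-derivatives, and integration by parts moves them onto the
  slowly varying factor \<open>f \<tau>\<close>. Inside the tube \<open>f z\<close> is at most
  \<open>1 - z / r0\<^sup>2\<close>, so the defect \<open>1 - X \<bullet> \<xi>\<close> controls the
  squared distance to the curve and the squared angle to its tangent, but nothing of first order.
  Hence the first-order terms of D(curl X) and of the time derivative have to cancel, and this is
  where the flow equation enters. For a general Z the errors are linear; a second small parameter
  \<eta> absorbs them at the cost of a factor 1 / \<eta>, so \<epsilon> must tend to 0 before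
  \<eta>.\<close>

lemma continuous_on_curry:
  fixes f :: "'a::topological_space \<Rightarrow> 'b::topological_space \<Rightarrow> 'c::topological_space"
  assumes f: "continuous_on (A \<times> B) (\<lambda>(x, y). f x y)"
  shows "x \<in> A \<Longrightarrow> continuous_on B (f x)" and "y \<in> B \<Longrightarrow> continuous_on A (\<lambda>x. f x y)"
proof -
  assume x: "x \<in> A"
  have p: "continuous_on B (\<lambda>y. (x, y))" by (intro continuous_intros)
  have "continuous_on ((\<lambda>y. (x, y)) ` B) (\<lambda>(x, y). f x y)"
    by (rule continuous_on_subset[OF f]) (use x in auto)
  from continuous_on_compose[OF p this] show "continuous_on B (f x)" by (simp add: o_def)
next
  assume y: "y \<in> B"
  have p: "continuous_on A (\<lambda>x. (x, y))" by (intro continuous_intros)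
  have "continuous_on ((\<lambda>x. (x, y)) ` A) (\<lambda>(x, y). f x y)"
    by (rule continuous_on_subset[OF f]) (use y in auto)
  from continuous_on_compose[OF p this] show "continuous_on A (\<lambda>x. f x y)" by (simp add: o_def)
qed

lemma is_interval_Icc_subset:
  fixes a b :: real
  shows "\<lbrakk>is_interval I; a \<in> I; b \<in> I\<rbrakk> \<Longrightarrow> {a..b} \<subseteq> I"
  unfolding is_interval_1 subset_iff atLeastAtMost_iff by blast

text \<open>In finite dimension, continuity of the derivative in each direction already gives
  continuity in operator norm, so Leibniz's rule applies to derivatives given as plain
  functions.\<close>

lemma has_derivative_integral_param:
  fixes H :: "'a::euclidean_space \<Rightarrow> real \<Rightarrow> 'b::banach"
  assumes der: "\<And>x s. s \<in> {a..b} \<Longrightarrow> ((\<lambda>x. H x s) has_derivative H' x s) (at x)"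
    and contH: "\<And>x. continuous_on {a..b} (H x)"
    and cont: "\<And>v. continuous_on (UNIV \<times> {a..b}) (\<lambda>(x, s). H' x s v)"
  shows "((\<lambda>x. integral {a..b} (H x)) has_derivative (\<lambda>v. integral {a..b} (\<lambda>s. H' x0 s v))) (at x0)"
proof -
  define B where "B x s = Blinfun (H' x s)" for x s
  have B: "blinfun_apply (B x s) = H' x s" if "s \<in> {a..b}" for x s
    unfolding B_def using der[OF that] by (intro bounded_linear_Blinfun_apply) (rule has_derivative_bounded_linear)
  have contB: "continuous_on (UNIV \<times> {a..b}) (\<lambda>(x, s). B x s)"
    unfolding case_prod_unfold
  proof (rule continuous_on_blinfun_componentwise)
    fix i :: 'a
    show "continuous_on (UNIV \<times> {a..b}) (\<lambda>p. blinfun_apply (B (fst p) (snd p)) i)"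
      using cont[of i] by (rule continuous_on_eq) (auto simp: B)
  qed
  have "((\<lambda>x. integral (cbox a b) (H x)) has_derivative integral (cbox a b) (B x0)) (at x0)"
  proof (rule leibniz_rule[where U = UNIV])
    show "\<And>x. H x integrable_on cbox a b"
      using contH by (auto intro: integrable_continuous_real)
    show "\<And>x t. t \<in> cbox a b \<Longrightarrow> ((\<lambda>x. H x t) has_derivative blinfun_apply (B x t)) (at x)"
      using der B by simp
  qed (use contB in auto)
  moreover have "blinfun_apply (integral {a..b} (B x0)) v = integral {a..b} (\<lambda>s. H' x0 s v)" for v
  proof -
    have "continuous_on {a..b} (B x0)"
      using continuous_on_curry(1)[OF contB] by simp
    then have "blinfun_apply (integral {a..b} (B x0)) v = integral {a..b} (\<lambda>s. blinfun_apply (B x0 s) v)"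
      by (intro blinfun_apply_integral integrable_continuous_real)
    also have "\<dots> = integral {a..b} (\<lambda>s. H' x0 s v)"
      by (intro integral_cong) (simp add: B)
    finally show ?thesis .
  qed
  ultimately show ?thesis by (simp add: has_derivative_eq_rhs ext)
qed

text \<open>Time derivatives are taken within \<open>I\<close>, as the time interval may contain its
  end points; there the statement is one-sided.\<close>

lemma has_vector_derivative_within_interval_from_integral:
  fixes p :: "real \<Rightarrow> 'b::banach"
  assumes I: "is_interval I" and cont: "continuous_on I q" and t0: "t0 \<in> I"
    and int: "\<And>c d. \<lbrakk>c \<in> I; d \<in> I; c \<le> d\<rbrakk> \<Longrightarrow> p d - p c = integral {c..d} q"
  shows "(p has_vector_derivative q t0) (at t0 within I)"
  unfolding has_vector_derivative_def has_derivative_within_alt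
proof (intro conjI allI impI)
  show "bounded_linear (\<lambda>x. x *\<^sub>R q t0)" by (rule bounded_linear_scaleR_left)
  fix e :: real assume "e > 0"
  then obtain d where d: "d > 0" "\<And>r. r \<in> I \<Longrightarrow> \<bar>r - t0\<bar> < d \<Longrightarrow> norm (q r - q t0) < e"
    using cont t0 unfolding continuous_on_iff dist_norm by (metis real_norm_def)
  have key: "norm (p b - p a - (b - a) *\<^sub>R q t0) \<le> e * (b - a)"
    if ab: "a \<in> I" "b \<in> I" "a \<le> b" "\<bar>a - t0\<bar> < d" "\<bar>b - t0\<bar> < d" for a b
  proof -
    have sub: "{a..b} \<subseteq> I" using I ab(1,2) by (rule is_interval_Icc_subset)
    have c: "continuous_on {a..b} q" using continuous_on_subset[OF cont sub] .
    have "p b - p a - (b - a) *\<^sub>R q t0 = integral {a..b} (\<lambda>r. q r - q t0)"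
      using int[OF ab(1-3)] ab(3) c
      by (subst integral_diff) (auto intro: integrable_continuous_real)
    also have "norm \<dots> \<le> e * (b - a)"
    proof (rule integral_bound)
      fix t assume t: "t \<in> {a..b}"
      then have "t \<in> I" "\<bar>t - t0\<bar> < d" using sub ab by auto
      then show "norm (q t - q t0) \<le> e" using d(2) by (simp add: less_imp_le)
    qed (use ab in \<open>auto intro!: continuous_intros c\<close>)
    finally show ?thesis .
  qed
  show "\<exists>d>0. \<forall>y\<in>I. norm (y - t0) < d \<longrightarrow> norm (p y - p t0 - (y - t0) *\<^sub>R q t0) \<le> e * norm (y - t0)"
  proof (intro exI[of _ d] conjI ballI impI)
    fix y assume y: "y \<in> I" "norm (y - t0) < d"
    show "norm (p y - p t0 - (y - t0) *\<^sub>R q t0) \<le> e * norm (y - t0)"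
    proof (cases "t0 \<le> y")
      case True then show ?thesis using key[of t0 y] y t0 d by simp
    next
      case False
      have "p y - p t0 - (y - t0) *\<^sub>R q t0 = - (p t0 - p y - (t0 - y) *\<^sub>R q t0)"
        by (simp add: algebra_simps)
      then show ?thesis using key[of y t0] y t0 d False by (simp only: norm_minus_cancel) simp
    qed
  qed (use d in auto)
qed

text \<open>Symmetry of mixed derivatives in which the time derivative of \<open>us\<close> is
  concluded, not assumed: the time integral of \<open>w\<close> is \<open>u d - u c\<close>, and
  differentiating this identity in \<open>s\<close> expresses the increments of \<open>us\<close> as
  integrals of \<open>ws\<close>.\<close>

lemma has_vector_derivative_swap:
  fixes u w :: "real \<Rightarrow> real \<Rightarrow> 'b::banach"
  assumes I: "is_interval I" and t0: "t0 \<in> I"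
    and ut: "\<And>t s. t \<in> I \<Longrightarrow> ((\<lambda>r. u r s) has_vector_derivative w t s) (at t within I)"
    and us: "\<And>t s. t \<in> I \<Longrightarrow> (u t has_vector_derivative us t s) (at s)"
    and ws: "\<And>t s. t \<in> I \<Longrightarrow> (w t has_vector_derivative ws t s) (at s)"
    and cont: "continuous_on (I \<times> UNIV) (\<lambda>(t, s). ws t s)"
  shows "((\<lambda>r. us r s) has_vector_derivative ws t0 s) (at t0 within I)"
proof (rule has_vector_derivative_within_interval_from_integral[OF I _ t0])
  show "continuous_on I (\<lambda>r. ws r s)"
    using continuous_on_curry(2)[OF cont] by simp
  fix c d assume cd: "c \<in> I" "d \<in> I" "c \<le> d"
  have sub: "{c..d} \<subseteq> I" using I cd(1,2) by (rule is_interval_Icc_subset)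
  have ftc: "((\<lambda>r. w r z) has_integral (u d z - u c z)) {c..d}" for z
    using cd(3) sub by (intro fundamental_theorem_of_calculus)
      (auto intro!: has_vector_derivative_within_subset[OF ut])
  have "((\<lambda>z. integral (cbox c d) (\<lambda>r. w r z)) has_vector_derivative integral (cbox c d) (\<lambda>r. ws r s)) (at s)"
  proof (rule leibniz_rule_vector_derivative[where U = UNIV])
    show "\<And>z r. r \<in> cbox c d \<Longrightarrow> (w r has_vector_derivative ws r z) (at z)"
      using sub ws by auto
    show "\<And>z. (\<lambda>r. w r z) integrable_on cbox c d" using ftc by auto
    have "continuous_on (UNIV \<times> cbox c d) (\<lambda>p. (\<lambda>(t, s). ws t s) (snd p, fst p))"
      by (rule continuous_on_compose2[OF cont]) (use sub in \<open>auto intro!: continuous_intros\<close>)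
    then show "continuous_on (UNIV \<times> cbox c d) (\<lambda>(x, t). ws t x)"
      by (simp add: case_prod_unfold)
  qed auto
  moreover have "(\<lambda>z. integral (cbox c d) (\<lambda>r. w r z)) = (\<lambda>z. u d z - u c z)"
    using ftc by auto
  ultimately have "((\<lambda>z. u d z - u c z) has_vector_derivative integral {c..d} (\<lambda>r. ws r s)) (at s)"
    by simp
  moreover have "((\<lambda>z. u d z - u c z) has_vector_derivative us d s - us c s) (at s)"
    using us cd by (auto intro!: derivative_eq_intros)
  ultimately show "us d s - us c s = integral {c..d} (\<lambda>r. ws r s)"
    by (rule vector_derivative_unique_at[rotated])
qed

section \<open>Mean value and Gronwall inequalities\<close>

lemma norm_diff_le_within:
  fixes u :: "real \<Rightarrow> 'b::real_normed_vector"
  assumes "convex S" and "\<And>s. s \<in> S \<Longrightarrow> (u has_vector_derivative u' s) (at s within S)"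
    and "\<And>s. s \<in> S \<Longrightarrow> norm (u' s) \<le> B" and "s \<in> S" "t \<in> S"
  shows "norm (u s - u t) \<le> B * \<bar>s - t\<bar>"
proof -
  have "norm (u s - u t) \<le> B * norm (s - t)"
  proof (rule differentiable_bound[of S u "\<lambda>s h. h *\<^sub>R u' s"])
    show "(u has_derivative (\<lambda>h. h *\<^sub>R u' s)) (at s within S)" if "s \<in> S" for s
      using assms(2)[OF that] by (simp add: has_vector_derivative_def)
    show "onorm (\<lambda>h. h *\<^sub>R u' s) \<le> B" if "s \<in> S" for s
    proof (rule onorm_bound)
      show "norm (h *\<^sub>R u' s) \<le> B * norm h" for h
        using mult_left_mono[OF assms(3)[OF that], of "\<bar>h\<bar>"] by (simp add: mult.commute)
    qed (use order.trans[OF norm_ge_zero assms(3)[OF that]] in blast)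
  qed (use assms in auto)
  then show ?thesis by simp
qed

lemma norm_diff_le_of_vector_derivative:
  fixes u :: "real \<Rightarrow> 'b::real_normed_vector"
  assumes "\<And>s. (u has_vector_derivative u' s) (at s)" and "\<And>s. norm (u' s) \<le> B"
  shows "norm (u s - u t) \<le> B * \<bar>s - t\<bar>"
  by (rule norm_diff_le_within[of UNIV]) (use assms in auto)

text \<open>Continuation argument: at the supremum \<open>c\<close> of the points up to which
  \<open>k\<close> is at most \<open>k a\<close>, continuity preserves the bound, and the local
  hypothesis would carry it further if \<open>c < b\<close>. A one-sided bound just to the right of
  each point replaces differentiability.\<close>

lemma nonincreasing_if_locally_right:
  fixes k :: "real \<Rightarrow> real"
  assumes ab: "a \<le> b" and cont: "continuous_on {a..b} k"
    and loc: "\<And>x. \<lbrakk>a \<le> x; x < b\<rbrakk> \<Longrightarrow> \<exists>d>0. \<forall>t. x < t \<and> t < x + d \<and> t \<le> b \<longrightarrow> k t \<le> k x"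
  shows "k b \<le> k a"
proof -
  define S where "S = {x \<in> {a..b}. \<forall>u\<in>{a..x}. k u \<le> k a}"
  have aS: "a \<in> S" using ab by (auto simp: S_def)
  have bdd: "bdd_above S" by (auto simp: S_def bdd_above_def)
  define c where "c = Sup S"
  have ac: "a \<le> c" unfolding c_def using aS bdd by (rule cSup_upper)
  have cb: "c \<le> b" unfolding c_def using aS by (intro cSup_least) (auto simp: S_def)
  have below: "k u \<le> k a" if "a \<le> u" "u < c" for u
  proof -
    obtain x where "x \<in> S" "u < x"
      using \<open>u < c\<close> less_cSup_iff[of S u] aS bdd unfolding c_def by auto
    then show ?thesis using that by (auto simp: S_def)
  qed
  have kc: "k c \<le> k a"
  proof (rule ccontr)
    assume n: "\<not> k c \<le> k a"
    then have "c \<noteq> a" by auto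
    with ac have "a < c" by simp
    obtain d where d: "d > 0" "\<And>u. u \<in> {a..b} \<Longrightarrow> \<bar>u - c\<bar> < d \<Longrightarrow> \<bar>k u - k c\<bar> < k c - k a"
      using cont n ac cb unfolding continuous_on_iff dist_real_def
      by (metis atLeastAtMost_iff diff_gt_0_iff_gt not_le)
    define u where "u = max a (c - d/2)"
    have "u \<in> {a..b}" "\<bar>u - c\<bar> < d" "u < c" "a \<le> u" using d(1) \<open>a < c\<close> cb by (auto simp: u_def)
    then show False using d(2)[of u] below[of u] by auto
  qed
  have "c = b"
  proof (rule ccontr)
    assume "c \<noteq> b"
    with cb have "c < b" by simp
    then obtain d where d: "d > 0" "\<And>t. c < t \<Longrightarrow> t < c + d \<Longrightarrow> t \<le> b \<Longrightarrow> k t \<le> k c"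
      using loc[OF ac] by blast
    define x where "x = min b (c + d/2)"
    have x: "c < x" "x \<le> b" "x < c + d" using d(1) \<open>c < b\<close> by (auto simp: x_def)
    have "k u \<le> k a" if "a \<le> u" "u \<le> x" for u
    proof (cases "u \<le> c")
      case True then show ?thesis using below[of u] kc that by (cases "u = c") auto
    next
      case False then show ?thesis using d(2)[of u] kc that x by auto
    qed
    then have "x \<in> S" using x ac by (auto simp: S_def)
    then have "x \<le> c" unfolding c_def using bdd by (rule cSup_upper)
    then show False using x by simp
  qed
  then show ?thesis using kc by simp
qed

text \<open>The hypothesis bounds difference quotients with a slack \<eta> instead of a derivative,
  because the gap of a weak flow is only estimated to first order around each time.\<close>

lemma gronwall_right:
  fixes G :: "real \<Rightarrow> real"
  assumes K: "K \<ge> 0" and T: "T \<ge> 0"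
    and loc: "\<And>a \<eta>. \<lbrakk>a \<in> {0..T}; \<eta> > 0\<rbrakk> \<Longrightarrow> \<exists>d>0. \<forall>t\<in>{0..T}. \<bar>t - a\<bar> < d \<longrightarrow>
       \<bar>G t - G a\<bar> \<le> (K * G a + \<eta>) * \<bar>t - a\<bar>"
    and G0: "\<And>t. t \<in> {0..T} \<Longrightarrow> G t \<ge> 0"
  shows "G T \<le> G 0 * exp (K * T)"
proof -
  have cont: "continuous_on {0..T} G"
    unfolding continuous_on_iff dist_real_def
  proof (intro ballI allI impI)
    fix x e :: real assume x: "x \<in> {0..T}" and e: "0 < e"
    obtain d where d: "d > 0" "\<And>t. t \<in> {0..T} \<Longrightarrow> \<bar>t - x\<bar> < d \<Longrightarrow> \<bar>G t - G x\<bar> \<le> (K * G x + 1) * \<bar>t - x\<bar>"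
      using loc[OF x, of 1] by auto
    have p: "K * G x + 1 > 0" using K G0[OF x] by (simp add: add_nonneg_pos)
    show "\<exists>d>0. \<forall>x'\<in>{0..T}. \<bar>x' - x\<bar> < d \<longrightarrow> \<bar>G x' - G x\<bar> < e"
    proof (intro exI[of _ "min d (e / (K * G x + 1))"] conjI ballI impI)
      fix t assume t: "t \<in> {0..T}" "\<bar>t - x\<bar> < min d (e / (K * G x + 1))"
      then have "\<bar>G t - G x\<bar> \<le> (K * G x + 1) * \<bar>t - x\<bar>" by (intro d(2)) auto
      also have "\<dots> < e" using t(2) p by (simp add: pos_less_divide_eq mult.commute)
      finally show "\<bar>G t - G x\<bar> < e" .
    qed (use d p e in auto)
  qed
  have *: "exp (- K * T) * G T \<le> G 0 + \<eta> * T" if \<eta>: "\<eta> > 0" for \<eta>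
  proof -
    \<comment> \<open>With the slack subtracted, the damped function does not increase to the right
      of any point; \<open>\<eta> * t\<close> absorbs the slack because the damping factor is at
      most 1.\<close>
    define k where "k t = exp (- K * t) * G t - \<eta> * t" for t
    have "k T \<le> k 0"
    proof (rule nonincreasing_if_locally_right[OF T])
      show "continuous_on {0..T} k" unfolding k_def by (intro continuous_intros cont)
      fix x assume x: "0 \<le> x" "x < T"
      obtain d where d: "d > 0" "\<And>t. t \<in> {0..T} \<Longrightarrow> \<bar>t - x\<bar> < d \<Longrightarrow> \<bar>G t - G x\<bar> \<le> (K * G x + \<eta>) * \<bar>t - x\<bar>"
        using loc[of x \<eta>] x \<eta> by auto
      show "\<exists>d>0. \<forall>t. x < t \<and> t < x + d \<and> t \<le> T \<longrightarrow> k t \<le> k x"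
      proof (intro exI[of _ d] conjI allI impI)
        fix t assume t: "x < t \<and> t < x + d \<and> t \<le> T"
        have 1: "G t \<le> G x + (K * G x + \<eta>) * (t - x)" using d(2)[of t] t x by auto
        define E where "E = exp (- K * t)"
        have E: "0 < E" "E \<le> 1" using K t x by (auto simp: E_def)
        have "exp (- K * x) = E * exp (K * (t - x))" by (simp add: E_def exp_add[symmetric] algebra_simps)
        also have "\<dots> \<ge> E * (1 + K * (t - x))" using E by (intro mult_left_mono exp_ge_add_one_self) auto
        finally have "exp (- K * x) * G x \<ge> E * (1 + K * (t - x)) * G x"
          using G0[of x] x by (intro mult_right_mono) auto
        moreover have "E * G t \<le> E * (G x + (K * G x + \<eta>) * (t - x))"
          using 1 E by (intro mult_left_mono) auto
        moreover have "E * (\<eta> * (t - x)) \<le> \<eta> * (t - x)"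
          using E t \<eta> by (intro mult_left_le_one_le) auto
        ultimately show "k t \<le> k x" unfolding k_def E_def[symmetric] by (simp add: algebra_simps)
      qed (use d in auto)
    qed
    then show ?thesis by (simp add: k_def)
  qed
  have "exp (- K * T) * G T \<le> G 0"
  proof (rule field_le_epsilon)
    fix e :: real assume e: "e > 0"
    show "exp (- K * T) * G T \<le> G 0 + e"
    proof (cases "T = 0")
      case True then show ?thesis using e by simp
    next
      case False then show ?thesis using *[of "e / T"] e T by simp
    qed
  qed
  then have "exp (K * T) * (exp (- K * T) * G T) \<le> exp (K * T) * G 0" by (intro mult_left_mono) auto
  then show ?thesis by (simp add: exp_minus mult.assoc[symmetric] mult.commute[of "G 0"])
qed

text \<open>The local hypothesis is symmetric in time, so reversing time gives the bound backwards
  from 0 as well.\<close>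

lemma gronwall_two_sided:
  fixes G :: "real \<Rightarrow> real"
  assumes K: "K \<ge> 0"
    and loc: "\<And>a \<eta>. \<lbrakk>a \<in> closed_segment 0 T; \<eta> > 0\<rbrakk> \<Longrightarrow> \<exists>d>0. \<forall>t\<in>closed_segment 0 T. \<bar>t - a\<bar> < d \<longrightarrow>
       \<bar>G t - G a\<bar> \<le> (K * G a + \<eta>) * \<bar>t - a\<bar>"
    and G0: "\<And>t. t \<in> closed_segment 0 T \<Longrightarrow> G t \<ge> 0"
  shows "G T \<le> G 0 * exp (K * \<bar>T\<bar>)"
proof (cases "T \<ge> 0")
  case True
  then show ?thesis using gronwall_right[of K T G] assms by (simp add: closed_segment_eq_real_ivl)
next
  case False
  have seg: "closed_segment 0 T = {T..0}" using False by (simp add: closed_segment_eq_real_ivl)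
  have "G (- (- T)) \<le> G (- 0) * exp (K * (- T))"
  proof (rule gronwall_right[of K "- T" "\<lambda>t. G (- t)"])
    fix a \<eta> :: real assume a: "a \<in> {0..- T}" "\<eta> > 0"
    then obtain d where d: "d > 0" "\<And>t. t \<in> {T..0} \<Longrightarrow> \<bar>t - (- a)\<bar> < d \<Longrightarrow>
       \<bar>G t - G (- a)\<bar> \<le> (K * G (- a) + \<eta>) * \<bar>t - (- a)\<bar>"
      using loc[of "- a" \<eta>] unfolding seg by (auto simp: minus_le_iff)
    have "\<bar>G (- t) - G (- a)\<bar> \<le> (K * G (- a) + \<eta>) * \<bar>t - a\<bar>" if "t \<in> {0..-T}" "\<bar>t - a\<bar> < d" for t
      using d(2)[of "- t"] that by (auto simp: abs_minus_commute)
    then show "\<exists>d>0. \<forall>t\<in>{0..- T}. \<bar>t - a\<bar> < d \<longrightarrow> \<bar>G (- t) - G (- a)\<bar> \<le> (K * G (- a) + \<eta>) * \<bar>t - a\<bar>"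
      using d(1) by blast
  qed (use False K G0 seg in \<open>auto simp: le_minus_iff\<close>)
  then show ?thesis using False by simp
qed

text \<open>The exceptional set is covered by an open set \<open>U\<close> of measure below
  \<open>e\<close>. While \<open>t\<close> runs through \<open>U\<close>, the measure of the part of
  \<open>U\<close> already passed grows at unit speed and pays for the Lipschitz constant; in total
  it pays at most a multiple of \<open>e\<close>.\<close>

lemma lipschitz_ae_derivative_increment_le:
  fixes f :: "real \<Rightarrow> real"
  assumes ab: "a \<le> b" and lip: "C-lipschitz_on {a..b} f" and N: "negligible N"
    and der: "\<And>t. t \<in> {a..b} - N \<Longrightarrow> \<exists>D. (f has_real_derivative D) (at t within {a..b}) \<and> D \<le> M"
  shows "f b - f a \<le> M * (b - a)"
proof -
  have C: "C \<ge> 0" using lip by (rule lipschitz_on_nonneg)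
  have main: "f b - f a \<le> (M + e) * (b - a) + (C + \<bar>M\<bar>) * e" if e: "e > 0" for e
  proof -
    have null: "N \<in> null_sets lebesgue" using N negligible_iff_null_sets by auto
    obtain U where U: "open U" "N \<subseteq> U" and UN: "U - N \<in> lmeasurable" "emeasure lebesgue (U - N) < ennreal e"
      using sets_lebesgue_outer_open[OF null_setsD2[OF null] e] .
    have "measure lebesgue (U - N) < e"
      using UN e by (simp add: emeasure_eq_measure2 ennreal_less_iff)
    moreover have "U = (U - N) \<union> N" using U by auto
    ultimately have U34: "U \<in> lmeasurable" "measure lebesgue U < e"
      using UN(1) null measure_Un_null_set[OF fmeasurableD[OF UN(1)] null]
        fmeasurable.Un[OF UN(1) fmeasurableI_null_sets[OF null]] by simp_all
    note U = U U34
    define \<Phi> where "\<Phi> t = measure lebesgue (U \<inter> {a..t})" for t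
    have lm: "U \<inter> {c..d} \<in> lmeasurable" for c d
      using U(3) by (auto intro!: fmeasurable.Int simp: )
    have \<Phi>_mono: "\<Phi> s \<le> \<Phi> t" if "s \<le> t" for s t
      unfolding \<Phi>_def using that lm by (intro measure_mono_fmeasurable) (auto simp: fmeasurableD)
    have \<Phi>_lip: "\<Phi> t \<le> \<Phi> s + (t - s)" if "s \<le> t" for s t
    proof -
      have "\<Phi> t \<le> measure lebesgue ((U \<inter> {a..s}) \<union> {s..t})"
        unfolding \<Phi>_def using lm by (intro measure_mono_fmeasurable fmeasurable.Un) (auto simp: fmeasurableD)
      also have "\<dots> \<le> \<Phi> s + measure lebesgue {s..t}"
        unfolding \<Phi>_def using lm by (intro measure_Un_le) (auto simp: fmeasurableD)
      finally show ?thesis using that by simp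
    qed
    have \<Phi>_grow: "\<Phi> t \<ge> \<Phi> s + (t - s)" if "a \<le> s" "s \<le> t" "{s..t} \<subseteq> U" for s t
    proof -
      have "\<Phi> s + (t - s) = measure lebesgue (U \<inter> {a..s}) + measure lebesgue {s<..t}"
        using that by (simp add: \<Phi>_def)
      also have "\<dots> = measure lebesgue ((U \<inter> {a..s}) \<union> {s<..t})"
        using lm by (intro measure_Un_AE[symmetric]) (auto intro!: AE_I2 bounded_set_imp_lmeasurable)
      also have "\<dots> \<le> \<Phi> t"
        unfolding \<Phi>_def using that lm by (intro measure_mono_fmeasurable) (auto simp: fmeasurableD)
      finally show ?thesis .
    qed
    \<comment> \<open>Off \<open>N\<close> the slope is at most \<open>M\<close>, and it suffices
      that \<open>\<Phi>\<close> is monotone. At a point of \<open>N\<close> the increment is at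
      most \<open>C\<close> times the step, and the growth of \<open>\<Phi>\<close> with the factor
      \<open>C + \<bar>M\<bar>\<close> outweighs both \<open>C\<close> and a negative
      \<open>M\<close>.\<close>
    define k where "k t = f t - (M + e) * t - (C + \<bar>M\<bar>) * \<Phi> t" for t
    have "k b \<le> k a"
    proof (rule nonincreasing_if_locally_right[OF ab])
      have "1-lipschitz_on UNIV \<Phi>"
      proof (rule lipschitz_onI)
        fix x y :: real
        show "dist (\<Phi> x) (\<Phi> y) \<le> 1 * dist x y"
          using \<Phi>_mono[of x y] \<Phi>_mono[of y x] \<Phi>_lip[of x y] \<Phi>_lip[of y x]
          by (cases "x \<le> y") (auto simp: dist_real_def)
      qed simp
      then have "continuous_on {a..b} \<Phi>"
        using lipschitz_on_continuous_on continuous_on_subset by blast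
      then show "continuous_on {a..b} k"
        unfolding k_def by (intro continuous_intros lipschitz_on_continuous_on[OF lip])
      fix x assume x: "a \<le> x" "x < b"
      show "\<exists>d>0. \<forall>t. x < t \<and> t < x + d \<and> t \<le> b \<longrightarrow> k t \<le> k x"
      proof (cases "x \<in> N")
        case True
        then obtain d where d: "d > 0" "ball x d \<subseteq> U" using U by (meson open_contains_ball subsetD)
        show ?thesis
        proof (intro exI[of _ d] conjI allI impI)
          fix t assume t: "x < t \<and> t < x + d \<and> t \<le> b"
          then have "{x..t} \<subseteq> U" using d by (auto simp: ball_def dist_real_def intro!: subsetD[OF d(2)])
          then have p: "\<Phi> t \<ge> \<Phi> x + (t - x)" using \<Phi>_grow x t by simp
          have "f t - f x \<le> C * (t - x)"
            using lipschitz_onD[OF lip, of t x] t x by (auto simp: dist_real_def)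
          moreover have "(C + \<bar>M\<bar>) * (t - x) \<le> (C + \<bar>M\<bar>) * (\<Phi> t - \<Phi> x)"
            using p C by (intro mult_left_mono) auto
          moreover have "0 \<le> (\<bar>M\<bar> + M + e) * (t - x)" using t e by (intro mult_nonneg_nonneg) auto
          ultimately show "k t \<le> k x" unfolding k_def by (simp add: algebra_simps)
        qed (use d in auto)
      next
        case False
        then obtain D where D: "(f has_real_derivative D) (at x within {a..b})" "D \<le> M"
          using der[of x] x by auto
        from D(1)[unfolded has_field_derivative_def has_derivative_within_alt] e obtain d where
          d: "d > 0" "\<And>y. y \<in> {a..b} \<Longrightarrow> \<bar>y - x\<bar> < d \<Longrightarrow> \<bar>f y - f x - D * (y - x)\<bar> \<le> e * \<bar>y - x\<bar>"
          by (metis real_norm_def)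
        show ?thesis
        proof (intro exI[of _ d] conjI allI impI)
          fix t assume t: "x < t \<and> t < x + d \<and> t \<le> b"
          then have "f t - f x \<le> D * (t - x) + e * (t - x)" using d(2)[of t] x by auto
          moreover have "D * (t - x) \<le> M * (t - x)" using D t by (intro mult_right_mono) auto
          moreover have "(C + \<bar>M\<bar>) * \<Phi> x \<le> (C + \<bar>M\<bar>) * \<Phi> t"
            using \<Phi>_mono[of x t] t C by (intro mult_left_mono) auto
          ultimately show "k t \<le> k x" unfolding k_def by (simp add: algebra_simps)
        qed (use d in auto)
      qed
    qed
    moreover have "\<Phi> b \<le> e"
    proof -
      have "\<Phi> b \<le> measure lebesgue U"
        unfolding \<Phi>_def by (rule measure_mono_fmeasurable) (use U lm in \<open>auto simp: fmeasurableD\<close>)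
      then show ?thesis using U(4) by simp
    qed
    then have "(C + \<bar>M\<bar>) * \<Phi> b \<le> (C + \<bar>M\<bar>) * e" using C by (simp add: mult_left_mono)
    moreover have "0 \<le> (C + \<bar>M\<bar>) * \<Phi> a" using C by (simp add: \<Phi>_def)
    ultimately show ?thesis unfolding k_def by (simp add: algebra_simps)
  qed
  show ?thesis
  proof (rule field_le_epsilon)
    fix e :: real assume e: "e > 0"
    define c where "c = (b - a) + (C + \<bar>M\<bar>) + 1"
    have c: "c > 0" using ab C by (simp add: c_def)
    define d where "d = e / c"
    have d: "d > 0" using e c by (simp add: d_def)
    have "f b - f a \<le> M * (b - a) + d * ((b - a) + (C + \<bar>M\<bar>))"
      using main[OF d] by (simp add: algebra_simps)
    also have "d * ((b - a) + (C + \<bar>M\<bar>)) \<le> d * c"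
      using d by (intro mult_left_mono) (auto simp: c_def)
    finally show "f b - f a \<le> M * (b - a) + e" using c by (simp add: d_def)
  qed
qed

section \<open>Smooth functions\<close>

text \<open>\<open>iter_deriv\<close> puts each further derivative outside; this recursion strips
  the first derivative of \<open>f\<close> instead, so that sum, product and chain rules go by
  induction on the order.\<close>

fun Ck :: "nat \<Rightarrow> ('a::real_normed_vector \<Rightarrow> 'b::real_normed_vector) \<Rightarrow> bool" where
  "Ck 0 f = continuous_on UNIV f"
| "Ck (Suc n) f = ((\<forall>x. f differentiable at x) \<and> (\<forall>v. Ck n (\<lambda>x. frechet_derivative f (at x) v)))"

lemma Ck_SucI:
  assumes "\<And>x. (f has_derivative f' x) (at x)" and "\<And>v. Ck n (\<lambda>x. f' x v)"
  shows "Ck (Suc n) f"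
proof -
  have "frechet_derivative f (at x) = f' x" for x
    using frechet_derivative_at[OF assms(1)] by simp
  then show ?thesis using assms by (auto simp: differentiable_def)
qed

lemma Ck_SucE:
  assumes "Ck (Suc n) f"
  obtains f' where "\<And>x. (f has_derivative f' x) (at x)" and "\<And>v. Ck n (\<lambda>x. f' x v)"
  by (rule that[of "\<lambda>x. frechet_derivative f (at x)"])
    (use assms in \<open>auto simp: frechet_derivative_works[THEN iffD1]\<close>)

lemma Ck_imp_continuous: "Ck n f \<Longrightarrow> continuous_on S f"
proof (cases n)
  case (Suc m)
  assume "Ck n f"
  then show ?thesis
    using differentiable_imp_continuous_on[of f UNIV] continuous_on_subset[of UNIV f S]
    by (simp add: Suc differentiable_on_def)
qed (auto intro: continuous_on_subset)

lemma Ck_Suc_imp: "Ck (Suc n) f \<Longrightarrow> Ck n f"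
proof (induction n arbitrary: f)
  case 0 show ?case using Ck_imp_continuous[OF 0] by simp
qed simp

lemma Ck_const: "Ck n (\<lambda>x. c)"
proof (induction n arbitrary: c)
  case (Suc n) show ?case by (rule Ck_SucI[where f' = "\<lambda>x v. 0"]) (auto intro: Suc)
qed simp

lemma Ck_bounded_linear: "bounded_linear l \<Longrightarrow> Ck n l"
proof (induction n)
  case 0 then show ?case by (auto intro: linear_continuous_on)
next
  case (Suc n) show ?case
    by (rule Ck_SucI[where f' = "\<lambda>x. l"]) (auto intro: Ck_const bounded_linear_imp_has_derivative Suc)
qed

lemma Ck_add: "Ck n f \<Longrightarrow> Ck n g \<Longrightarrow> Ck n (\<lambda>x. f x + g x)"
proof (induction n arbitrary: f g)
  case 0 then show ?case by (auto intro: continuous_intros)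
next
  case (Suc n)
  obtain f' where f': "\<And>x. (f has_derivative f' x) (at x)" "\<And>v. Ck n (\<lambda>x. f' x v)"
    by (rule Ck_SucE[OF Suc.prems(1)]) blast
  obtain g' where g': "\<And>x. (g has_derivative g' x) (at x)" "\<And>v. Ck n (\<lambda>x. g' x v)"
    by (rule Ck_SucE[OF Suc.prems(2)]) blast
  show ?case
    by (rule Ck_SucI[where f' = "\<lambda>x v. f' x v + g' x v"]) (auto intro: Suc.IH f' g' has_derivative_add)
qed

lemma Ck_bounded_linear_comp:
  assumes l: "bounded_linear l"
  shows "Ck n f \<Longrightarrow> Ck n (\<lambda>x. l (f x))"
proof (induction n arbitrary: f)
  case 0 then show ?case
    using bounded_linear.continuous_on[OF l] by auto
next
  case (Suc n)
  obtain f' where f': "\<And>x. (f has_derivative f' x) (at x)" "\<And>v. Ck n (\<lambda>x. f' x v)"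
    by (rule Ck_SucE[OF Suc.prems]) blast
  show ?case
    by (rule Ck_SucI[where f' = "\<lambda>x v. l (f' x v)"])
      (auto intro: Suc.IH f' bounded_linear.has_derivative[OF l])
qed

lemma Ck_comp_bounded_linear:
  assumes l: "bounded_linear l"
  shows "Ck n f \<Longrightarrow> Ck n (\<lambda>x. f (l x))"
proof (induction n arbitrary: f)
  case 0 then show ?case
    using continuous_on_compose2[of UNIV f UNIV l] linear_continuous_on[OF l] by auto
next
  case (Suc n)
  obtain f' where f': "\<And>x. (f has_derivative f' x) (at x)" "\<And>v. Ck n (\<lambda>x. f' x v)"
    by (rule Ck_SucE[OF Suc.prems]) blast
  show ?case
    by (rule Ck_SucI[where f' = "\<lambda>x v. f' (l x) (l v)"])
      (auto intro: Suc.IH f' has_derivative_compose[OF bounded_linear_imp_has_derivative[OF l]])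
qed

lemma Ck_bounded_bilinear:
  assumes b: "bounded_bilinear b"
  shows "Ck n f \<Longrightarrow> Ck n g \<Longrightarrow> Ck n (\<lambda>x. b (f x) (g x))"
proof (induction n arbitrary: f g)
  case 0 then show ?case
    using bounded_bilinear.continuous_on[OF b] by auto
next
  case (Suc n)
  obtain f' where f': "\<And>x. (f has_derivative f' x) (at x)" "\<And>v. Ck n (\<lambda>x. f' x v)"
    by (rule Ck_SucE[OF Suc.prems(1)]) blast
  obtain g' where g': "\<And>x. (g has_derivative g' x) (at x)" "\<And>v. Ck n (\<lambda>x. g' x v)"
    by (rule Ck_SucE[OF Suc.prems(2)]) blast
  show ?case
  proof (rule Ck_SucI[where f' = "\<lambda>x v. b (f x) (g' x v) + b (f' x v) (g x)"])
    show "((\<lambda>x. b (f x) (g x)) has_derivative (\<lambda>v. b (f x) (g' x v) + b (f' x v) (g x))) (at x)" for x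
      by (rule bounded_bilinear.FDERIV[OF b f'(1) g'(1)])
    show "Ck n (\<lambda>x. b (f x) (g' x v) + b (f' x v) (g x))" for v
      by (rule Ck_add[OF Suc.IH[OF Ck_Suc_imp[OF Suc.prems(1)] g'(2)] Suc.IH[OF f'(2) Ck_Suc_imp[OF Suc.prems(2)]]])
  qed
qed

lemmas Ck_scaleR = Ck_bounded_bilinear[OF bounded_bilinear_scaleR]
lemmas Ck_mult = Ck_bounded_bilinear[OF bounded_bilinear_mult]
lemmas Ck_inner = Ck_bounded_bilinear[OF bounded_bilinear_inner]
lemmas Ck_minus = Ck_bounded_linear_comp[OF bounded_linear_minus[OF bounded_linear_ident]]

lemma Ck_diff: "Ck n f \<Longrightarrow> Ck n g \<Longrightarrow> Ck n (\<lambda>x. f x - g x)"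
  using Ck_add[of n f "\<lambda>x. - g x"] Ck_minus[of n g] by simp

lemma norm_cross3_le: "norm (cross3 a b) \<le> norm a * norm b"
proof (rule power2_le_imp_le)
  show "(norm (cross3 a b))\<^sup>2 \<le> (norm a * norm b)\<^sup>2"
    using norm_cross_dot[of a b] zero_le_power2[of "a \<bullet> b"] by linarith
qed simp

lemma bounded_bilinear_cross3: "bounded_bilinear cross3"
proof
  show "\<exists>K. \<forall>a b. norm (cross3 a b) \<le> norm a * norm b * K"
    by (intro exI[of _ 1]) (simp add: norm_cross3_le)
qed (rule cross_add_left cross_add_right cross_mult_left cross_mult_right)+

lemma Ck_SucI_real:
  assumes "\<And>x. (f has_vector_derivative f' x) (at x)" and "Ck n f'"
  shows "Ck (Suc n) f"
  by (rule Ck_SucI[where f' = "\<lambda>x v. v *\<^sub>R f' x"])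
    (use assms in \<open>auto simp: has_vector_derivative_def intro: Ck_scaleR Ck_const\<close>)

lemma Ck_SucE_real:
  assumes "Ck (Suc n) f"
  obtains f' where "\<And>x. (f has_vector_derivative f' x) (at x)" and "Ck n f'"
proof -
  obtain f' where f': "\<And>x. (f has_derivative f' x) (at x)" "\<And>v. Ck n (\<lambda>x. f' x v)"
    by (rule Ck_SucE[OF assms]) blast
  have *: "f' x = (\<lambda>v. v *\<^sub>R f' x 1)" for x
  proof
    show "f' x v = v *\<^sub>R f' x 1" for v
      using linear_scale[OF has_derivative_linear[OF f'(1)], of x v 1] by simp
  qed
  show ?thesis
  proof (rule that[of "\<lambda>x. f' x 1"])
    show "(f has_vector_derivative f' x 1) (at x)" for x
      unfolding has_vector_derivative_def using f'(1)[of x] by (subst *[symmetric])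
  qed (rule f'(2))
qed

lemma Ck_comp_real:
  fixes \<phi> :: "real \<Rightarrow> 'b::real_normed_vector" and g :: "'a::real_normed_vector \<Rightarrow> real"
  shows "Ck n \<phi> \<Longrightarrow> Ck n g \<Longrightarrow> Ck n (\<lambda>x. \<phi> (g x))"
proof (induction n arbitrary: \<phi>)
  case 0 then show ?case using continuous_on_compose2[of UNIV \<phi> UNIV g] by auto
next
  case (Suc n)
  obtain \<phi>' where p: "\<And>x. (\<phi> has_vector_derivative \<phi>' x) (at x)" "Ck n \<phi>'"
    by (rule Ck_SucE_real[OF Suc.prems(1)]) blast
  obtain g' where g': "\<And>x. (g has_derivative g' x) (at x)" "\<And>v. Ck n (\<lambda>x. g' x v)"
    by (rule Ck_SucE[OF Suc.prems(2)]) blast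
  show ?case
  proof (rule Ck_SucI[where f' = "\<lambda>x v. g' x v *\<^sub>R \<phi>' (g x)"])
    show "((\<lambda>x. \<phi> (g x)) has_derivative (\<lambda>v. g' x v *\<^sub>R \<phi>' (g x))) (at x)" for x
      using has_derivative_compose[OF g'(1) p(1)[unfolded has_vector_derivative_def]] .
    show "Ck n (\<lambda>x. g' x v *\<^sub>R \<phi>' (g x))" for v
      by (intro Ck_scaleR g' Suc.IH p Ck_Suc_imp[OF Suc.prems(2)])
  qed
qed

text \<open>The derivative in direction \<open>v\<close> is again a parameter integral, of the
  derivative of \<open>H\<close> in direction \<open>(v, 0)\<close>, so the induction
  closes.\<close>

lemma Ck_integral:
  fixes H :: "'a::euclidean_space \<times> real \<Rightarrow> 'b::banach"
  shows "Ck n H \<Longrightarrow> Ck n (\<lambda>x. integral {a..b} (\<lambda>s. H (x, s)))"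
proof (induction n arbitrary: H)
  case 0
  then have "continuous_on (UNIV \<times> cbox a b) (\<lambda>(x, s). H (x, s))"
    by (auto intro: continuous_on_subset)
  then show ?case using integral_continuous_on_param[of UNIV a b "\<lambda>x s. H (x, s)"] by simp
next
  case (Suc n)
  obtain H' where H': "\<And>x. (H has_derivative H' x) (at x)" "\<And>v. Ck n (\<lambda>x. H' x v)"
    by (rule Ck_SucE[OF Suc.prems]) blast
  show ?case
  proof (rule Ck_SucI[where f' = "\<lambda>x v. integral {a..b} (\<lambda>s. H' (x, s) (v, 0))"])
    fix x
    show "((\<lambda>x. integral {a..b} (\<lambda>s. H (x, s))) has_derivative (\<lambda>v. integral {a..b} (\<lambda>s. H' (x, s) (v, 0)))) (at x)"
    proof (rule has_derivative_integral_param)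
      fix x :: 'a and s :: real
      have "((\<lambda>x. (x, s)) has_derivative (\<lambda>v. (v, 0))) (at x)"
        by (intro derivative_intros)
      from has_derivative_compose[OF this H'(1)]
      show "((\<lambda>x. H (x, s)) has_derivative (\<lambda>v. H' (x, s) (v, 0))) (at x)" .
    next
      fix v :: 'a
      show "continuous_on (UNIV \<times> {a..b}) (\<lambda>(x, s). H' (x, s) (v, 0))"
        using Ck_imp_continuous[OF H'(2)] by (simp add: case_prod_unfold)
    next
      fix x
      have "continuous_on (UNIV \<times> {a..b}) (\<lambda>(x, s). H (x, s))"
        using Ck_imp_continuous[OF Suc.prems] by simp
      from continuous_on_curry(1)[OF this] show "continuous_on {a..b} (\<lambda>s. H (x, s))" by simp
    qed
  next
    fix v
    show "Ck n (\<lambda>x. integral {a..b} (\<lambda>s. H' (x, s) (v, 0)))"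
      using Suc.IH[OF H'(2)[of "(v, 0)"]] .
  qed
qed

definition smooth :: "('a::real_normed_vector \<Rightarrow> 'b::real_normed_vector) \<Rightarrow> bool" where
  "smooth f \<longleftrightarrow> (\<forall>n. Ck n f)"

lemma iter_deriv_append: "iter_deriv S (vs @ ws) f = iter_deriv S vs (iter_deriv S ws f)"
  by (induction vs) auto

text \<open>The two recursions strip derivatives from opposite ends of the list; appending
  \<open>[v]\<close> at the inner end reconciles them.\<close>

lemma smooth_on_UNIV_iff: "smooth_on UNIV f \<longleftrightarrow> smooth f"
proof
  assume "smooth_on UNIV f"
  then have "Ck n f" for n
  proof (induction n arbitrary: f)
    case 0 then show ?case unfolding smooth_on_def by (metis Ck.simps(1) iter_deriv.simps(1))
  next
    case (Suc n)
    have 1: "f differentiable at x" for x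
      using Suc.prems unfolding smooth_on_def by (metis UNIV_I iter_deriv.simps(1))
    have 2: "smooth_on UNIV (dir_deriv UNIV v f)" for v
      unfolding smooth_on_def
    proof
      fix vs
      have "iter_deriv UNIV vs (dir_deriv UNIV v f) = iter_deriv UNIV (vs @ [v]) f"
        by (simp add: iter_deriv_append)
      then show "continuous_on UNIV (iter_deriv UNIV vs (dir_deriv UNIV v f)) \<and>
          (\<forall>x\<in>UNIV. iter_deriv UNIV vs (dir_deriv UNIV v f) differentiable at x)"
        using Suc.prems unfolding smooth_on_def by metis
    qed
    have "Ck n (\<lambda>x. frechet_derivative f (at x) v)" for v
      using Suc.IH[OF 2[of v]] by (simp add: dir_deriv_def[abs_def])
    then show ?case using 1 by simp
  qed
  then show "smooth f" by (simp add: smooth_def)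
next
  assume f: "smooth f"
  have "smooth (iter_deriv UNIV vs f)" for vs
  proof (induction vs)
    case (Cons v vs)
    have "Ck n (dir_deriv UNIV v (iter_deriv UNIV vs f))" for n
      using Cons[unfolded smooth_def, rule_format, of "Suc n"] by (simp add: dir_deriv_def[abs_def])
    then show ?case by (simp add: smooth_def)
  qed (use f in simp)
  then show "smooth_on UNIV f"
    unfolding smooth_on_def smooth_def by (metis Ck.simps Ck_imp_continuous)
qed

lemma smooth_const: "smooth (\<lambda>x. c)" by (simp add: smooth_def Ck_const)
lemma smooth_linear: "bounded_linear l \<Longrightarrow> smooth l" by (simp add: smooth_def Ck_bounded_linear)
lemma smooth_add: "smooth f \<Longrightarrow> smooth g \<Longrightarrow> smooth (\<lambda>x. f x + g x)" by (simp add: smooth_def Ck_add)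
lemma smooth_diff: "smooth f \<Longrightarrow> smooth g \<Longrightarrow> smooth (\<lambda>x. f x - g x)" by (simp add: smooth_def Ck_diff)
lemma smooth_minus: "smooth f \<Longrightarrow> smooth (\<lambda>x. - f x)" by (simp add: smooth_def Ck_minus)
lemma smooth_scaleR: "smooth f \<Longrightarrow> smooth g \<Longrightarrow> smooth (\<lambda>x. f x *\<^sub>R g x)" by (simp add: smooth_def Ck_scaleR)
lemma smooth_inner: "smooth f \<Longrightarrow> smooth g \<Longrightarrow> smooth (\<lambda>x. f x \<bullet> g x)" by (simp add: smooth_def Ck_inner)
lemma smooth_mult: "smooth f \<Longrightarrow> smooth g \<Longrightarrow> smooth (\<lambda>x. f x * g x :: real)" by (simp add: smooth_def Ck_mult)
lemma smooth_cross3: "smooth f \<Longrightarrow> smooth g \<Longrightarrow> smooth (\<lambda>x. cross3 (f x) (g x))"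
  by (simp add: smooth_def Ck_bounded_bilinear[OF bounded_bilinear_cross3])
lemma smooth_bounded_linear_comp: "bounded_linear l \<Longrightarrow> smooth f \<Longrightarrow> smooth (\<lambda>x. l (f x))"
  by (simp add: smooth_def Ck_bounded_linear_comp)
lemma smooth_comp_bounded_linear: "bounded_linear l \<Longrightarrow> smooth f \<Longrightarrow> smooth (\<lambda>x. f (l x))"
  by (simp add: smooth_def Ck_comp_bounded_linear)
lemma smooth_comp_real: "smooth \<phi> \<Longrightarrow> smooth g \<Longrightarrow> smooth (\<lambda>x. \<phi> (g x :: real))"
  by (simp add: smooth_def Ck_comp_real)
lemma smooth_integral:
  fixes H :: "'a::euclidean_space \<times> real \<Rightarrow> 'b::banach"
  shows "smooth H \<Longrightarrow> smooth (\<lambda>x. integral {a..b} (\<lambda>s. H (x, s)))"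
  by (simp add: smooth_def Ck_integral)
lemma smooth_comp_snd: "smooth f \<Longrightarrow> smooth (\<lambda>p. f (snd p))"
  by (rule smooth_comp_bounded_linear[OF bounded_linear_snd])
lemma smooth_fst: "smooth fst" by (rule smooth_linear[OF bounded_linear_fst])
lemma smooth_ident: "smooth (\<lambda>x. x)" by (rule smooth_linear[OF bounded_linear_ident])

lemmas smooth_intros = smooth_const smooth_add smooth_diff smooth_minus smooth_scaleR smooth_inner
  smooth_mult smooth_cross3 smooth_comp_snd smooth_fst smooth_ident

lemma smooth_imp_continuous: "smooth f \<Longrightarrow> continuous_on S f"
  unfolding smooth_def using Ck_imp_continuous by blast

lemma smooth_has_derivative:
  assumes "smooth f"
  shows "(f has_derivative frechet_derivative f (at x)) (at x)"
    and "smooth (\<lambda>x. frechet_derivative f (at x) v)"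
proof -
  have "Ck (Suc n) f" for n using assms by (simp add: smooth_def del: Ck.simps)
  then show "(f has_derivative frechet_derivative f (at x)) (at x)" "smooth (\<lambda>x. frechet_derivative f (at x) v)"
    by (auto simp: frechet_derivative_works[symmetric] smooth_def)
qed

lemma smooth_of_vector_derivative:
  assumes "\<And>x. (f has_vector_derivative f' x) (at x)" and "smooth f'"
  shows "smooth f"
  unfolding smooth_def
proof
  fix n show "Ck n f"
    using Ck_Suc_imp[OF Ck_SucI_real[OF assms(1)]] assms(2) by (simp add: smooth_def)
qed

text \<open>The iterated derivatives of \<open>exp (- 1 / x)\<close> are linear combinations of these functions.\<close>
definition flat :: "nat \<Rightarrow> real \<Rightarrow> real" where
  "flat n x = (if x > 0 then inverse x ^ n * exp (- inverse x) else 0)"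

text \<open>A single term of the exponential series at \<open>1 / x\<close> gives the bound. The
  factor \<open>x ^ 2\<close> makes the difference quotient at 0 vanish.\<close>

lemma flat_le: "\<bar>flat n x\<bar> \<le> fact (n + 2) * x ^ 2"
proof (cases "x > 0")
  case True
  define y where "y = inverse x"
  have y: "y > 0" using True by (simp add: y_def)
  have "y ^ (n + 2) / fact (n + 2) \<le> exp y"
  proof -
    have "(\<Sum>k\<in>{n + 2}. y ^ k / fact k) \<le> (\<Sum>k. y ^ k / fact k)"
      using y summable_exp[of y] by (intro sum_le_suminf) (auto simp: field_simps)
    then show ?thesis by (simp add: exp_def field_simps)
  qed
  then have "y ^ (n + 2) \<le> exp y * fact (n + 2)"
    by (subst (asm) pos_divide_le_eq) simp_all
  then have "y ^ (n + 2) * exp (- y) \<le> exp y * fact (n + 2) * exp (- y)"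
    by (rule mult_right_mono) simp
  then have "y ^ (n + 2) * exp (- y) \<le> fact (n + 2)"
    by (simp only: mult.commute[of "exp y"] mult.assoc exp_minus_inverse mult_1_right)
  then have "y ^ n * exp (- y) * y ^ 2 \<le> fact (n + 2)" by (simp add: power2_eq_square mult_ac)
  then have "y ^ n * exp (- y) * y ^ 2 * x ^ 2 \<le> fact (n + 2) * x ^ 2" by (intro mult_right_mono) auto
  moreover have "y ^ 2 * x ^ 2 = 1" using True by (simp add: y_def power_mult_distrib[symmetric])
  ultimately have "y ^ n * exp (- y) \<le> fact (n + 2) * x ^ 2" by (simp add: mult.assoc)
  then show ?thesis using y True by (simp add: flat_def y_def)
qed (simp add: flat_def)

lemma flat_has_derivative:
  "(flat n has_real_derivative (flat (n + 2) x - real n * flat (n + 1) x)) (at x)"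
proof -
  consider "x > 0" | "x < 0" | "x = 0" by linarith
  then show ?thesis
  proof cases
    case 1
    have "((\<lambda>x. inverse x ^ n * exp (- inverse x)) has_real_derivative (flat (n + 2) x - real n * flat (n + 1) x)) (at x)"
    proof (rule DERIV_cong)
      show "((\<lambda>x. inverse x ^ n * exp (- inverse x)) has_real_derivative
          (real n * inverse x ^ (n - 1) * - (inverse x * inverse x)) * exp (- inverse x)
          + inverse x ^ n * (exp (- inverse x) * (inverse x * inverse x))) (at x)"
        using 1 by (auto intro!: derivative_eq_intros)
      show "(real n * inverse x ^ (n - 1) * - (inverse x * inverse x)) * exp (- inverse x)
          + inverse x ^ n * (exp (- inverse x) * (inverse x * inverse x)) = flat (n + 2) x - real n * flat (n + 1) x"
        using 1 by (cases n) (simp_all add: flat_def algebra_simps)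
    qed
    then show ?thesis
      by (rule has_field_derivative_transform_within_open[where S = "{0<..}"]) (use 1 in \<open>auto simp: flat_def\<close>)
  next
    case 2
    have "((\<lambda>x. 0) has_real_derivative (flat (n + 2) x - real n * flat (n + 1) x)) (at x)"
      using 2 by (auto simp: flat_def)
    then show ?thesis
      by (rule has_field_derivative_transform_within_open[where S = "{..<0}"]) (use 2 in \<open>auto simp: flat_def\<close>)
  next
    case 3
    have "((\<lambda>h. flat n h / h) \<longlongrightarrow> 0) (at 0)"
    proof (rule Lim_null_comparison)
      show "\<forall>\<^sub>F h in at 0. norm (flat n h / h) \<le> fact (n + 2) * \<bar>h\<bar>"
      proof (rule eventuallyI)
        fix h :: real
        show "norm (flat n h / h) \<le> fact (n + 2) * \<bar>h\<bar>"
          using flat_le[of n h] by (cases "h = 0") (auto simp: divide_le_eq power2_eq_square abs_mult mult.assoc)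
      qed
      show "((\<lambda>h. fact (n + 2) * \<bar>h\<bar>) \<longlongrightarrow> 0) (at (0::real))"
        by (rule tendsto_eq_intros refl | simp)+
    qed
    then show ?thesis using 3 by (simp add: DERIV_def flat_def)
  qed
qed

lemma smooth_flat: "smooth (flat n)"
  unfolding smooth_def
proof
  fix k show "Ck k (flat n)"
  proof (induction k arbitrary: n)
    case 0
    have "flat n differentiable_on UNIV"
      unfolding differentiable_on_def using flat_has_derivative
      by (meson UNIV_I real_differentiable_def has_field_derivative_imp_has_derivative differentiableI)
    then show ?case by (simp add: differentiable_imp_continuous_on)
  next
    case (Suc k)
    show ?case
      by (rule Ck_SucI_real[OF flat_has_derivative[unfolded has_real_derivative_iff_has_vector_derivative]])
        (intro Ck_diff Ck_mult Ck_const Suc)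
  qed
qed

section \<open>Calibrating vector fields along a curve\<close>

lemmas has_vector_derivative_inner = bounded_bilinear.has_vector_derivative[OF bounded_bilinear_inner]
lemmas has_vector_derivative_cross3 = bounded_bilinear.has_vector_derivative[OF bounded_bilinear_cross3]
lemmas has_vector_derivative_scaleR' = bounded_bilinear.has_vector_derivative[OF bounded_bilinear_scaleR]
lemmas has_vector_derivative_times = bounded_bilinear.has_vector_derivative[OF bounded_bilinear_mult]
lemmas continuous_on_cross3 = bounded_bilinear.continuous_on[OF bounded_bilinear_cross3]

lemma has_vector_derivative_shift:
  assumes "(f has_vector_derivative f') (at (s + c))"
  shows "((\<lambda>s. f (s + c)) has_vector_derivative f') (at (s::real))"
proof -
  have "((\<lambda>s. s + c) has_vector_derivative 1) (at s)"
    by (auto intro!: derivative_eq_intros)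
  from vector_diff_chain_at[OF this assms] show ?thesis by (simp add: o_def)
qed

lemma has_vector_derivative_periodic:
  assumes "\<And>s. (f has_vector_derivative f' s) (at s)" and "\<And>s. f (s + L) = f s"
  shows "f' (s + L) = f' (s::real)"
proof -
  have "((\<lambda>s. f (s + L)) has_vector_derivative f' (s + L)) (at s)"
    by (rule has_vector_derivative_shift[OF assms(1)])
  then have "(f has_vector_derivative f' (s + L)) (at s)" by (simp add: assms(2))
  from vector_derivative_unique_at[OF this assms(1)] show ?thesis .
qed

text \<open>With \<open>P\<close> an antiderivative, \<open>P (u + L) - P u\<close> has derivative
  \<open>p (u + L) - p u = 0\<close>, so its values at \<open>c\<close> and at 0 agree.\<close>

lemma integral_periodic_shift:
  fixes p :: "real \<Rightarrow> 'b::euclidean_space"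
  assumes cont: "continuous_on UNIV p" and per: "\<And>s. p (s + L) = p s" and L: "L \<ge> 0"
  shows "integral {c..c + L} p = integral {0..L} p"
proof -
  \<comment> \<open>The antiderivative is taken on a compact interval; the margin 1 keeps
    \<open>u\<close> and \<open>u + L\<close> in its interior for all \<open>u\<close> between 0 and
    \<open>c\<close>.\<close>
  define b where "b = \<bar>c\<bar> + L"
  obtain P where P: "\<And>x. x \<in> {-b - 1..b + 1} \<Longrightarrow> (P has_vector_derivative p x) (at x within {-b - 1..b + 1})"
    using antiderivative_continuous[of "-b - 1" "b + 1" p] continuous_on_subset[OF cont] by blast
  have P': "(P has_vector_derivative p x) (at x)" if "x \<in> {-b - 1<..<b + 1}" for x
    using P[of x] that at_within_Icc_at[of "-b - 1" x "b + 1"] by auto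
  have ftc: "integral {u..u + L} p = P (u + L) - P u" if "u \<in> closed_segment 0 c" for u
  proof (rule integral_unique, rule fundamental_theorem_of_calculus)
    fix x assume "x \<in> {u..u + L}"
    then have "x \<in> {-b - 1<..<b + 1}" using that L
      by (auto simp: b_def closed_segment_eq_real_ivl split: if_splits)
    then show "(P has_vector_derivative p x) (at x within {u..u + L})"
      using P' has_vector_derivative_at_within by blast
  qed (use L in simp)
  have "(\<lambda>u. P (u + L) - P u) c = (\<lambda>u. P (u + L) - P u) 0"
  proof (rule has_derivative_zero_unique[of "closed_segment 0 c"])
    fix u assume u: "u \<in> closed_segment 0 c"
    then have "u \<in> {-b - 1<..<b + 1}" "u + L \<in> {-b - 1<..<b + 1}" using L
      by (auto simp: b_def closed_segment_eq_real_ivl split: if_splits)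
    then have "((\<lambda>u. P (u + L) - P u) has_vector_derivative p (u + L) - p u) (at u)"
      by (intro has_vector_derivative_diff has_vector_derivative_shift P')
    then show "((\<lambda>u. P (u + L) - P u) has_derivative (\<lambda>h. 0)) (at u within closed_segment 0 c)"
      using has_derivative_at_withinI by (auto simp: has_vector_derivative_def per)
  qed auto
  then show ?thesis using ftc[of c] ftc[of 0] by simp
qed

lemma has_derivative_compose_real:
  assumes "(\<phi> has_real_derivative d) (at (u x))" and "(u has_derivative u') (at x)"
  shows "((\<lambda>x. \<phi> (u x)) has_derivative (\<lambda>v. u' v * d)) (at x)"
  using DERIV_compose_FDERIV[of \<phi> d u x, OF assms] .

lemma has_vector_derivative_compose_real:
  assumes "(\<phi> has_real_derivative d) (at (u x))" and "(u has_vector_derivative u') (at x within S)"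
  shows "((\<lambda>x. \<phi> (u x)) has_vector_derivative u' * d) (at x within S)"
  using DERIV_compose_FDERIV[of \<phi> d u x "\<lambda>h. h *\<^sub>R u'", OF assms(1)] assms(2)
  by (simp add: has_vector_derivative_def mult_ac)

text \<open>By periodicity, \<open>sep\<close> is a quantitative form of the injectivity of the closed curve \<open>g\<close>.\<close>
locale calib =
  fixes g \<tau> \<kappa> \<kappa>s :: "real \<Rightarrow> real^3" and L \<delta> r0 k0 k1 b1 b2 \<epsilon> :: real
    and f f1 f2 \<rho> \<rho>1 R :: "real \<Rightarrow> real"
  assumes L: "L > 0"
    and g_deriv: "\<And>s. (g has_vector_derivative \<tau> s) (at s)"
    and tau_deriv: "\<And>s. (\<tau> has_vector_derivative \<kappa> s) (at s)"
    and kappa_deriv: "\<And>s. (\<kappa> has_vector_derivative \<kappa>s s) (at s)"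
    and smooth_kappas: "smooth \<kappa>s"
    and g_per: "\<And>s. g (s + L) = g s"
    and unit: "\<And>s. norm (\<tau> s) = 1"
    and k0: "\<And>s. norm (\<kappa> s) \<le> k0" and k1: "\<And>s. norm (\<kappa>s s) \<le> k1"
    and sep: "\<And>s s'. \<bar>s - s'\<bar> \<le> L / 2 \<Longrightarrow> norm (g s - g s') \<le> 2 * r0 \<Longrightarrow> \<bar>s - s'\<bar> \<le> \<delta>"
    and r0: "r0 > 0" and \<delta>: "\<delta> > 0" "\<delta> \<le> L / 2" and small: "(r0 + \<delta>) * k0 \<le> 1 / 2"
    and f_deriv: "\<And>z. (f has_real_derivative f1 z) (at z)"
    and f1_deriv: "\<And>z. (f1 has_real_derivative f2 z) (at z)"
    and smooth_f: "smooth f" "smooth f1" "smooth f2"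
    and f_nonneg: "\<And>z. f z \<ge> 0" and f_le: "\<And>z. \<lbrakk>0 \<le> z; z \<le> r0\<^sup>2\<rbrakk> \<Longrightarrow> f z \<le> 1 - z / r0\<^sup>2"
    and f_0: "f 0 = 1"
    and f_out: "\<And>z. z \<ge> r0\<^sup>2 \<Longrightarrow> f z = 0 \<and> f1 z = 0 \<and> f2 z = 0"
    and b1: "\<And>z. z \<ge> 0 \<Longrightarrow> \<bar>f1 z\<bar> \<le> b1" and b2: "\<And>z. z \<ge> 0 \<Longrightarrow> \<bar>f2 z\<bar> \<le> b2"
    and smooth_rho: "smooth \<rho>" and rho_nonneg: "\<And>u. \<rho> u \<ge> 0"
    and rho_deriv: "\<And>u. (\<rho> has_real_derivative \<rho>1 u) (at u)" and rho1_cont: "continuous_on UNIV \<rho>1"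
    and R_deriv: "\<And>u. (R has_real_derivative \<rho> u) (at u)"
    and R_bounds: "\<And>u. 0 \<le> R u" "\<And>u. R u \<le> 1"
    and R_lo: "\<And>u. u \<le> - \<epsilon> \<Longrightarrow> R u = 0" and R_hi: "\<And>u. u \<ge> \<epsilon> \<Longrightarrow> R u = 1"
    and rho_out: "\<And>u. \<bar>u\<bar> \<ge> \<epsilon> \<Longrightarrow> \<rho> u = 0"
    and \<epsilon>: "\<epsilon> > 0"
begin

lemma smooth_kappa: "smooth \<kappa>" by (rule smooth_of_vector_derivative[OF kappa_deriv smooth_kappas])
lemma smooth_tau: "smooth \<tau>" by (rule smooth_of_vector_derivative[OF tau_deriv smooth_kappa])
lemma smooth_g: "smooth g" by (rule smooth_of_vector_derivative[OF g_deriv smooth_tau])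

lemma tau_per: "\<tau> (s + L) = \<tau> s" by (rule has_vector_derivative_periodic[OF g_deriv g_per])
lemma kappa_per: "\<kappa> (s + L) = \<kappa> s" by (rule has_vector_derivative_periodic[OF tau_deriv tau_per])
lemma kappas_per: "\<kappa>s (s + L) = \<kappa>s s" by (rule has_vector_derivative_periodic[OF kappa_deriv kappa_per])

lemma at_L: "g L = g 0" "\<tau> L = \<tau> 0" "\<kappa> L = \<kappa> 0" "\<kappa>s L = \<kappa>s 0"
  using g_per[of 0] tau_per[of 0] kappa_per[of 0] kappas_per[of 0] by simp_all

lemma smooth_comps:
  "continuous_on UNIV g" "continuous_on UNIV \<tau>" "continuous_on UNIV \<kappa>" "continuous_on UNIV \<kappa>s"
  "continuous_on UNIV f" "continuous_on UNIV f1" "continuous_on UNIV f2" "continuous_on UNIV \<rho>"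
  using smooth_g smooth_tau smooth_kappa smooth_kappas smooth_f smooth_rho by (auto intro: smooth_imp_continuous)

lemmas comp_cont [continuous_intros] =
  smooth_comps(1)[THEN continuous_on_compose2, OF _ subset_UNIV]
  smooth_comps(2)[THEN continuous_on_compose2, OF _ subset_UNIV]
  smooth_comps(3)[THEN continuous_on_compose2, OF _ subset_UNIV]
  smooth_comps(4)[THEN continuous_on_compose2, OF _ subset_UNIV]
  smooth_comps(5)[THEN continuous_on_compose2, OF _ subset_UNIV]
  smooth_comps(6)[THEN continuous_on_compose2, OF _ subset_UNIV]
  smooth_comps(7)[THEN continuous_on_compose2, OF _ subset_UNIV]
  smooth_comps(8)[THEN continuous_on_compose2, OF _ subset_UNIV]
  rho1_cont[THEN continuous_on_compose2, OF _ subset_UNIV]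
  continuous_on_cross3

lemma tau_tau: "\<tau> s \<bullet> \<tau> s = 1"
  using unit[of s] by (simp add: norm_eq_1)

lemma tau_kappa: "\<tau> s \<bullet> \<kappa> s = 0"
proof -
  have "((\<lambda>s. \<tau> s \<bullet> \<tau> s) has_vector_derivative \<tau> s \<bullet> \<kappa> s + \<kappa> s \<bullet> \<tau> s) (at s)"
    by (rule has_vector_derivative_inner[OF tau_deriv tau_deriv])
  then have "((\<lambda>s. 1::real) has_vector_derivative \<tau> s \<bullet> \<kappa> s + \<kappa> s \<bullet> \<tau> s) (at s)"
    by (simp add: tau_tau)
  from vector_derivative_unique_at[OF this has_vector_derivative_const]
  show ?thesis by (simp add: inner_commute)
qed

definition F where "F x s = (x - g s) \<bullet> \<tau> s"
definition \<nu> where "\<nu> x s = 1 - (x - g s) \<bullet> \<kappa> s"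
definition q where "q x s = (x - g s) \<bullet> (x - g s)"

lemma F_x: "((\<lambda>x. F x s) has_derivative (\<lambda>v. v \<bullet> \<tau> s)) (at x)"
  unfolding F_def by (auto intro!: derivative_eq_intros)
lemma nu_x: "((\<lambda>x. \<nu> x s) has_derivative (\<lambda>v. - (v \<bullet> \<kappa> s))) (at x)"
  unfolding \<nu>_def by (auto intro!: derivative_eq_intros)
lemma q_x: "((\<lambda>x. q x s) has_derivative (\<lambda>v. 2 * ((x - g s) \<bullet> v))) (at x)"
  unfolding q_def by (auto intro!: derivative_eq_intros simp: inner_commute)

lemma y_s: "((\<lambda>s. x - g s) has_vector_derivative - \<tau> s) (at s)"
  by (auto intro!: derivative_eq_intros g_deriv)
lemma F_s: "(F x has_vector_derivative - \<nu> x s) (at s)"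
  unfolding F_def
  by (rule has_vector_derivative_eq_rhs[OF has_vector_derivative_inner[OF y_s tau_deriv]])
    (simp add: \<nu>_def tau_tau)
lemma nu_s: "(\<nu> x has_vector_derivative - ((x - g s) \<bullet> \<kappa>s s)) (at s)"
  unfolding \<nu>_def
  by (rule has_vector_derivative_eq_rhs[OF has_vector_derivative_diff[OF has_vector_derivative_const
        has_vector_derivative_inner[OF y_s kappa_deriv]]])
    (simp add: tau_kappa)
lemma q_s: "(q x has_vector_derivative - 2 * F x s) (at s)"
  unfolding q_def
  by (rule has_vector_derivative_eq_rhs[OF has_vector_derivative_inner[OF y_s y_s]])
    (simp add: F_def inner_commute)

lemma cont_F [continuous_intros]: "continuous_on S u \<Longrightarrow> continuous_on S v \<Longrightarrow> continuous_on S (\<lambda>p. F (u p) (v p))"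
  unfolding F_def by (intro continuous_intros)
lemma cont_nu [continuous_intros]: "continuous_on S u \<Longrightarrow> continuous_on S v \<Longrightarrow> continuous_on S (\<lambda>p. \<nu> (u p) (v p))"
  unfolding \<nu>_def by (intro continuous_intros)
lemma cont_q [continuous_intros]: "continuous_on S u \<Longrightarrow> continuous_on S v \<Longrightarrow> continuous_on S (\<lambda>p. q (u p) (v p))"
  unfolding q_def by (intro continuous_intros)

lemma Fnuq_per: "F x (s + L) = F x s" "\<nu> x (s + L) = \<nu> x s" "q x (s + L) = q x s"
  by (simp_all add: F_def \<nu>_def q_def g_per tau_per kappa_per)

lemma Fnuq_L: "F x L = F x 0" "\<nu> x L = \<nu> x 0" "q x L = q x 0"
  by (simp_all add: F_def \<nu>_def q_def at_L)

lemma smooth_F: "smooth (\<lambda>p. F (fst p) (snd p))"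
  unfolding F_def by (intro smooth_intros smooth_g smooth_tau)
lemma smooth_nu: "smooth (\<lambda>p. \<nu> (fst p) (snd p))"
  unfolding \<nu>_def by (intro smooth_intros smooth_g smooth_kappa)
lemma smooth_q: "smooth (\<lambda>p. q (fst p) (snd p))"
  unfolding q_def by (intro smooth_intros smooth_g smooth_kappa)

text \<open>A mollified evaluation of \<open>G\<close> at the foot point of \<open>x\<close>: as
  \<open>\<nu> = - \<partial>\<^sub>s F\<close>, the substitution \<open>u = F x s\<close> turns the
  weight into \<open>\<rho> u\<close> near the parameter where \<open>F x s = 0\<close>. The
  codomain is general because fields, curls and scalar potentials are all averaged.\<close>

definition A :: "(real^3 \<Rightarrow> real \<Rightarrow> 'b::euclidean_space) \<Rightarrow> real^3 \<Rightarrow> 'b" where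
  "A G x = integral {0..L} (\<lambda>s. (\<rho> (F x s) * \<nu> x s) *\<^sub>R G x s)"

text \<open>The weight \<open>\<rho>(F) \<nu>\<close> is an \<open>s\<close>-derivative, so an integration by parts turns the derivative of the
  weight into a derivative of \<open>G\<close> along \<open>s\<close>.\<close>
lemma A_has_derivative:
  fixes G :: "real^3 \<Rightarrow> real \<Rightarrow> 'b::euclidean_space"
  assumes Gx: "\<And>x s. ((\<lambda>x. G x s) has_derivative Gx x s) (at x)"
    and Gs: "\<And>x s. (G x has_vector_derivative Gs x s) (at s)"
    and cG: "continuous_on UNIV (\<lambda>p. G (fst p) (snd p))"
    and cGx: "\<And>v. continuous_on UNIV (\<lambda>p. Gx (fst p) (snd p) v)"
    and cGs: "continuous_on UNIV (\<lambda>p. Gs (fst p) (snd p))"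
    and per: "\<And>x. G x L = G x 0"
  shows "(A G has_derivative (\<lambda>v. integral {0..L} (\<lambda>s. \<rho> (F x s) *\<^sub>R
           (\<nu> x s *\<^sub>R Gx x s v + (v \<bullet> \<tau> s) *\<^sub>R Gs x s)))) (at x)"
proof -
  have cs: "continuous_on S (\<lambda>s. G x s)" "continuous_on S (\<lambda>s. Gx x s v)" "continuous_on S (\<lambda>s. Gs x s)" for S x v
    using continuous_on_compose2[OF cG, of S "\<lambda>s. (x, s)"]
      continuous_on_compose2[OF cGx, of S "\<lambda>s. (x, s)" v]
      continuous_on_compose2[OF cGs, of S "\<lambda>s. (x, s)"]
    by (simp_all add: continuous_on_Pair continuous_on_const continuous_on_id)
  note cG' = continuous_on_subset[OF cG subset_UNIV] continuous_on_subset[OF cGx subset_UNIV]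
    continuous_on_subset[OF cGs subset_UNIV]
  define H' where "H' x s v = ((v \<bullet> \<tau> s) * \<rho>1 (F x s) * \<nu> x s - \<rho> (F x s) * (v \<bullet> \<kappa> s)) *\<^sub>R G x s
      + (\<rho> (F x s) * \<nu> x s) *\<^sub>R Gx x s v" for x s v
  have 1: "((\<lambda>x. integral {0..L} (\<lambda>s. (\<rho> (F x s) * \<nu> x s) *\<^sub>R G x s)) has_derivative
      (\<lambda>v. integral {0..L} (\<lambda>s. H' x s v))) (at x)"
  proof (rule has_derivative_integral_param)
    show "((\<lambda>x. (\<rho> (F x s) * \<nu> x s) *\<^sub>R G x s) has_derivative H' x s) (at x)" for x s
      unfolding H'_def
      by (rule has_derivative_eq_rhs[OF has_derivative_scaleR[OF has_derivative_mult[OF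
            has_derivative_compose_real[OF rho_deriv F_x] nu_x] Gx]])
        (auto simp: algebra_simps)
    show "continuous_on {0..L} (\<lambda>s. (\<rho> (F x s) * \<nu> x s) *\<^sub>R G x s)" for x
      by (intro continuous_intros cs)
    show "continuous_on (UNIV \<times> {0..L}) (\<lambda>(x, s). H' x s v)" for v
      unfolding H'_def case_prod_unfold by (intro continuous_intros cG')
  qed
  have 2: "integral {0..L} (\<lambda>s. H' x s v) = integral {0..L} (\<lambda>s. \<rho> (F x s) *\<^sub>R
           (\<nu> x s *\<^sub>R Gx x s v + (v \<bullet> \<tau> s) *\<^sub>R Gs x s))" (is "?a = ?b") for v
  proof -
    \<comment> \<open>Boundary term of the integration by parts; its \<open>s\<close>-derivative
      \<open>P'\<close> is the new integrand minus the old one, so \<open>P L = P 0\<close> makes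
      both integrals equal.\<close>
    define P where "P s = (\<rho> (F x s) * (v \<bullet> \<tau> s)) *\<^sub>R G x s" for s
    define P' where "P' s = \<rho> (F x s) *\<^sub>R (\<nu> x s *\<^sub>R Gx x s v + (v \<bullet> \<tau> s) *\<^sub>R Gs x s) - H' x s v" for s
    have "(P has_vector_derivative P' s) (at s)" for s
    proof -
      have "((\<lambda>s. v \<bullet> \<tau> s) has_vector_derivative v \<bullet> \<kappa> s) (at s)"
        using has_vector_derivative_inner[OF has_vector_derivative_const tau_deriv, of v s] by simp
      from has_vector_derivative_scaleR'[OF has_vector_derivative_times[OF
          has_vector_derivative_compose_real[OF rho_deriv F_s] this] Gs]
      show ?thesis unfolding P_def P'_def H'_def
        by (rule has_vector_derivative_eq_rhs) (simp add: algebra_simps)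
    qed
    then have "(P' has_integral (P L - P 0)) {0..L}"
      using L by (intro fundamental_theorem_of_calculus) (auto intro: has_vector_derivative_at_within)
    moreover have "P L = P 0" by (simp add: P_def Fnuq_L at_L per)
    ultimately have "integral {0..L} P' = 0" by (simp add: integral_unique)
    moreover have "integral {0..L} P' = ?b - ?a"
      unfolding P'_def H'_def
      by (intro integral_diff integrable_continuous_real continuous_intros cs)
    ultimately show ?thesis by simp
  qed
  show ?thesis using 1 unfolding A_def[abs_def] 2 .
qed

end

text \<open>A \<open>C\<^sup>1\<close> extension of \<open>1 / z\<close> from \<open>z \<ge> 1 / 2\<close> to the line: \<open>\<nu>\<close> may vanish, but not on the support of \<open>f\<close>.\<close>
definition recip :: "real \<Rightarrow> real" where "recip z = (if z \<ge> 1/2 then 1 / z else 4 - 4 * z)"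
definition recip' :: "real \<Rightarrow> real" where "recip' z = - (1 / max z (1/2))\<^sup>2"

text \<open>The line \<open>4 - 4 * z\<close> is the tangent of \<open>1 / z\<close> at
  \<open>1 / 2\<close>, so both one-sided slopes there are -4; to the right the difference quotient
  misses -4 by exactly \<open>8 * h / (1 + 2 * h)\<close>.\<close>

lemma recip_deriv: "(recip has_real_derivative recip' z) (at z)"
proof -
  consider "z > 1/2" | "z < 1/2" | "z = 1/2" by linarith
  then show ?thesis
  proof cases
    case 1
    have "((\<lambda>z. 1 / z) has_real_derivative recip' z) (at z)"
      using 1 by (auto intro!: derivative_eq_intros simp: recip'_def power2_eq_square max_def field_simps)
    then show ?thesis
      by (rule has_field_derivative_transform_within_open[where S = "{1/2<..}"]) (use 1 in \<open>auto simp: recip_def\<close>)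
  next
    case 2
    have "((\<lambda>z. 4 - 4 * z) has_real_derivative recip' z) (at z)"
      using 2 by (auto intro!: derivative_eq_intros simp: recip'_def power2_eq_square max_def)
    then show ?thesis
      by (rule has_field_derivative_transform_within_open[where S = "{..<1/2}"]) (use 2 in \<open>auto simp: recip_def\<close>)
  next
    case 3
    have "((\<lambda>h. (recip (1/2 + h) - recip (1/2)) / h - (- 4)) \<longlongrightarrow> 0) (at 0)"
    proof (rule Lim_null_comparison)
      show "\<forall>\<^sub>F h in at 0. norm ((recip (1/2 + h) - recip (1/2)) / h - (- 4)) \<le> 8 * \<bar>h\<bar>"
        unfolding eventually_at_filter
      proof (intro eventuallyI impI)
        fix h :: real assume h: "h \<noteq> 0"
        show "norm ((recip (1/2 + h) - recip (1/2)) / h - (- 4)) \<le> 8 * \<bar>h\<bar>"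
        proof (cases "h > 0")
          case True
          then have "(recip (1/2 + h) - recip (1/2)) / h = - 4 / (1 + 2 * h)"
            by (simp add: recip_def divide_simps)
          moreover have "- 4 / (1 + 2 * h) - (- 4) = 8 * h / (1 + 2 * h)" using True by (simp add: field_simps)
          moreover have "norm (8 * h / (1 + 2 * h)) \<le> 8 * \<bar>h\<bar>" using True by (simp add: field_simps)
          ultimately show ?thesis by simp
        next
          case False
          then have "(recip (1/2 + h) - recip (1/2)) / h - (- 4) = 0"
            using h by (simp add: recip_def field_simps)
          then show ?thesis by simp
        qed
      qed
      show "((\<lambda>h. 8 * \<bar>h\<bar>) \<longlongrightarrow> 0) (at (0::real))"
        by (rule tendsto_eq_intros refl | simp)+
    qed
    then have "((\<lambda>h. (recip (1/2 + h) - recip (1/2)) / h) \<longlongrightarrow> - 4) (at 0)"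
      using Lim_null[of _ "- 4"] by blast
    moreover have "recip' (1/2) = - 4" by (simp add: recip'_def power2_eq_square)
    ultimately show ?thesis unfolding 3 DERIV_def by simp
  qed
qed

lemma cont_recip: "continuous_on S recip"
  using recip_deriv DERIV_continuous_on has_field_derivative_at_within by blast
lemma cont_recip': "continuous_on S recip'"
  unfolding recip'_def by (intro continuous_intros) (auto simp: max_def)

lemma curl_eq:
  assumes "(X has_derivative D) (at x)"
  shows "curl X x = vector [D (axis 2 1) $ 3 - D (axis 3 1) $ 2, D (axis 3 1) $ 1 - D (axis 1 1) $ 3,
                      D (axis 1 1) $ 2 - D (axis 2 1) $ 1]"
  unfolding curl_def pd_def frechet_derivative_at[OF assms, symmetric] ..

text \<open>A derivative of rank one, sending \<open>v\<close> to \<open>(v \<bullet> p) c\<close>,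
  has curl \<open>cross3 p c\<close>; an integral of two such terms is what
  \<open>A_has_derivative\<close> produces for \<open>X\<close>.\<close>

lemma curl_integral_eq:
  fixes a b :: real and p1 p2 c1 c2 :: "real \<Rightarrow> real^3"
  assumes D: "(X has_derivative (\<lambda>v. integral {a..b} (\<lambda>s. (v \<bullet> p1 s) *\<^sub>R c1 s + (v \<bullet> p2 s) *\<^sub>R c2 s))) (at x)"
    and cont: "continuous_on {a..b} p1" "continuous_on {a..b} c1" "continuous_on {a..b} p2" "continuous_on {a..b} c2"
  shows "curl X x = integral {a..b} (\<lambda>s. cross3 (p1 s) (c1 s) + cross3 (p2 s) (c2 s))"
proof -
  define D where "D v s = (v \<bullet> p1 s) *\<^sub>R c1 s + (v \<bullet> p2 s) *\<^sub>R c2 s" for v s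
  have iD: "D v integrable_on {a..b}" for v
    unfolding D_def by (intro integrable_continuous_real continuous_intros cont)
  have iC: "(\<lambda>s. cross3 (p1 s) (c1 s) + cross3 (p2 s) (c2 s)) integrable_on {a..b}"
    by (intro integrable_continuous_real continuous_intros continuous_on_cross3 cont)
  have comp: "integral {a..b} (D v) $ k = integral {a..b} (\<lambda>s. D v s $ k)" for v k
    using integral_component_eq_cart[OF iD] by simp
  have ic: "(\<lambda>s. D v s $ k) integrable_on {a..b}" for v k
    unfolding D_def by (intro integrable_continuous_real continuous_intros cont)
  have ax: "axis k 1 \<bullet> v = v $ k" for k and v :: "real^3" by (simp add: inner_axis')
  have diff: "integral {a..b} (D v) $ k - integral {a..b} (D w) $ l = integral {a..b} (\<lambda>s. D v s $ k - D w s $ l)" for v w k l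
    unfolding comp by (rule integral_diff[symmetric]) (rule ic)+
  show ?thesis
    unfolding curl_eq[OF D, folded D_def] vec_eq_iff forall_3 vector_3
      integral_component_eq_cart[OF iC, symmetric] diff
    by (simp add: D_def ax cross3_def algebra_simps)
qed

lemma Dcurl_xi_eq:
  assumes D: "(curl X has_derivative D) (at x)"
  shows "Dcurl_xi X x \<xi> = D \<xi> \<bullet> \<xi>"
proof -
  have lin: "linear D" using D by (rule has_derivative_linear)
  have "D \<xi> = D (\<Sum>l\<in>UNIV. \<xi> $ l *\<^sub>R axis l 1)"
    by (simp add: basis_expansion scalar_mult_eq_scaleR[symmetric])
  also have "\<dots> = (\<Sum>l\<in>UNIV. \<xi> $ l *\<^sub>R D (axis l 1))"
    by (simp add: linear_sum[OF lin] linear_scale[OF lin])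
  finally have "D \<xi> \<bullet> \<xi> = (\<Sum>k\<in>UNIV. (\<Sum>l\<in>UNIV. \<xi> $ l * D (axis l 1) $ k) * \<xi> $ k)"
    by (simp add: inner_vec_def)
  then show ?thesis
    unfolding Dcurl_xi_def pd_def frechet_derivative_at[OF D, symmetric]
    by (simp add: sum_distrib_left sum_distrib_right mult_ac)
qed

lemma abs_mult_le:
  fixes a b :: real
  shows "\<lbrakk>\<bar>a\<bar> \<le> A; \<bar>b\<bar> \<le> B\<rbrakk> \<Longrightarrow> \<bar>a * b\<bar> \<le> A * B"
  unfolding abs_mult by (rule mult_mono) auto

section \<open>The curl of the calibrating field\<close>

context calib begin

definition G1 where "G1 x s = f (q x s) *\<^sub>R \<tau> s"
definition G1x where "G1x x s v = (2 * f1 (q x s) * ((x - g s) \<bullet> v)) *\<^sub>R \<tau> s"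
definition G1s where "G1s x s = (- 2 * f1 (q x s) * F x s) *\<^sub>R \<tau> s + f (q x s) *\<^sub>R \<kappa> s"

definition X where "X = A G1"

lemma G1_x: "((\<lambda>x. G1 x s) has_derivative G1x x s) (at x)"
  unfolding G1_def G1x_def
  by (rule has_derivative_eq_rhs[OF has_derivative_scaleR[OF has_derivative_compose_real[OF f_deriv q_x] has_derivative_const]])
    (auto simp: mult_ac)
lemma G1_s: "(G1 x has_vector_derivative G1s x s) (at s)"
  unfolding G1_def G1s_def
  by (rule has_vector_derivative_eq_rhs[OF has_vector_derivative_scaleR'[OF has_vector_derivative_compose_real[OF f_deriv q_s] tau_deriv]])
    (simp add: algebra_simps)

lemma X_has_derivative:
  "(X has_derivative (\<lambda>v. integral {0..L} (\<lambda>s. \<rho> (F x s) *\<^sub>R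
           (\<nu> x s *\<^sub>R G1x x s v + (v \<bullet> \<tau> s) *\<^sub>R G1s x s)))) (at x)"
  unfolding X_def
proof (rule A_has_derivative[OF G1_x G1_s])
  show "continuous_on UNIV (\<lambda>p. G1 (fst p) (snd p))"
    "continuous_on UNIV (\<lambda>p. G1x (fst p) (snd p) v)"
    "continuous_on UNIV (\<lambda>p. G1s (fst p) (snd p))" for v
    unfolding G1_def G1x_def G1s_def by (intro continuous_intros)+
  show "G1 x L = G1 x 0" for x by (simp add: G1_def Fnuq_L at_L)
qed

text \<open>Chosen so that \<open>curl X = A G2\<close>: the \<open>\<tau>\<close> part of the
  derivative of \<open>X\<close> carries no factor \<open>\<nu>\<close>, and dividing by
  \<open>\<nu>\<close> restores the averaged form, to which \<open>A_has_derivative\<close> applies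
  once more. At \<open>x = g s\<close> the value is \<open>cross3 (\<tau> s) (\<kappa> s)\<close>,
  the velocity of the flow.\<close>

definition G2 where
  "G2 x s = (2 * f1 (q x s)) *\<^sub>R cross3 (x - g s) (\<tau> s) + (f (q x s) * recip (\<nu> x s)) *\<^sub>R cross3 (\<tau> s) (\<kappa> s)"
definition G2x where
  "G2x x s v = (4 * f2 (q x s) * ((x - g s) \<bullet> v)) *\<^sub>R cross3 (x - g s) (\<tau> s) + (2 * f1 (q x s)) *\<^sub>R cross3 v (\<tau> s)
    + (2 * f1 (q x s) * ((x - g s) \<bullet> v) * recip (\<nu> x s) - f (q x s) * recip' (\<nu> x s) * (v \<bullet> \<kappa> s)) *\<^sub>R cross3 (\<tau> s) (\<kappa> s)"
definition G2s where
  "G2s x s = (- 4 * f2 (q x s) * F x s) *\<^sub>R cross3 (x - g s) (\<tau> s) + (2 * f1 (q x s)) *\<^sub>R cross3 (x - g s) (\<kappa> s)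
    + (- 2 * f1 (q x s) * F x s * recip (\<nu> x s) - f (q x s) * recip' (\<nu> x s) * ((x - g s) \<bullet> \<kappa>s s)) *\<^sub>R cross3 (\<tau> s) (\<kappa> s)
    + (f (q x s) * recip (\<nu> x s)) *\<^sub>R cross3 (\<tau> s) (\<kappa>s s)"

lemma G2_x: "((\<lambda>x. G2 x s) has_derivative G2x x s) (at x)"
proof -
  have y: "((\<lambda>x. x - g s) has_derivative (\<lambda>v. v)) (at x)"
    by (auto intro!: derivative_eq_intros)
  have c: "((\<lambda>x. cross3 (x - g s) (\<tau> s)) has_derivative (\<lambda>v. cross3 v (\<tau> s))) (at x)"
    using bounded_bilinear.FDERIV[OF bounded_bilinear_cross3 y has_derivative_const, of "\<tau> s"] by simp
  have t: "((\<lambda>x. 2 * f1 (q x s)) has_derivative (\<lambda>v. 4 * f2 (q x s) * ((x - g s) \<bullet> v))) (at x)"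
    by (rule has_derivative_eq_rhs[OF has_derivative_mult_right[OF has_derivative_compose_real[OF f1_deriv q_x]]]) auto
  note 1 = has_derivative_scaleR[OF t c]
  note 2 = has_derivative_scaleR[OF has_derivative_mult[OF has_derivative_compose_real[OF f_deriv q_x]
        has_derivative_compose_real[OF recip_deriv nu_x]] has_derivative_const]
  show ?thesis unfolding G2_def G2x_def
    by (rule has_derivative_eq_rhs[OF has_derivative_add[OF 1 2]]) (auto simp: algebra_simps)
qed

lemma G2_s: "(G2 x has_vector_derivative G2s x s) (at s)"
proof -
  have "((\<lambda>s. 2 * f1 (q x s)) has_vector_derivative - 4 * f2 (q x s) * F x s) (at s)"
    by (rule has_vector_derivative_eq_rhs[OF has_vector_derivative_mult_right[OF has_vector_derivative_compose_real[OF f1_deriv q_s]]]) auto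
  note 1 = has_vector_derivative_scaleR'[OF this has_vector_derivative_cross3[OF y_s[of x] tau_deriv]]
  note 2 = has_vector_derivative_scaleR'[OF has_vector_derivative_times[OF has_vector_derivative_compose_real[OF f_deriv q_s]
        has_vector_derivative_compose_real[OF recip_deriv nu_s]] has_vector_derivative_cross3[OF tau_deriv kappa_deriv]]
  have neg: "cross3 (- \<tau> s) (\<tau> s) = 0" by (simp add: cross_minus_left)
  show ?thesis unfolding G2_def G2s_def
    by (rule has_vector_derivative_eq_rhs[OF has_vector_derivative_add[OF 1 2]]) (simp add: neg algebra_simps)
qed

lemma small': "r0 * k0 \<le> 1 / 2" "k0 \<ge> 0"
proof -
  show k: "k0 \<ge> 0" using k0[of 0] norm_ge_zero[of "\<kappa> 0"] by linarith
  have "r0 * k0 \<le> (r0 + \<delta>) * k0" using k \<delta> by (intro mult_right_mono) auto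
  with small show "r0 * k0 \<le> 1 / 2" by simp
qed

lemma q_eq: "q x s = (norm (x - g s))\<^sup>2" by (simp add: q_def power2_norm_eq_inner)

lemma nu_near: "\<bar>\<nu> x s - 1\<bar> \<le> norm (x - g s) * k0"
proof -
  have "\<bar>(x - g s) \<bullet> \<kappa> s\<bar> \<le> norm (x - g s) * norm (\<kappa> s)" by (rule Cauchy_Schwarz_ineq2)
  also have "\<dots> \<le> norm (x - g s) * k0" by (intro mult_left_mono k0) auto
  finally show ?thesis by (simp add: \<nu>_def)
qed

text \<open>The smallness of \<open>(r0 + \<delta>) * k0\<close> is assumed for this:
  \<open>\<nu>\<close> stays positive on the arc of half length \<open>\<delta>\<close> around a
  parameter whose point is closer than \<open>r0\<close> to \<open>x\<close>, so \<open>F x\<close>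
  is strictly decreasing there.\<close>

lemma nu_bounds:
  assumes "norm (x - g s) \<le> r0 + \<delta>"
  shows "1 / 2 \<le> \<nu> x s" "\<nu> x s \<le> 3 / 2"
proof -
  have "norm (x - g s) * k0 \<le> (r0 + \<delta>) * k0" using assms small' by (intro mult_right_mono) auto
  then show "1 / 2 \<le> \<nu> x s" "\<nu> x s \<le> 3 / 2" using nu_near[of x s] small by linarith+
qed

lemma far: "norm (x - g s) \<ge> r0 \<Longrightarrow> f (q x s) = 0 \<and> f1 (q x s) = 0 \<and> f2 (q x s) = 0"
  using f_out[of "q x s"] r0 by (simp add: q_eq power_mono)

lemma f_recip: "\<nu> x s * (f (q x s) * recip (\<nu> x s)) = f (q x s)"
proof (cases "norm (x - g s) \<ge> r0")
  case True then show ?thesis using far by simp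
next
  case False
  then have "\<nu> x s \<ge> 1 / 2" using nu_bounds \<delta> by simp
  then show ?thesis by (simp add: recip_def)
qed

lemma curl_X: "curl X = A G2"
proof
  fix x
  have "(X has_derivative (\<lambda>v. integral {0..L} (\<lambda>s. (v \<bullet> (x - g s)) *\<^sub>R ((\<rho> (F x s) * \<nu> x s * 2 * f1 (q x s)) *\<^sub>R \<tau> s)
      + (v \<bullet> \<tau> s) *\<^sub>R (\<rho> (F x s) *\<^sub>R G1s x s)))) (at x)"
    by (rule has_derivative_eq_rhs[OF X_has_derivative], rule ext, rule integral_cong)
      (simp add: G1x_def scaleR_add_right inner_commute mult_ac)
  then have "curl X x = integral {0..L} (\<lambda>s. cross3 (x - g s) ((\<rho> (F x s) * \<nu> x s * 2 * f1 (q x s)) *\<^sub>R \<tau> s)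
      + cross3 (\<tau> s) (\<rho> (F x s) *\<^sub>R G1s x s))"
    by (rule curl_integral_eq) (unfold G1s_def, (intro continuous_intros)+)
  also have "\<dots> = A G2 x"
    unfolding A_def
  proof (rule integral_cong)
    fix s
    \<comment> \<open>The part of \<open>G1s\<close> along \<open>\<tau> s\<close>, with
      \<open>f1\<close> and \<open>F\<close>, is killed by the cross product with
      \<open>\<tau> s\<close>.\<close>
    have "cross3 (\<tau> s) (\<rho> (F x s) *\<^sub>R G1s x s) = (\<rho> (F x s) * f (q x s)) *\<^sub>R cross3 (\<tau> s) (\<kappa> s)"
      unfolding G1s_def cross_add_right cross_mult_right cross_refl by simp
    also have "\<dots> = (\<rho> (F x s) * (\<nu> x s * (f (q x s) * recip (\<nu> x s)))) *\<^sub>R cross3 (\<tau> s) (\<kappa> s)"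
      by (simp add: f_recip)
    finally show "cross3 (x - g s) ((\<rho> (F x s) * \<nu> x s * 2 * f1 (q x s)) *\<^sub>R \<tau> s) + cross3 (\<tau> s) (\<rho> (F x s) *\<^sub>R G1s x s)
        = (\<rho> (F x s) * \<nu> x s) *\<^sub>R G2 x s"
      by (simp add: G2_def scaleR_add_right cross_mult_right mult_ac)
  qed
  finally show "curl X x = A G2 x" .
qed

lemmas cont_recip_comp [continuous_intros] =
  cont_recip[of UNIV, THEN continuous_on_compose2, OF _ subset_UNIV]
  cont_recip'[of UNIV, THEN continuous_on_compose2, OF _ subset_UNIV]

lemma Dcurl_X:
  "Dcurl_xi X x \<xi> = integral {0..L} (\<lambda>s. \<rho> (F x s) * (\<nu> x s * (G2x x s \<xi> \<bullet> \<xi>) + (\<xi> \<bullet> \<tau> s) * (G2s x s \<bullet> \<xi>)))"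
proof -
  have "(A G2 has_derivative (\<lambda>v. integral {0..L} (\<lambda>s. \<rho> (F x s) *\<^sub>R
           (\<nu> x s *\<^sub>R G2x x s v + (v \<bullet> \<tau> s) *\<^sub>R G2s x s)))) (at x)"
  proof (rule A_has_derivative[OF G2_x G2_s])
    show "continuous_on UNIV (\<lambda>p. G2 (fst p) (snd p))"
      "continuous_on UNIV (\<lambda>p. G2x (fst p) (snd p) v)"
      "continuous_on UNIV (\<lambda>p. G2s (fst p) (snd p))" for v
      unfolding G2_def G2x_def G2s_def by (intro continuous_intros)+
    show "G2 x L = G2 x 0" for x by (simp add: G2_def Fnuq_L at_L)
  qed
  from Dcurl_xi_eq[OF this[folded curl_X]]
  have "Dcurl_xi X x \<xi> = integral {0..L} (\<lambda>s. \<rho> (F x s) *\<^sub>R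
           (\<nu> x s *\<^sub>R G2x x s \<xi> + (\<xi> \<bullet> \<tau> s) *\<^sub>R G2s x s)) \<bullet> \<xi>" .
  also have "\<dots> = integral {0..L} (\<lambda>s. (\<rho> (F x s) *\<^sub>R
           (\<nu> x s *\<^sub>R G2x x s \<xi> + (\<xi> \<bullet> \<tau> s) *\<^sub>R G2s x s)) \<bullet> \<xi>)"
    by (rule integral_linear[OF _ bounded_linear_inner_left, unfolded o_def, symmetric])
      (unfold G2x_def G2s_def, intro integrable_continuous_real continuous_intros)
  finally show ?thesis by (simp add: inner_add_left)
qed

end

section \<open>The pointwise error estimate\<close>

lemma abs_add_le:
  fixes a b :: real
  shows "\<lbrakk>\<bar>a\<bar> \<le> A; \<bar>b\<bar> \<le> B\<rbrakk> \<Longrightarrow> \<bar>a + b\<bar> \<le> A + B" "\<lbrakk>\<bar>a\<bar> \<le> A; \<bar>b\<bar> \<le> B\<rbrakk> \<Longrightarrow> \<bar>a - b\<bar> \<le> A + B"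
  by linarith+

text \<open>Sum of the coefficients in the eleven bounds of \<open>error_bound_real\<close>. The
  curve enters only through \<open>k0\<close> and \<open>k1\<close>, the profile only through
  \<open>b1\<close> and \<open>b2\<close>; the width \<epsilon> is absent.\<close>

definition Kc :: "real \<Rightarrow> real \<Rightarrow> real \<Rightarrow> real \<Rightarrow> real" where
  "Kc k0 k1 b1 b2 = 10 * b2 + 8 * b1 * k0 + 2 * k0\<^sup>2 + 2 * b1 * (k0\<^sup>2 + 1) + 10 * k0 * k1 + 2 * k1 + 2 * b1 * k1"

text \<open>To first order in the distance \<open>d\<close> to the curve and in the angle \<open>z\<close> between \<open>\<xi>\<close> and the tangent
  all terms cancel.\<close>
lemma error_bound_real:
  fixes p1 D1 T B' M U Ft kx ks F \<nu> f f1 f2 a d z :: real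
  assumes d: "d \<ge> 0" and z: "0 \<le> z" "z \<le> 1" and a: "\<bar>a\<bar> \<le> 1" and k: "k0 \<ge> 0" "k1 \<ge> 0" "b1 \<ge> 0" "b2 \<ge> 0"
    and p1: "\<bar>p1\<bar> \<le> d" and D1: "\<bar>D1\<bar> \<le> d * z" and T: "\<bar>T\<bar> \<le> k0 * z" and B': "\<bar>B'\<bar> \<le> d * k0 * z"
    and M: "\<bar>M\<bar> \<le> d * k0" and U: "\<bar>U\<bar> \<le> k1 * z" and Ft: "\<bar>Ft\<bar> \<le> d * k1" and kx: "\<bar>kx\<bar> \<le> k0 * z"
    and ks: "\<bar>ks\<bar> \<le> d * k1" and F: "\<bar>F\<bar> \<le> d" and \<nu>: "\<bar>\<nu> - 1\<bar> \<le> d * k0" and small: "d * k0 \<le> 1 / 2"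
    and f: "\<bar>f\<bar> \<le> 1" "\<bar>f1\<bar> \<le> b1" "\<bar>f2\<bar> \<le> b2"
  defines "h \<equiv> 1 / \<nu>" and "h' \<equiv> - (1 / \<nu>)\<^sup>2"
  shows "\<bar>\<nu> * (4 * f2 * p1 * D1 + (2 * f1 * p1 * h - f * h' * kx) * T)
     + a * (- 4 * f2 * F * D1 + 2 * f1 * (B' - a * M) + (- 2 * f1 * F * h - f * h' * ks) * T + f * h * U)
     - (\<nu> * (- 2 * f1 * M * a + f * U) + Ft * (- 2 * f1 * F * a + f * kx))\<bar>
     \<le> Kc k0 k1 b1 b2 * (d\<^sup>2 + z\<^sup>2 + (1 - a))" (is "\<bar>?e\<bar> \<le> _ * ?Q")
proof -
  have nu: "1 / 2 \<le> \<nu>" "\<nu> \<le> 3 / 2" using \<nu> small by linarith+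
  have h: "\<bar>h\<bar> \<le> 2" "\<bar>h'\<bar> \<le> 4" "\<nu> * h = 1" "\<nu> * h' = - h"
  proof -
    have h2: "0 \<le> h" "h \<le> 2" using nu by (auto simp: h_def divide_simps)
    then show "\<bar>h\<bar> \<le> 2" by simp
    have "h\<^sup>2 \<le> 2\<^sup>2" using h2 by (intro power_mono) auto
    then show "\<bar>h'\<bar> \<le> 4" by (simp add: h'_def h_def)
    show "\<nu> * h = 1" "\<nu> * h' = - h" using nu by (auto simp: h_def h'_def power2_eq_square)
  qed
  have Q: "d * d \<le> ?Q" "z * z \<le> ?Q" "d * z \<le> ?Q" "1 - a \<le> ?Q" "d * (d * z) \<le> ?Q" "(d * k0) * (1 - a) \<le> ?Q"
    "z * (1 - a) \<le> ?Q" "?Q \<ge> 0"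
  proof -
    have 1: "1 - a \<ge> 0" using a by auto
    show "d * d \<le> ?Q" "z * z \<le> ?Q" "1 - a \<le> ?Q" "?Q \<ge> 0" using 1 by (auto simp: power2_eq_square)
    have "2 * (d * z) \<le> d\<^sup>2 + z\<^sup>2" using sum_squares_bound[of d z] by simp
    moreover have "0 \<le> d\<^sup>2 + z\<^sup>2" by simp
    ultimately show "d * z \<le> ?Q" using 1 by linarith
    have "d * (d * z) \<le> d * (d * 1)" using d z by (intro mult_left_mono) auto
    then show "d * (d * z) \<le> ?Q" using 1 by (simp add: power2_eq_square) (smt (verit) zero_le_square)
    have "(d * k0) * (1 - a) \<le> 1 * (1 - a)" using small 1 by (intro mult_right_mono) auto
    moreover have "z * (1 - a) \<le> 1 * (1 - a)" using z 1 by (intro mult_right_mono) auto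
    ultimately show "(d * k0) * (1 - a) \<le> ?Q" "z * (1 - a) \<le> ?Q" using 1
      by (smt (verit) mult_1 zero_le_power2)+
  qed
  define t1 where "t1 = \<nu> * (4 * f2) * p1 * D1"
  define t2 where "t2 = 2 * f1 * p1 * T"
  define t3 where "t3 = f * h * kx * T"
  define t4 where "t4 = a * (4 * f2) * F * D1"
  define t5 where "t5 = 2 * a * f1 * B'"
  \<comment> \<open>\<open>M\<close> occurs once on each side, to first order in \<open>d\<close>;
    the difference carries the factor \<open>\<nu> - a\<close>, of size at most
    \<open>d * k0 + (1 - a)\<close>.\<close>
  define t6 where "t6 = 2 * a * f1 * M * (\<nu> - a)"
  define t7 where "t7 = a * (2 * f1) * F * h * T"
  define t8 where "t8 = a * f * h' * ks * T"
  \<comment> \<open>\<open>U\<close> occurs once on each side, to first order in \<open>z\<close>;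
    since \<open>h = 1 / \<nu>\<close>, the difference \<open>h * a - \<nu>\<close> equals
    \<open>h * (a - \<nu>\<^sup>2)\<close>, which is small again.\<close>
  define t9 where "t9 = f * U * (h * (a - \<nu>\<^sup>2))"
  define t10 where "t10 = Ft * (2 * f1) * F * a"
  define t11 where "t11 = f * Ft * kx"
  have "h * \<nu>\<^sup>2 = \<nu>" using h(3) by (simp add: power2_eq_square mult.left_commute mult.commute)
  then have t9': "t9 = f * U * (h * a - \<nu>)" unfolding t9_def by (simp add: right_diff_distrib)
  have "?e = t1 + 2 * f1 * p1 * (\<nu> * h) * T - f * (\<nu> * h') * kx * T - t4 + t5 + t6 - t7 - t8 + t9 + t10 - t11"
    unfolding t1_def t4_def t5_def t6_def t7_def t8_def t9' t10_def t11_def by (simp add: algebra_simps)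
  also have "\<dots> = t1 + t2 + t3 - t4 + t5 + t6 - t7 - t8 + t9 + t10 - t11"
    unfolding h t2_def t3_def by simp
  finally have e: "?e = t1 + t2 + t3 - t4 + t5 + t6 - t7 - t8 + t9 + t10 - t11" .
  have nuabs: "\<bar>\<nu>\<bar> \<le> 3 / 2" using nu by auto
  have c4: "\<bar>4 * f2\<bar> \<le> 4 * b2" "\<bar>2 * f1\<bar> \<le> 2 * b1" using f by auto
  have "\<bar>t1\<bar> \<le> 3 / 2 * (4 * b2) * d * (d * z)" unfolding t1_def by (intro abs_mult_le nuabs c4 p1 D1)
  also have "\<dots> = 6 * b2 * (d * (d * z))" by simp
  also have "\<dots> \<le> 6 * b2 * ?Q" using Q k by (intro mult_left_mono) auto
  finally have 1: "\<bar>t1\<bar> \<le> 6 * b2 * ?Q" .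
  have "\<bar>t2\<bar> \<le> 2 * b1 * d * (k0 * z)" unfolding t2_def by (intro abs_mult_le c4 p1 T)
  also have "\<dots> = 2 * b1 * k0 * (d * z)" by simp
  also have "\<dots> \<le> 2 * b1 * k0 * ?Q" using Q k by (intro mult_left_mono) auto
  finally have 2: "\<bar>t2\<bar> \<le> 2 * b1 * k0 * ?Q" .
  have "\<bar>t3\<bar> \<le> 1 * 2 * (k0 * z) * (k0 * z)" unfolding t3_def by (intro abs_mult_le f h kx T)
  also have "\<dots> = 2 * k0\<^sup>2 * (z * z)" by (simp add: power2_eq_square)
  also have "\<dots> \<le> 2 * k0\<^sup>2 * ?Q" using Q k by (intro mult_left_mono) auto
  finally have 3: "\<bar>t3\<bar> \<le> 2 * k0\<^sup>2 * ?Q" .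
  have "\<bar>t4\<bar> \<le> 1 * (4 * b2) * d * (d * z)" unfolding t4_def by (intro abs_mult_le a c4 F D1)
  also have "\<dots> = 4 * b2 * (d * (d * z))" by simp
  also have "\<dots> \<le> 4 * b2 * ?Q" using Q k by (intro mult_left_mono) auto
  finally have 4: "\<bar>t4\<bar> \<le> 4 * b2 * ?Q" .
  have a2: "\<bar>2 * a\<bar> \<le> 2" using a by auto
  have "\<bar>t5\<bar> \<le> 2 * b1 * (d * k0 * z)" unfolding t5_def by (intro abs_mult_le a2 f B')
  also have "\<dots> = 2 * b1 * k0 * (d * z)" by simp
  also have "\<dots> \<le> 2 * b1 * k0 * ?Q" using Q k by (intro mult_left_mono) auto
  finally have 5: "\<bar>t5\<bar> \<le> 2 * b1 * k0 * ?Q" .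
  have na: "\<bar>\<nu> - a\<bar> \<le> d * k0 + (1 - a)" using \<nu> a by linarith
  have "\<bar>t6\<bar> \<le> 2 * b1 * (d * k0) * (d * k0 + (1 - a))" unfolding t6_def by (intro abs_mult_le a2 f M na)
  also have "\<dots> = 2 * b1 * (k0\<^sup>2 * (d * d) + (d * k0) * (1 - a))" by (simp add: power2_eq_square algebra_simps)
  also have "\<dots> \<le> 2 * b1 * (k0\<^sup>2 * ?Q + ?Q)" using Q k by (intro mult_left_mono add_mono) auto
  finally have 6: "\<bar>t6\<bar> \<le> 2 * b1 * (k0\<^sup>2 + 1) * ?Q" by (simp add: algebra_simps)
  have "\<bar>t7\<bar> \<le> 1 * (2 * b1) * d * 2 * (k0 * z)" unfolding t7_def by (intro abs_mult_le a c4 F h T)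
  also have "\<dots> = 4 * b1 * k0 * (d * z)" by simp
  also have "\<dots> \<le> 4 * b1 * k0 * ?Q" using Q k by (intro mult_left_mono) auto
  finally have 7: "\<bar>t7\<bar> \<le> 4 * b1 * k0 * ?Q" .
  have "\<bar>t8\<bar> \<le> 1 * 1 * 4 * (d * k1) * (k0 * z)" unfolding t8_def by (intro abs_mult_le a f h ks T)
  also have "\<dots> = 4 * k0 * k1 * (d * z)" by simp
  also have "\<dots> \<le> 4 * k0 * k1 * ?Q" using Q k by (intro mult_left_mono) auto
  finally have 8: "\<bar>t8\<bar> \<le> 4 * k0 * k1 * ?Q" .
  have "\<bar>(\<nu> - 1) * (\<nu> + 1)\<bar> \<le> d * k0 * (5 / 2)" using nu by (intro abs_mult_le \<nu>) auto
  moreover have "\<nu>\<^sup>2 - 1 = (\<nu> - 1) * (\<nu> + 1)" by (simp add: power2_eq_square algebra_simps)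
  ultimately have "\<bar>a - \<nu>\<^sup>2\<bar> \<le> (1 - a) + 5 / 2 * (d * k0)" using a by linarith
  then have "\<bar>t9\<bar> \<le> 1 * (k1 * z) * (2 * ((1 - a) + 5 / 2 * (d * k0)))"
    unfolding t9_def by (intro abs_mult_le f U h)
  also have "\<dots> = 2 * k1 * (z * (1 - a)) + 5 * k0 * k1 * (d * z)" by (simp add: algebra_simps)
  also have "\<dots> \<le> 2 * k1 * ?Q + 5 * k0 * k1 * ?Q" using Q k by (intro add_mono mult_left_mono) auto
  finally have 9: "\<bar>t9\<bar> \<le> 2 * k1 * ?Q + 5 * k0 * k1 * ?Q" .
  have "\<bar>t10\<bar> \<le> (d * k1) * (2 * b1) * d * 1" unfolding t10_def by (intro abs_mult_le a c4 F Ft)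
  also have "\<dots> = 2 * b1 * k1 * (d * d)" by simp
  also have "\<dots> \<le> 2 * b1 * k1 * ?Q" using Q k by (intro mult_left_mono) auto
  finally have 10: "\<bar>t10\<bar> \<le> 2 * b1 * k1 * ?Q" .
  have "\<bar>t11\<bar> \<le> 1 * (d * k1) * (k0 * z)" unfolding t11_def by (intro abs_mult_le f Ft kx)
  also have "\<dots> = k0 * k1 * (d * z)" by simp
  also have "\<dots> \<le> k0 * k1 * ?Q" using Q k by (intro mult_left_mono) auto
  finally have 11: "\<bar>t11\<bar> \<le> k0 * k1 * ?Q" .
  have "\<bar>?e\<bar> \<le> 6 * b2 * ?Q + 2 * b1 * k0 * ?Q + 2 * k0\<^sup>2 * ?Q + 4 * b2 * ?Q + 2 * b1 * k0 * ?Q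
     + 2 * b1 * (k0\<^sup>2 + 1) * ?Q + 4 * b1 * k0 * ?Q + 4 * k0 * k1 * ?Q + (2 * k1 * ?Q + 5 * k0 * k1 * ?Q)
     + 2 * b1 * k1 * ?Q + k0 * k1 * ?Q"
    unfolding e by (intro abs_add_le 1 2 3 4 5 6 7 8 9 10 11)
  also have "\<dots> = Kc k0 k1 b1 b2 * ?Q" unfolding Kc_def by algebra
  finally show ?thesis .
qed

context calib begin

text \<open>Time derivatives of \<open>G1\<close> and \<open>F\<close> at fixed \<open>x\<close>
  when \<open>g\<close> has velocity \<open>cross3 \<tau> \<kappa>\<close>, so that
  \<open>\<tau>\<close> has velocity \<open>cross3 \<tau> \<kappa>s\<close>.\<close>

definition Gt where
  "Gt x s = (- 2 * f1 (q x s) * ((x - g s) \<bullet> cross3 (\<tau> s) (\<kappa> s))) *\<^sub>R \<tau> s + f (q x s) *\<^sub>R cross3 (\<tau> s) (\<kappa>s s)"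
definition Ft where "Ft x s = (x - g s) \<bullet> cross3 (\<tau> s) (\<kappa>s s)"

text \<open>When \<open>g\<close> moves by the binormal curvature flow, this is the time derivative of \<open>X\<close>.\<close>
definition Y where
  "Y x = integral {0..L} (\<lambda>s. \<rho> (F x s) *\<^sub>R (\<nu> x s *\<^sub>R Gt x s + Ft x s *\<^sub>R G1s x s))"

definition err where
  "err x \<xi> s = \<nu> x s * (G2x x s \<xi> \<bullet> \<xi>) + (\<xi> \<bullet> \<tau> s) * (G2s x s \<bullet> \<xi>)
     - (\<nu> x s * (Gt x s \<bullet> \<xi>) + Ft x s * (G1s x s \<bullet> \<xi>))"

lemma Dcurl_minus_Y: "Dcurl_xi X x \<xi> - Y x \<bullet> \<xi> = integral {0..L} (\<lambda>s. \<rho> (F x s) * err x \<xi> s)"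
proof -
  have "Y x \<bullet> \<xi> = integral {0..L} (\<lambda>s. (\<rho> (F x s) *\<^sub>R (\<nu> x s *\<^sub>R Gt x s + Ft x s *\<^sub>R G1s x s)) \<bullet> \<xi>)"
    unfolding Y_def
    by (rule integral_linear[OF _ bounded_linear_inner_left, unfolded o_def, symmetric])
      (unfold Gt_def Ft_def G1s_def, intro integrable_continuous_real continuous_intros)
  also have "\<dots> = integral {0..L} (\<lambda>s. \<rho> (F x s) * (\<nu> x s * (Gt x s \<bullet> \<xi>) + Ft x s * (G1s x s \<bullet> \<xi>)))"
    by (simp add: inner_add_left)
  finally show ?thesis
    unfolding Dcurl_X err_def right_diff_distrib[of "\<rho> _"]
    by (subst integral_diff)
      (unfold Gt_def Ft_def G1s_def G2x_def G2s_def, (intro integrable_continuous_real continuous_intros)+, simp)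
qed

lemma Kc_nonneg: "Kc k0 k1 b1 b2 \<ge> 0" "k1 \<ge> 0" "b1 \<ge> 0" "b2 \<ge> 0"
proof -
  show "k1 \<ge> 0" using k1[of 0] norm_ge_zero[of "\<kappa>s 0"] by linarith
  moreover show "b1 \<ge> 0" using b1[of 0] by linarith
  moreover show "b2 \<ge> 0" using b2[of 0] by linarith
  ultimately show "Kc k0 k1 b1 b2 \<ge> 0" using small' by (simp add: Kc_def)
qed

lemma f_le_1: "z \<ge> 0 \<Longrightarrow> f z \<le> 1"
proof (cases "z \<le> r0\<^sup>2")
  case True assume "z \<ge> 0"
  moreover have "z / r0\<^sup>2 \<ge> 0" using \<open>z \<ge> 0\<close> by simp
  ultimately show ?thesis using f_le[of z] True by linarith
qed (use f_out[of z] in auto)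

text \<open>Coercivity of the defect, from \<open>f \<le> 1 - u\<close> with \<open>u\<close> the
  squared distance divided by \<open>r0\<^sup>2\<close>. If \<open>a \<ge> 1 / 2\<close> the defect
  is at least \<open>(1 - a) + u / 2\<close>; otherwise it is at least \<open>1 / 2\<close>, while
  the left-hand side is at most \<open>r0\<^sup>2 + 6\<close>, whence the 12.\<close>

lemma Q_le:
  assumes near: "norm (x - g s) < r0" and xi: "norm \<xi> = 1"
  shows "(norm (x - g s))\<^sup>2 + (norm (\<xi> - (\<xi> \<bullet> \<tau> s) *\<^sub>R \<tau> s))\<^sup>2 + (1 - \<xi> \<bullet> \<tau> s)
      \<le> (2 * r0\<^sup>2 + 12) * (1 - f (q x s) * (\<xi> \<bullet> \<tau> s))"
proof -
  define a where "a = \<xi> \<bullet> \<tau> s"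
  define u where "u = q x s / r0\<^sup>2"
  have xi': "\<xi> \<bullet> \<xi> = 1" using xi by (simp add: norm_eq_1)
  have z2: "(norm (\<xi> - a *\<^sub>R \<tau> s))\<^sup>2 = 1 - a\<^sup>2"
    unfolding power2_norm_eq_inner
    by (simp add: inner_diff_left inner_diff_right tau_tau xi' a_def inner_commute power2_eq_square)
  have a: "\<bar>a\<bar> \<le> 1" using Cauchy_Schwarz_ineq2[of \<xi> "\<tau> s"] by (simp add: a_def xi unit)
  have "1 - a\<^sup>2 = (1 - a) * (1 + a)" by (simp add: power2_eq_square algebra_simps)
  also have "\<dots> \<le> (1 - a) * 2" using a by (intro mult_left_mono) auto
  finally have z2': "1 - a\<^sup>2 \<le> 2 * (1 - a)" by simp
  have "q x s \<le> r0\<^sup>2" using near by (simp add: q_eq power_mono)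
  then have u: "0 \<le> u" "u \<le> 1" "f (q x s) \<le> 1 - u"
    using f_le[of "q x s"] r0 by (auto simp: u_def q_eq)
  have d2: "(norm (x - g s))\<^sup>2 = r0\<^sup>2 * u" using r0 by (simp add: u_def q_eq)
  define w where "w = 1 - f (q x s) * a"
  have "r0\<^sup>2 * u + 3 * (1 - a) \<le> (2 * r0\<^sup>2 + 12) * w"
  proof (cases "a \<ge> 1 / 2")
    case True
    have "f (q x s) * a \<le> (1 - u) * a" using u True by (intro mult_right_mono) auto
    moreover have "u * (1 / 2) \<le> u * a" using u True by (intro mult_left_mono) auto
    ultimately have w: "w \<ge> (1 - a) + u / 2" by (simp add: w_def algebra_simps)
    have "r0\<^sup>2 * u \<le> r0\<^sup>2 * (2 * w)" using w a by (intro mult_left_mono) auto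
    moreover have "1 - a \<le> w" "w \<ge> 0" using w u a by linarith+
    ultimately show ?thesis by (simp add: algebra_simps)
  next
    case False
    have "w \<ge> 1 / 2"
    proof (cases "a \<ge> 0")
      case True
      have "f (q x s) * a \<le> 1 * a" using True f_le_1[of "q x s"] by (intro mult_right_mono) (auto simp: q_eq)
      then show ?thesis using False by (simp add: w_def)
    next
      case neg: False
      have "f (q x s) * a \<le> 0" using neg f_nonneg by (intro mult_nonneg_nonpos) auto
      then show ?thesis by (simp add: w_def)
    qed
    then have "(2 * r0\<^sup>2 + 12) * (1 / 2) \<le> (2 * r0\<^sup>2 + 12) * w" by (intro mult_left_mono) auto
    moreover have "r0\<^sup>2 * u \<le> r0\<^sup>2 * 1" using u by (intro mult_left_mono) auto
    moreover have "1 - a \<le> 2" using a by linarith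
    ultimately show ?thesis by (simp add: algebra_simps)
  qed
  moreover have "r0\<^sup>2 * u + (1 - a\<^sup>2) + (1 - a) \<le> r0\<^sup>2 * u + 3 * (1 - a)" using z2' by simp
  ultimately show ?thesis unfolding d2 a_def[symmetric] z2 w_def by (rule order.trans[rotated])
qed

text \<open>\<open>Kc\<close> times the coercivity constant of \<open>Q_le\<close>; the 2
  compensates \<open>\<nu> \<ge> 1 / 2\<close>, since \<open>weighted_bound\<close> asks for a bound
  proportional to \<open>\<nu>\<close>.\<close>

definition Kcal where "Kcal = 2 * Kc k0 k1 b1 b2 * (2 * r0\<^sup>2 + 12)"

text \<open>Split \<open>\<xi>\<close> into \<open>a *\<^sub>R \<tau> s\<close> and the normal part
  \<open>\<zeta>\<close>: triple products of \<open>\<xi>\<close> that also contain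
  \<open>\<tau> s\<close> see only \<open>\<zeta>\<close>, which yields the factors \<open>z\<close>
  that \<open>error_bound_real\<close> needs.\<close>

lemma err_bound:
  assumes near: "norm (x - g s) < r0" and xi: "norm \<xi> = 1"
  shows "\<bar>err x \<xi> s\<bar> \<le> \<nu> x s * (Kcal * (1 - f (q x s) * (\<xi> \<bullet> \<tau> s)))"
proof -
  define y where "y = x - g s"
  define a where "a = \<xi> \<bullet> \<tau> s"
  define \<zeta> where "\<zeta> = \<xi> - a *\<^sub>R \<tau> s"
  define d where "d = norm y"
  define z where "z = norm \<zeta>"
  define B' where "B' = cross3 y (\<kappa> s) \<bullet> \<zeta>"
  define M where "M = y \<bullet> cross3 (\<tau> s) (\<kappa> s)"
  have xi_eq: "\<xi> = \<zeta> + a *\<^sub>R \<tau> s" by (simp add: \<zeta>_def)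
  have xi': "\<xi> \<bullet> \<xi> = 1" using xi by (simp add: norm_eq_1)
  have a: "\<bar>a\<bar> \<le> 1" using Cauchy_Schwarz_ineq2[of \<xi> "\<tau> s"] by (simp add: a_def xi unit)
  have "z\<^sup>2 = 1 - a\<^sup>2"
    unfolding z_def \<zeta>_def power2_norm_eq_inner
    by (simp add: inner_diff_left inner_diff_right tau_tau xi' a_def inner_commute power2_eq_square)
  then have "z\<^sup>2 \<le> 1\<^sup>2" by simp
  then have z: "0 \<le> z" "z \<le> 1" using power2_le_imp_le[of z 1] by (auto simp: z_def)
  have nu: "1 / 2 \<le> \<nu> x s" "\<nu> x s \<le> 3 / 2" using nu_bounds[of x s] near \<delta> by auto
  have tri: "\<bar>cross3 u v \<bullet> w\<bar> \<le> norm u * norm v * norm w" for u v w :: "real^3"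
    using order.trans[OF Cauchy_Schwarz_ineq2 mult_right_mono[OF norm_cross3_le norm_ge_zero]] .
  have cr0: "cross3 u (\<tau> s) \<bullet> \<tau> s = 0" "cross3 (\<tau> s) u \<bullet> \<tau> s = 0" for u
    by (simp_all add: dot_cross_self)
  have ck: "norm y * norm (\<kappa> s) * w \<le> d * k0 * w" if "w \<ge> 0" for w
    unfolding d_def using that k0 small' by (intro mult_right_mono mult_left_mono) auto
  have D1: "\<bar>cross3 y (\<tau> s) \<bullet> \<xi>\<bar> \<le> d * z"
    using tri[of y "\<tau> s" \<zeta>] unfolding xi_eq inner_add_right inner_scaleR_right cr0 by (simp add: unit d_def z_def)
  have T: "\<bar>cross3 (\<tau> s) (\<kappa> s) \<bullet> \<xi>\<bar> \<le> k0 * z"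
    using order.trans[OF tri[of "\<tau> s" "\<kappa> s" \<zeta>] mult_right_mono[OF _ norm_ge_zero], of k0] k0[of s]
    unfolding xi_eq inner_add_right inner_scaleR_right cr0 by (simp add: unit z_def)
  have U: "\<bar>cross3 (\<tau> s) (\<kappa>s s) \<bullet> \<xi>\<bar> \<le> k1 * z"
    using order.trans[OF tri[of "\<tau> s" "\<kappa>s s" \<zeta>] mult_right_mono[OF _ norm_ge_zero], of k1] k1[of s]
    unfolding xi_eq inner_add_right inner_scaleR_right cr0 by (simp add: unit z_def)
  have B': "\<bar>B'\<bar> \<le> d * k0 * z"
    using order.trans[OF tri[of y "\<kappa> s" \<zeta>] ck[of "norm \<zeta>"]] by (simp add: B'_def z_def)
  \<comment> \<open>The one triple product with \<open>\<xi>\<close> but without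
    \<open>\<tau> s\<close>: its tangential part \<open>- a * M\<close> is only of first order in
    \<open>d\<close> and is kept to cancel against \<open>M\<close> in \<open>Gt\<close>.\<close>
  have "cross3 y (\<kappa> s) \<bullet> \<tau> s = - M"
    by (simp add: M_def cross3_def inner_vec_def sum_3 vector_3 algebra_simps)
  then have B: "cross3 y (\<kappa> s) \<bullet> \<xi> = B' - a * M"
    by (simp add: B'_def xi_eq inner_add_right)
  have M: "\<bar>M\<bar> \<le> d * k0"
    using order.trans[OF tri[of "\<tau> s" "\<kappa> s" y]] ck[of 1] by (simp add: M_def unit inner_commute mult.commute)
  have Ft: "\<bar>Ft x s\<bar> \<le> d * k1"
    using order.trans[OF tri[of "\<tau> s" "\<kappa>s s" y] mult_right_mono[OF _ norm_ge_zero], of k1] k1[of s]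
    by (simp add: Ft_def y_def[symmetric] unit inner_commute mult.commute d_def)
  have kx: "\<bar>\<xi> \<bullet> \<kappa> s\<bar> \<le> k0 * z"
    using order.trans[OF Cauchy_Schwarz_ineq2[of \<zeta> "\<kappa> s"] mult_left_mono[OF k0 norm_ge_zero]]
    by (simp add: xi_eq inner_add_left tau_kappa z_def mult.commute)
  have ks: "\<bar>y \<bullet> \<kappa>s s\<bar> \<le> d * k1"
    using order.trans[OF Cauchy_Schwarz_ineq2[of y "\<kappa>s s"] mult_left_mono[OF k1 norm_ge_zero]] by (simp add: d_def)
  have p1: "\<bar>y \<bullet> \<xi>\<bar> \<le> d" using Cauchy_Schwarz_ineq2[of y \<xi>] by (simp add: d_def xi)
  have F: "\<bar>F x s\<bar> \<le> d" using Cauchy_Schwarz_ineq2[of y "\<tau> s"] by (simp add: F_def y_def[symmetric] d_def unit)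
  have nu1: "\<bar>\<nu> x s - 1\<bar> \<le> d * k0" using nu_near[of x s] by (simp add: d_def y_def)
  have dk: "d * k0 \<le> 1 / 2"
    using mult_right_mono[of d r0 k0] near small' by (simp add: d_def y_def)
  have q0: "q x s \<ge> 0" by (simp add: q_eq)
  have fb: "\<bar>f (q x s)\<bar> \<le> 1" "\<bar>f1 (q x s)\<bar> \<le> b1" "\<bar>f2 (q x s)\<bar> \<le> b2"
    using f_nonneg f_le_1[OF q0] b1[OF q0] b2[OF q0] by auto
  have rc: "recip (\<nu> x s) = 1 / \<nu> x s" "recip' (\<nu> x s) = - (1 / \<nu> x s)\<^sup>2"
    using nu by (auto simp: recip_def recip'_def)
  have self: "cross3 \<xi> (\<tau> s) \<bullet> \<xi> = 0" by (simp add: dot_cross_self)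
  have "err x \<xi> s = \<nu> x s * (4 * f2 (q x s) * (y \<bullet> \<xi>) * (cross3 y (\<tau> s) \<bullet> \<xi>)
       + (2 * f1 (q x s) * (y \<bullet> \<xi>) * (1 / \<nu> x s) - f (q x s) * (- (1 / \<nu> x s)\<^sup>2) * (\<xi> \<bullet> \<kappa> s)) * (cross3 (\<tau> s) (\<kappa> s) \<bullet> \<xi>))
     + a * (- 4 * f2 (q x s) * F x s * (cross3 y (\<tau> s) \<bullet> \<xi>) + 2 * f1 (q x s) * (B' - a * M)
       + (- 2 * f1 (q x s) * F x s * (1 / \<nu> x s) - f (q x s) * (- (1 / \<nu> x s)\<^sup>2) * (y \<bullet> \<kappa>s s)) * (cross3 (\<tau> s) (\<kappa> s) \<bullet> \<xi>)
       + f (q x s) * (1 / \<nu> x s) * (cross3 (\<tau> s) (\<kappa>s s) \<bullet> \<xi>))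
     - (\<nu> x s * (- 2 * f1 (q x s) * M * a + f (q x s) * (cross3 (\<tau> s) (\<kappa>s s) \<bullet> \<xi>))
       + Ft x s * (- 2 * f1 (q x s) * F x s * a + f (q x s) * (\<xi> \<bullet> \<kappa> s)))"
    unfolding err_def G2x_def G2s_def Gt_def G1s_def rc y_def[symmetric] inner_add_left inner_scaleR_left self B
      M_def[symmetric] a_def[symmetric] inner_commute[of "\<tau> s" \<xi>] inner_commute[of "\<kappa> s" \<xi>]
    by simp
  then have "\<bar>err x \<xi> s\<bar> \<le> Kc k0 k1 b1 b2 * (d\<^sup>2 + z\<^sup>2 + (1 - a))"
    using error_bound_real[OF _ z a small'(2) Kc_nonneg(2-4) p1 D1 T B' M U Ft kx ks F nu1 dk fb] by (simp add: d_def)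
  also have "\<dots> \<le> Kc k0 k1 b1 b2 * ((2 * r0\<^sup>2 + 12) * (1 - f (q x s) * a))"
    using Q_le[OF near xi] Kc_nonneg by (intro mult_left_mono) (auto simp: d_def z_def y_def \<zeta>_def a_def)
  also have "\<dots> = (1 / 2) * (Kcal * (1 - f (q x s) * a))" by (simp add: Kcal_def)
  also have "\<dots> \<le> \<nu> x s * (Kcal * (1 - f (q x s) * a))"
  proof (rule mult_right_mono[OF nu(1)])
    have "f (q x s) * a \<le> 1 * 1" using abs_mult_le[OF fb(1) a] by linarith
    then show "0 \<le> Kcal * (1 - f (q x s) * a)" using Kc_nonneg by (intro mult_nonneg_nonneg) (auto simp: Kcal_def)
  qed
  finally show ?thesis by (simp add: a_def)
qed

section \<open>Smoothness, support and size of the calibrating field\<close>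

lemma smooth_rhoF: "smooth (\<lambda>p. \<rho> (F (fst p) (snd p)))"
  by (rule smooth_comp_real[OF smooth_rho smooth_F])
lemma smooth_fq: "smooth (\<lambda>p. f (q (fst p) (snd p)))" "smooth (\<lambda>p. f1 (q (fst p) (snd p)))"
  by (rule smooth_comp_real[OF _ smooth_q], rule smooth_f)+

lemma smooth_X: "smooth X"
proof -
  have "smooth (\<lambda>p. (\<rho> (F (fst p) (snd p)) * \<nu> (fst p) (snd p)) *\<^sub>R (f (q (fst p) (snd p)) *\<^sub>R \<tau> (snd p)))"
    by (intro smooth_intros smooth_rhoF smooth_nu smooth_fq smooth_tau)
  from smooth_integral[OF this, of 0 L] show ?thesis
    by (simp add: X_def A_def[abs_def] G1_def)
qed

lemma smooth_Y: "smooth Y"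
proof -
  have "smooth (\<lambda>p. \<rho> (F (fst p) (snd p)) *\<^sub>R (\<nu> (fst p) (snd p) *\<^sub>R Gt (fst p) (snd p) + Ft (fst p) (snd p) *\<^sub>R G1s (fst p) (snd p)))"
    unfolding Gt_def Ft_def G1s_def
    by (intro smooth_intros smooth_rhoF smooth_nu smooth_fq smooth_tau smooth_F smooth_kappa smooth_kappas smooth_g)
  from smooth_integral[OF this, of 0 L] show ?thesis
    by (simp add: Y_def[abs_def])
qed

definition tubular where "tubular = {x. \<exists>s\<in>{0..L}. norm (x - g s) \<le> r0}"

lemma bounded_tubular: "bounded tubular"
proof -
  have "compact (g ` {0..L})" by (intro compact_continuous_image) (auto intro: continuous_intros)
  then obtain B where B: "\<And>s. s \<in> {0..L} \<Longrightarrow> norm (g s) \<le> B"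
    using compact_imp_bounded bounded_iff by (metis imageI)
  have "norm x \<le> B + r0" if "x \<in> tubular" for x
  proof -
    obtain s where s: "s \<in> {0..L}" "norm (x - g s) \<le> r0" using \<open>x \<in> tubular\<close> by (auto simp: tubular_def)
    then show ?thesis using B[of s] norm_triangle_sub[of x "g s"] by simp
  qed
  then show ?thesis unfolding bounded_iff by blast
qed

lemma integral_zero_off:
  assumes "x \<notin> tubular" and "\<And>s. norm (x - g s) \<ge> r0 \<Longrightarrow> b s = 0"
  shows "integral {0..L} (\<lambda>s. \<rho> (F x s) *\<^sub>R b s) = (0 :: 'b::real_normed_vector)"
proof -
  have "integral {0..L} (\<lambda>s. \<rho> (F x s) *\<^sub>R b s) = integral {0..L} (\<lambda>s. 0 :: 'b)"
  proof (rule integral_cong)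
    fix s assume "s \<in> {0..L}"
    then have "norm (x - g s) \<ge> r0" using assms(1) by (force simp: tubular_def)
    then show "\<rho> (F x s) *\<^sub>R b s = 0" using assms(2) by simp
  qed
  then show ?thesis by simp
qed

lemma A_alt: "A G x = integral {0..L} (\<lambda>s. \<rho> (F x s) *\<^sub>R (\<nu> x s *\<^sub>R G x s))"
  by (simp add: A_def)

lemma X_off: "x \<notin> tubular \<Longrightarrow> X x = 0" and Y_off: "x \<notin> tubular \<Longrightarrow> Y x = 0"
  unfolding X_def A_alt Y_def
  by (rule integral_zero_off; simp add: G1_def Gt_def G1s_def far)+

lemma test_field_X: "test_field X" and test_field_Y: "test_field Y"
  unfolding test_field_def smooth_on_UNIV_iff
  using smooth_X smooth_Y X_off Y_off by (auto intro: bounded_subset[OF bounded_tubular])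

lemma arc_nu:
  assumes "norm (x - g s0) < r0" "\<bar>s - s0\<bar> \<le> \<delta>"
  shows "norm (x - g s) \<le> r0 + \<delta>" "1 / 2 \<le> \<nu> x s" "\<nu> x s \<le> 3 / 2"
proof -
  have "norm (g s - g s0) \<le> 1 * \<bar>s - s0\<bar>"
    by (rule norm_diff_le_of_vector_derivative[OF g_deriv]) (simp add: unit)
  moreover have "norm (x - g s) \<le> norm (x - g s0) + norm (g s - g s0)"
    using norm_triangle_ineq4[of "x - g s0" "g s - g s0"] by simp
  ultimately show "norm (x - g s) \<le> r0 + \<delta>" using assms by simp
  then show "1 / 2 \<le> \<nu> x s" "\<nu> x s \<le> 3 / 2" by (rule nu_bounds)+
qed

text \<open>Parameters with \<open>norm (x - g s) < r0\<close> give points at mutual distance at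
  most \<open>2 * r0\<close>, so by \<open>sep\<close> those in the period centred at
  \<open>s0\<close> lie within \<open>\<delta>\<close> of \<open>s0\<close>. Everything reduces to
  one arc on which \<open>\<nu>\<close> is positive, even if \<open>\<rho> (F x s)\<close> is
  nonzero on other parts of the curve.\<close>

lemma integral_arc:
  fixes p :: "real \<Rightarrow> 'b::euclidean_space"
  assumes s0: "norm (x - g s0) < r0" and cont: "continuous_on UNIV p" and per: "\<And>s. p (s + L) = p s"
    and out: "\<And>s. norm (x - g s) \<ge> r0 \<Longrightarrow> p s = 0"
  shows "integral {0..L} p = integral {s0 - \<delta>..s0 + \<delta>} p"
proof -
  have "integral {0..L} p = integral {s0 - L/2..s0 - L/2 + L} p"
    using integral_periodic_shift[OF cont per, of "s0 - L/2"] L by simp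
  also have "s0 - L/2 + L = s0 + L/2" by simp
  also have "integral {s0 - L/2..s0 + L/2} p
      = integral {s0 - L/2..s0 + L/2} (\<lambda>s. if s \<in> {s0 - \<delta>..s0 + \<delta>} then p s else 0)"
  proof (rule integral_cong)
    fix s assume s: "s \<in> {s0 - L/2..s0 + L/2}"
    show "p s = (if s \<in> {s0 - \<delta>..s0 + \<delta>} then p s else 0)"
    proof (cases "norm (x - g s) \<ge> r0")
      case True then show ?thesis using out by simp
    next
      case False
      have "norm (g s - g s0) \<le> norm (x - g s0) + norm (x - g s)"
        using norm_triangle_ineq4[of "x - g s0" "x - g s"] by simp
      then have "norm (g s - g s0) \<le> 2 * r0" using False s0 by simp
      then have "\<bar>s - s0\<bar> \<le> \<delta>" by (intro sep abs_leI; use s in simp)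
      then show ?thesis by (auto simp: abs_le_iff)
    qed
  qed
  also have "\<dots> = integral ({s0 - \<delta>..s0 + \<delta>} \<inter> {s0 - L/2..s0 + L/2}) p"
    by (rule integral_restrict_Int)
  also have "{s0 - \<delta>..s0 + \<delta>} \<inter> {s0 - L/2..s0 + L/2} = {s0 - \<delta>..s0 + \<delta>}"
    using \<delta> by auto
  finally show ?thesis .
qed

text \<open>The weight is the \<open>s\<close>-derivative of \<open>- R (F x s)\<close>. As
  \<open>R\<close> has values between 0 and 1, its mass on the arc is at most 1, whatever \<epsilon>
  is.\<close>

lemma arc_weight: "integral {s0 - \<delta>..s0 + \<delta>} (\<lambda>s. \<rho> (F x s) * \<nu> x s) = R (F x (s0 - \<delta>)) - R (F x (s0 + \<delta>))"
proof -
  have "((\<lambda>s. - R (F x s)) has_vector_derivative \<rho> (F x s) * \<nu> x s) (at s)" for s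
    by (rule has_vector_derivative_eq_rhs[OF has_vector_derivative_minus[OF has_vector_derivative_compose_real[OF R_deriv F_s]]])
      simp
  then have "((\<lambda>s. \<rho> (F x s) * \<nu> x s) has_integral (- R (F x (s0 + \<delta>)) - - R (F x (s0 - \<delta>)))) {s0 - \<delta>..s0 + \<delta>}"
    using \<delta> by (intro fundamental_theorem_of_calculus) (auto intro: has_vector_derivative_at_within)
  then show ?thesis by (simp add: integral_unique)
qed

lemma X_inner: "X x \<bullet> \<xi> = integral {0..L} (\<lambda>s. \<rho> (F x s) * \<nu> x s * (f (q x s) * (\<xi> \<bullet> \<tau> s)))"
proof -
  have "X x \<bullet> \<xi> = integral {0..L} (\<lambda>s. ((\<rho> (F x s) * \<nu> x s) *\<^sub>R G1 x s) \<bullet> \<xi>)"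
    unfolding X_def A_def
    by (rule integral_linear[OF _ bounded_linear_inner_left, unfolded o_def, symmetric])
      (unfold G1_def, intro integrable_continuous_real continuous_intros)
  then show ?thesis by (simp add: G1_def inner_commute mult.assoc)
qed

lemma X_inner_arc:
  assumes "norm (x - g s0) < r0"
  shows "X x \<bullet> \<xi> = integral {s0 - \<delta>..s0 + \<delta>} (\<lambda>s. \<rho> (F x s) * \<nu> x s * (f (q x s) * (\<xi> \<bullet> \<tau> s)))"
  unfolding X_inner
  by (rule integral_arc[OF assms]) (auto simp: Fnuq_per tau_per far intro!: continuous_intros)

lemma abs_fa_le: "norm \<xi> = 1 \<Longrightarrow> \<bar>f (q x s) * (\<xi> \<bullet> \<tau> s)\<bar> \<le> 1"
  using abs_mult_le[of "f (q x s)" 1 "\<xi> \<bullet> \<tau> s" 1] Cauchy_Schwarz_ineq2[of \<xi> "\<tau> s"] f_nonneg f_le_1[of "q x s"]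
  by (simp add: unit q_eq)

text \<open>The comparison behind all estimates: on the arc the weight \<open>\<rho> \<nu>\<close>
  is nonnegative with mass at most 1, and integrating \<open>f (\<xi> \<bullet> \<tau>)\<close>
  against it gives exactly \<open>X x \<bullet> \<xi>\<close>. Missing mass only helps, as
  \<open>c0 + c1 \<ge> 0\<close>. If no point of the curve is closer than \<open>r0\<close> to
  \<open>x\<close>, both the integral and \<open>X x\<close> vanish.\<close>

lemma weighted_bound:
  assumes cont: "continuous_on UNIV b" and per: "\<And>s. b (s + L) = b s"
    and out: "\<And>s. norm (x - g s) \<ge> r0 \<Longrightarrow> b s = 0" and c: "c0 \<ge> 0" "c1 \<ge> 0" and xi: "norm \<xi> = 1"
    and near: "\<And>s. norm (x - g s) < r0 \<Longrightarrow> \<bar>b s\<bar> \<le> \<nu> x s * (c0 + c1 * (1 - f (q x s) * (\<xi> \<bullet> \<tau> s)))"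
  shows "\<bar>integral {0..L} (\<lambda>s. \<rho> (F x s) * b s)\<bar> \<le> c0 + c1 * (1 - X x \<bullet> \<xi>)"
proof (cases "\<exists>s0. norm (x - g s0) < r0")
  case False
  then have *: "norm (x - g s) \<ge> r0" for s by (simp add: not_less)
  have "x \<in> tubular \<Longrightarrow> \<exists>s. norm (x - g s) \<le> r0" by (auto simp: tubular_def)
  have "X x = 0"
    unfolding X_def A_def G1_def using far[OF *] by simp
  then show ?thesis using out[OF *] c by simp
next
  case True
  then obtain s0 where s0: "norm (x - g s0) < r0" by blast
  let ?I = "{s0 - \<delta>..s0 + \<delta>}"
  have "integral {0..L} (\<lambda>s. \<rho> (F x s) * b s) = integral ?I (\<lambda>s. \<rho> (F x s) * b s)"
    by (rule integral_arc[OF s0]) (auto simp: Fnuq_per per out intro!: continuous_intros cont)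
  moreover have "norm (integral ?I (\<lambda>s. \<rho> (F x s) * b s)) \<le>
      integral ?I (\<lambda>s. \<rho> (F x s) * \<nu> x s * (c0 + c1) - c1 * (\<rho> (F x s) * \<nu> x s * (f (q x s) * (\<xi> \<bullet> \<tau> s))))"
  proof (rule integral_norm_bound_integral)
    show "(\<lambda>s. \<rho> (F x s) * b s) integrable_on ?I"
      by (intro integrable_continuous_real continuous_intros continuous_on_subset[OF cont]) auto
    show "(\<lambda>s. \<rho> (F x s) * \<nu> x s * (c0 + c1) - c1 * (\<rho> (F x s) * \<nu> x s * (f (q x s) * (\<xi> \<bullet> \<tau> s)))) integrable_on ?I"
      by (intro integrable_continuous_real continuous_intros)
    fix s assume "s \<in> ?I"
    then have nu: "\<nu> x s \<ge> 1 / 2" using arc_nu[OF s0, of s] by (auto simp: abs_le_iff)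
    have "\<bar>b s\<bar> \<le> \<nu> x s * (c0 + c1 * (1 - f (q x s) * (\<xi> \<bullet> \<tau> s)))"
    proof (cases "norm (x - g s) \<ge> r0")
      case True then show ?thesis using out far nu c by simp
    qed (use near in simp)
    then have "\<rho> (F x s) * \<bar>b s\<bar> \<le> \<rho> (F x s) * (\<nu> x s * (c0 + c1 * (1 - f (q x s) * (\<xi> \<bullet> \<tau> s))))"
      using rho_nonneg by (rule mult_left_mono)
    then show "norm (\<rho> (F x s) * b s) \<le> \<rho> (F x s) * \<nu> x s * (c0 + c1) - c1 * (\<rho> (F x s) * \<nu> x s * (f (q x s) * (\<xi> \<bullet> \<tau> s)))"
      using rho_nonneg by (simp add: abs_mult algebra_simps)
  qed
  moreover have "integral ?I (\<lambda>s. \<rho> (F x s) * \<nu> x s * (c0 + c1) - c1 * (\<rho> (F x s) * \<nu> x s * (f (q x s) * (\<xi> \<bullet> \<tau> s))))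
      = (R (F x (s0 - \<delta>)) - R (F x (s0 + \<delta>))) * (c0 + c1) - c1 * (X x \<bullet> \<xi>)"
    unfolding X_inner_arc[OF s0] arc_weight[symmetric]
    by (subst integral_diff) (auto intro!: integrable_continuous_real continuous_intros)
  moreover have "(R (F x (s0 - \<delta>)) - R (F x (s0 + \<delta>))) * (c0 + c1) \<le> 1 * (c0 + c1)"
    using R_bounds(1)[of "F x (s0 + \<delta>)"] R_bounds(2)[of "F x (s0 - \<delta>)"] c by (intro mult_right_mono) auto
  ultimately show ?thesis by (simp add: algebra_simps)
qed

text \<open>This is \<open>weighted_bound\<close> for the zero function: its right-hand side must be
  nonnegative.\<close>

lemma X_inner_le_1: "norm \<xi> = 1 \<Longrightarrow> X x \<bullet> \<xi> \<le> 1"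
proof -
  assume xi: "norm \<xi> = 1"
  have "\<bar>integral {0..L} (\<lambda>s. \<rho> (F x s) * 0)\<bar> \<le> 0 + 1 * (1 - X x \<bullet> \<xi>)"
  proof (rule weighted_bound[OF _ _ _ _ _ xi])
    fix s assume "norm (x - g s) < r0"
    then have "\<nu> x s \<ge> 1 / 2" using nu_bounds \<delta> by simp
    then show "\<bar>0\<bar> \<le> \<nu> x s * (0 + 1 * (1 - f (q x s) * (\<xi> \<bullet> \<tau> s)))"
      using abs_fa_le[OF xi, of x s] by (auto intro!: mult_nonneg_nonneg)
  qed auto
  then show "X x \<bullet> \<xi> \<le> 1" by simp
qed

lemma norm_X_le_1: "norm (X x) \<le> 1"
proof (cases "X x = 0")
  case False
  then have "X x \<bullet> (X x /\<^sub>R norm (X x)) \<le> 1" by (intro X_inner_le_1) simp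
  moreover have "X x \<bullet> (X x /\<^sub>R norm (X x)) = norm (X x)"
    using False by (simp add: power2_norm_eq_inner[symmetric] power2_eq_square)
  ultimately show ?thesis by simp
qed simp

lemma Kcal_nonneg: "Kcal \<ge> 0" using Kc_nonneg by (simp add: Kcal_def)

lemma evolution_bound:
  assumes xi: "norm \<xi> = 1"
  shows "\<bar>Dcurl_xi X x \<xi> - Y x \<bullet> \<xi>\<bar> \<le> Kcal * (1 - X x \<bullet> \<xi>)"
proof -
  have "\<bar>integral {0..L} (\<lambda>s. \<rho> (F x s) * err x \<xi> s)\<bar> \<le> 0 + Kcal * (1 - X x \<bullet> \<xi>)"
  proof (rule weighted_bound[OF _ _ _ _ _ xi])
    show "continuous_on UNIV (err x \<xi>)"
      unfolding err_def[abs_def] G2x_def G2s_def Gt_def Ft_def G1s_def by (intro continuous_intros)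
    show "err x \<xi> (s + L) = err x \<xi> s" for s
      by (simp add: err_def G2x_def G2s_def Gt_def Ft_def G1s_def Fnuq_per g_per tau_per kappa_per kappas_per)
    show "err x \<xi> s = 0" if "r0 \<le> norm (x - g s)" for s
      using far[OF that] by (simp add: err_def G2x_def G2s_def Gt_def Ft_def G1s_def)
    show "\<bar>err x \<xi> s\<bar> \<le> \<nu> x s * (0 + Kcal * (1 - f (q x s) * (\<xi> \<bullet> \<tau> s)))" if "norm (x - g s) < r0" for s
      using err_bound[OF that xi] by simp
  qed (use Kcal_nonneg in auto)
  then show ?thesis unfolding Dcurl_minus_Y by simp
qed

text \<open>Across the arc \<open>F x\<close> falls from at least \<epsilon> to at most -\<epsilon>
  with slope at most \<open>- 1 / 2\<close>, so the weight has full mass 1 and lives on parameters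
  within \<open>2 * \<epsilon>\<close> of \<open>s0\<close>. There \<open>q\<close> is at most
  \<open>4 * \<epsilon>\<^sup>2\<close>, which lowers \<open>f\<close> by at most
  \<open>4 * b1 * \<epsilon>\<^sup>2\<close>, and \<open>\<tau>\<close> turns by at most
  \<open>2 * k0 * \<epsilon>\<close>.\<close>

lemma X_on_curve:
  assumes eps: "\<epsilon> \<le> \<delta> / 2"
  shows "X (g s0) \<bullet> \<tau> s0 \<ge> 1 - (4 * b1 * \<epsilon>\<^sup>2 + 2 * k0 * \<epsilon>)"
proof -
  define x where "x = g s0"
  have s0: "norm (x - g s0) < r0" using r0 by (simp add: x_def)
  let ?I = "{s0 - \<delta>..s0 + \<delta>}"
  define c where "c = 4 * b1 * \<epsilon>\<^sup>2 + 2 * k0 * \<epsilon>"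
  have F0: "F x s0 = 0" by (simp add: F_def x_def)
  have Fmono: "F x u - F x v \<ge> (v - u) / 2" if "u \<in> ?I" "v \<in> ?I" "u \<le> v" for u v
  proof (cases "u = v")
    case False
    then have "u < v" using that by simp
    have "\<exists>z>u. z < v \<and> F x v - F x u = (v - u) * (- \<nu> x z)"
    proof (rule MVT2[OF \<open>u < v\<close>])
      show "(F x has_real_derivative - \<nu> x z) (at z)" for z
        using F_s[of x z] by (simp add: has_real_derivative_iff_has_vector_derivative)
    qed
    then obtain z where z: "u < z" "z < v" "F x v - F x u = (v - u) * (- \<nu> x z)" by blast
    have "1 / 2 \<le> \<nu> x z" using arc_nu[OF s0, of z] z that by auto
    then have "(v - u) * (1 / 2) \<le> (v - u) * \<nu> x z" using that by (intro mult_left_mono) auto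
    then show ?thesis using z(3) by simp
  qed simp
  have "F x (s0 - \<delta>) \<ge> \<epsilon>" "F x (s0 + \<delta>) \<le> - \<epsilon>"
    using Fmono[of "s0 - \<delta>" s0] Fmono[of s0 "s0 + \<delta>"] F0 \<delta> eps by auto
  then have W: "integral ?I (\<lambda>s. \<rho> (F x s) * \<nu> x s) = 1"
    unfolding arc_weight using R_hi R_lo by simp
  have "integral ?I (\<lambda>s. \<rho> (F x s) * \<nu> x s * (1 - c)) \<le> X x \<bullet> \<tau> s0"
    unfolding X_inner_arc[OF s0]
  proof (rule integral_le)
    show "(\<lambda>s. \<rho> (F x s) * \<nu> x s * (1 - c)) integrable_on ?I"
      "(\<lambda>s. \<rho> (F x s) * \<nu> x s * (f (q x s) * (\<tau> s0 \<bullet> \<tau> s))) integrable_on ?I"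
      by (intro integrable_continuous_real continuous_intros)+
    fix s assume s: "s \<in> ?I"
    then have nu: "\<nu> x s \<ge> 1 / 2" using arc_nu[OF s0, of s] by (auto simp: abs_le_iff)
    show "\<rho> (F x s) * \<nu> x s * (1 - c) \<le> \<rho> (F x s) * \<nu> x s * (f (q x s) * (\<tau> s0 \<bullet> \<tau> s))"
    proof (cases "\<bar>F x s\<bar> \<ge> \<epsilon>")
      case True then show ?thesis using rho_out by simp
    next
      case False
      have ds: "\<bar>s - s0\<bar> \<le> 2 * \<epsilon>"
        using Fmono[of s s0] Fmono[of s0 s] F0 False s \<delta> by (cases "s \<le> s0") auto
      have lip: "norm (g s - g s0) \<le> \<bar>s - s0\<bar>"
        using norm_diff_le_of_vector_derivative[OF g_deriv, of 1 s s0] by (simp add: unit)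
      have "(norm (x - g s))\<^sup>2 \<le> (2 * \<epsilon>)\<^sup>2"
        using lip ds by (intro power_mono) (auto simp: x_def norm_minus_commute)
      then have q: "0 \<le> q x s" "q x s \<le> 4 * \<epsilon>\<^sup>2" by (auto simp: q_eq power_mult_distrib)
      have "\<exists>z. 0 \<le> z \<and> f (q x s) - 1 = q x s * f1 z"
      proof (cases "q x s = 0")
        case False
        then have "0 < q x s" using q by simp
        from MVT2[OF this f_deriv] show ?thesis by (auto simp: f_0 intro: less_imp_le)
      qed (auto simp: f_0)
      then obtain z where z: "0 \<le> z" "f (q x s) - 1 = q x s * f1 z" by blast
      have "\<bar>q x s * f1 z\<bar> \<le> (4 * \<epsilon>\<^sup>2) * b1" using q b1[OF z(1)] by (intro abs_mult_le) auto
      then have f: "1 - f (q x s) \<le> 4 * b1 * \<epsilon>\<^sup>2" using z by (simp add: mult_ac)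
      have "norm (\<tau> s - \<tau> s0) \<le> k0 * \<bar>s - s0\<bar>"
        by (rule norm_diff_le_of_vector_derivative[OF tau_deriv k0])
      also have "\<dots> \<le> k0 * (2 * \<epsilon>)" using ds small' by (intro mult_left_mono) auto
      finally have "\<bar>\<tau> s0 \<bullet> (\<tau> s - \<tau> s0)\<bar> \<le> 2 * k0 * \<epsilon>"
        using Cauchy_Schwarz_ineq2[of "\<tau> s0" "\<tau> s - \<tau> s0"] by (simp add: unit)
      then have a: "1 - \<tau> s0 \<bullet> \<tau> s \<le> 2 * k0 * \<epsilon>" by (simp add: inner_diff_right tau_tau)
      have "0 \<le> 1 - \<tau> s0 \<bullet> \<tau> s" using Cauchy_Schwarz_ineq2[of "\<tau> s0" "\<tau> s"] by (simp add: unit)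
      then have "f (q x s) * (1 - \<tau> s0 \<bullet> \<tau> s) \<le> 1 * (1 - \<tau> s0 \<bullet> \<tau> s)"
        using f_le_1[OF q(1)] by (intro mult_right_mono) auto
      then have "1 - c \<le> f (q x s) * (\<tau> s0 \<bullet> \<tau> s)" using f a by (simp add: c_def algebra_simps)
      then show ?thesis using rho_nonneg nu by (intro mult_left_mono) auto
    qed
  qed
  moreover have "integral ?I (\<lambda>s. \<rho> (F x s) * \<nu> x s * (1 - c)) = 1 - c"
    unfolding integral_mult_left W by simp
  ultimately show ?thesis by (simp only: x_def c_def)
qed

end

section \<open>Gradient fields and averaged potentials\<close>

lemma curl_gradient:
  fixes \<phi> :: "real^3 \<Rightarrow> real"
  assumes \<phi>: "\<And>x. (\<phi> has_derivative (\<lambda>v. W x \<bullet> v)) (at x)" and W: "smooth W"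
  shows "curl W x = 0"
proof -
  define D where "D x = frechet_derivative W (at x)" for x
  have D: "(W has_derivative D x) (at x)" for x
    unfolding D_def by (rule smooth_has_derivative[OF W])
  \<comment> \<open>Symmetry of the Hessian, from exchanging the derivatives of
    \<open>\<phi>\<close> in the directions \<open>u\<close> and \<open>v\<close>.\<close>
  have sym: "D x v \<bullet> u = D x u \<bullet> v" for u v
  proof -
    have line_t: "((\<lambda>r. x + r *\<^sub>R u + s *\<^sub>R v) has_derivative (\<lambda>h. h *\<^sub>R u)) (at t)" for s t
      by (auto intro!: derivative_eq_intros)
    have line_s: "((\<lambda>r. x + t *\<^sub>R u + r *\<^sub>R v) has_derivative (\<lambda>h. h *\<^sub>R v)) (at s)" for s t
      by (auto intro!: derivative_eq_intros)
    have Wd: "((\<lambda>r. W (c r) \<bullet> b) has_vector_derivative D (c t) w \<bullet> b) (at t)"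
      if "(c has_derivative (\<lambda>h. h *\<^sub>R w)) (at t)" for c b w and t :: real
    proof -
      have "((\<lambda>r. W (c r)) has_derivative (\<lambda>h. D (c t) (h *\<^sub>R w))) (at t)"
        by (rule has_derivative_compose[OF that D])
      from has_derivative_inner_left[OF this, of b] show ?thesis
        unfolding has_vector_derivative_def by (rule has_derivative_eq_rhs)
          (simp add: linear_scale[OF has_derivative_linear[OF D]])
    qed
    have "((\<lambda>r. W (x + r *\<^sub>R u + 0 *\<^sub>R v) \<bullet> v) has_vector_derivative D (x + 0 *\<^sub>R u + 0 *\<^sub>R v) v \<bullet> u) (at 0 within UNIV)"
    proof (rule has_vector_derivative_swap[where u = "\<lambda>t s. \<phi> (x + t *\<^sub>R u + s *\<^sub>R v)"
          and us = "\<lambda>t s. W (x + t *\<^sub>R u + s *\<^sub>R v) \<bullet> v" and w = "\<lambda>t s. W (x + t *\<^sub>R u + s *\<^sub>R v) \<bullet> u"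
          and ws = "\<lambda>t s. D (x + t *\<^sub>R u + s *\<^sub>R v) v \<bullet> u"])
      show "((\<lambda>r. \<phi> (x + r *\<^sub>R u + s *\<^sub>R v)) has_vector_derivative W (x + t *\<^sub>R u + s *\<^sub>R v) \<bullet> u) (at t within UNIV)" for t s
        unfolding has_vector_derivative_def
        by (rule has_derivative_eq_rhs[OF has_derivative_compose[OF line_t \<phi>]]) simp
      show "((\<lambda>s. \<phi> (x + t *\<^sub>R u + s *\<^sub>R v)) has_vector_derivative W (x + t *\<^sub>R u + s *\<^sub>R v) \<bullet> v) (at s)" for t s
        unfolding has_vector_derivative_def
        by (rule has_derivative_eq_rhs[OF has_derivative_compose[OF line_s \<phi>]]) simp
      show "((\<lambda>s. W (x + t *\<^sub>R u + s *\<^sub>R v) \<bullet> u) has_vector_derivative D (x + t *\<^sub>R u + s *\<^sub>R v) v \<bullet> u) (at s)" for t s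
        by (rule Wd[OF line_s])
      have "continuous_on UNIV (\<lambda>x. D x v)"
        unfolding D_def by (intro smooth_imp_continuous smooth_has_derivative[OF W])
      note [continuous_intros] = this[THEN continuous_on_compose2, OF _ subset_UNIV]
      show "continuous_on (UNIV \<times> UNIV) (\<lambda>(t, s). D (x + t *\<^sub>R u + s *\<^sub>R v) v \<bullet> u)"
        unfolding case_prod_unfold by (intro continuous_intros)
    qed auto
    from vector_derivative_unique_at[OF this[simplified] Wd[OF line_t[of 0 0, simplified], of v, simplified]]
    show ?thesis by simp
  qed
  have ax: "D x (axis i 1) $ j = D x (axis j 1) $ i" for i j
    using sym[of "axis i 1" "axis j 1"] by (simp add: inner_axis)
  show ?thesis
    unfolding curl_eq[OF D] ax[of 3 2] ax[of 3 1] ax[of 2 1] by (simp add: vec_eq_iff forall_3 vector_3)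
qed

lemma Dcurl_xi_gradient:
  fixes \<phi> :: "real^3 \<Rightarrow> real"
  assumes "\<And>x. (\<phi> has_derivative (\<lambda>v. W x \<bullet> v)) (at x)" and "smooth W"
  shows "Dcurl_xi W x \<xi> = 0"
proof -
  have "curl W = (\<lambda>x. 0)" using curl_gradient[OF assms] by auto
  then have "(curl W has_derivative (\<lambda>v. 0)) (at x)" by simp
  from Dcurl_xi_eq[OF this] show ?thesis by simp
qed

context calib begin

text \<open>Stand-in for the constant 1 when a function of \<open>x\<close> alone has to be brought
  under the averaging integral; by \<open>Af_bounds\<close> it lies between
  \<open>X x \<bullet> \<xi>\<close> and 1.\<close>

definition Af where "Af x = integral {0..L} (\<lambda>s. \<rho> (F x s) * (\<nu> x s * f (q x s)))"

lemma Af_bounds: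
  assumes xi: "norm \<xi> = 1"
  shows "X x \<bullet> \<xi> \<le> Af x" "Af x \<le> 1"
proof -
  define b where "b s = \<nu> x s * f (q x s) * (1 - \<xi> \<bullet> \<tau> s)" for s
  have a: "\<xi> \<bullet> \<tau> s \<le> 1" for s using Cauchy_Schwarz_ineq2[of \<xi> "\<tau> s"] by (simp add: xi unit)
  have eq: "integral {0..L} (\<lambda>s. \<rho> (F x s) * b s) = Af x - X x \<bullet> \<xi>"
  proof -
    have "Af x - X x \<bullet> \<xi> = integral {0..L} (\<lambda>s. \<rho> (F x s) * (\<nu> x s * f (q x s)) - \<rho> (F x s) * \<nu> x s * (f (q x s) * (\<xi> \<bullet> \<tau> s)))"
      unfolding Af_def X_inner
      by (rule integral_diff[symmetric]) (intro integrable_continuous_real continuous_intros)+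
    then show ?thesis by (simp add: b_def algebra_simps)
  qed
  have nf: "\<nu> x s * f (q x s) \<ge> 0" for s
  proof (cases "norm (x - g s) \<ge> r0")
    case False
    then have "\<nu> x s \<ge> 1 / 2" using nu_bounds \<delta> by simp
    then show ?thesis using f_nonneg by (auto intro: mult_nonneg_nonneg)
  qed (simp add: far)
  have "0 \<le> integral {0..L} (\<lambda>s. \<rho> (F x s) * b s)"
  proof (rule integral_nonneg)
    show "(\<lambda>s. \<rho> (F x s) * b s) integrable_on {0..L}"
      unfolding b_def by (intro integrable_continuous_real continuous_intros)
    show "0 \<le> \<rho> (F x s) * b s" for s
      unfolding b_def using a[of s] by (intro mult_nonneg_nonneg[OF rho_nonneg mult_nonneg_nonneg[OF nf]]) simp
  qed
  then show "X x \<bullet> \<xi> \<le> Af x" using eq by simp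
  have "\<bar>integral {0..L} (\<lambda>s. \<rho> (F x s) * b s)\<bar> \<le> 0 + 1 * (1 - X x \<bullet> \<xi>)"
  proof (rule weighted_bound[OF _ _ _ _ _ xi])
    show "continuous_on UNIV b" unfolding b_def by (intro continuous_intros)
    show "b (s + L) = b s" for s by (simp add: b_def Fnuq_per tau_per)
    show "b s = 0" if "r0 \<le> norm (x - g s)" for s using far[OF that] by (simp add: b_def)
    fix s assume "norm (x - g s) < r0"
    then have nu: "\<nu> x s \<ge> 1 / 2" using nu_bounds \<delta> by simp
    have "\<bar>b s\<bar> = \<nu> x s * (f (q x s) * (1 - \<xi> \<bullet> \<tau> s))"
      using mult_nonneg_nonneg[OF nf[of s], of "1 - \<xi> \<bullet> \<tau> s"] a[of s] by (simp add: b_def mult.assoc)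
    also have "\<dots> \<le> \<nu> x s * (0 + 1 * (1 - f (q x s) * (\<xi> \<bullet> \<tau> s)))"
      using nu f_le_1[of "q x s"] by (intro mult_left_mono) (auto simp: right_diff_distrib q_eq)
    finally show "\<bar>b s\<bar> \<le> \<nu> x s * (0 + 1 * (1 - f (q x s) * (\<xi> \<bullet> \<tau> s)))" .
  qed auto
  then show "Af x \<le> 1" using eq by simp
qed

text \<open>Gradient of the potential \<open>A\<close> of \<open>f * h\<close>, read off from
  \<open>A_has_derivative\<close> when \<open>h'\<close> is the derivative of \<open>h\<close>. On
  the curve it is close to \<open>h' \<tau>\<close> for small \<epsilon>, so \<open>h'\<close>
  prescribes its tangential component.\<close>

definition W :: "(real \<Rightarrow> real) \<Rightarrow> (real \<Rightarrow> real) \<Rightarrow> real^3 \<Rightarrow> real^3" where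
  "W h h' x = integral {0..L} (\<lambda>s. \<rho> (F x s) *\<^sub>R ((\<nu> x s * 2 * f1 (q x s) * h s) *\<^sub>R (x - g s)
     + (- 2 * f1 (q x s) * F x s * h s + f (q x s) * h' s) *\<^sub>R \<tau> s))"

lemma W_gradient:
  assumes h: "\<And>s. (h has_real_derivative h' s) (at s)" and cont: "continuous_on UNIV h'" and per: "h L = h 0"
  shows "(A (\<lambda>x s. f (q x s) * h s) has_derivative (\<lambda>v. W h h' x \<bullet> v)) (at x)"
proof -
  have ch: "continuous_on UNIV h" using h DERIV_continuous_on by blast
  note [continuous_intros] = ch[THEN continuous_on_compose2, OF _ subset_UNIV] cont[THEN continuous_on_compose2, OF _ subset_UNIV]
  have "(A (\<lambda>x s. f (q x s) * h s) has_derivative (\<lambda>v. integral {0..L} (\<lambda>s. \<rho> (F x s) *\<^sub>R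
           (\<nu> x s *\<^sub>R (2 * f1 (q x s) * ((x - g s) \<bullet> v) * h s) + (v \<bullet> \<tau> s) *\<^sub>R (- 2 * f1 (q x s) * F x s * h s + f (q x s) * h' s))))) (at x)"
  proof (rule A_has_derivative)
    show "((\<lambda>x. f (q x s) * h s) has_derivative (\<lambda>v. 2 * f1 (q x s) * ((x - g s) \<bullet> v) * h s)) (at x)" for x s
      by (rule has_derivative_eq_rhs[OF has_derivative_mult_left[OF has_derivative_compose_real[OF f_deriv q_x]]]) auto
    show "((\<lambda>s. f (q x s) * h s) has_vector_derivative (- 2 * f1 (q x s) * F x s * h s + f (q x s) * h' s)) (at s)" for x s
      by (rule has_vector_derivative_eq_rhs[OF has_vector_derivative_times[OF has_vector_derivative_compose_real[OF f_deriv q_s]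
              h[unfolded has_real_derivative_iff_has_vector_derivative]]]) auto
    show "continuous_on UNIV (\<lambda>p. f (q (fst p) (snd p)) * h (snd p))"
      "continuous_on UNIV (\<lambda>p. 2 * f1 (q (fst p) (snd p)) * ((fst p - g (snd p)) \<bullet> v) * h (snd p))"
      "continuous_on UNIV (\<lambda>p. - 2 * f1 (q (fst p) (snd p)) * F (fst p) (snd p) * h (snd p) + f (q (fst p) (snd p)) * h' (snd p))" for v
      by (intro continuous_intros)+
    show "f (q x L) * h L = f (q x 0) * h 0" for x by (simp add: Fnuq_L per)
  qed
  moreover have "W h h' x \<bullet> v = integral {0..L} (\<lambda>s. \<rho> (F x s) *\<^sub>R
           (\<nu> x s *\<^sub>R (2 * f1 (q x s) * ((x - g s) \<bullet> v) * h s) + (v \<bullet> \<tau> s) *\<^sub>R (- 2 * f1 (q x s) * F x s * h s + f (q x s) * h' s)))" for v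
  proof -
    have "W h h' x \<bullet> v = integral {0..L} (\<lambda>s. (\<rho> (F x s) *\<^sub>R ((\<nu> x s * 2 * f1 (q x s) * h s) *\<^sub>R (x - g s)
     + (- 2 * f1 (q x s) * F x s * h s + f (q x s) * h' s) *\<^sub>R \<tau> s)) \<bullet> v)"
      unfolding W_def
      by (rule integral_linear[OF _ bounded_linear_inner_left, unfolded o_def, symmetric])
        (intro integrable_continuous_real continuous_intros)
    then show ?thesis by (simp add: inner_add_left inner_commute[of "\<tau> _" v] algebra_simps)
  qed
  ultimately show ?thesis by simp
qed

lemma test_field_W:
  assumes "smooth h" "smooth h'"
  shows "test_field (W h h')"
proof -
  have "smooth (\<lambda>p. \<rho> (F (fst p) (snd p)) *\<^sub>R ((\<nu> (fst p) (snd p) * 2 * f1 (q (fst p) (snd p)) * h (snd p)) *\<^sub>R (fst p - g (snd p))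
     + (- 2 * f1 (q (fst p) (snd p)) * F (fst p) (snd p) * h (snd p) + f (q (fst p) (snd p)) * h' (snd p)) *\<^sub>R \<tau> (snd p)))"
    by (intro smooth_intros smooth_rhoF smooth_nu smooth_fq smooth_tau smooth_F smooth_g assms)
  from smooth_integral[OF this, of 0 L] have "smooth (W h h')" by (simp add: W_def[abs_def])
  moreover have "W h h' x = 0" if "x \<notin> tubular" for x
    unfolding W_def using that by (rule integral_zero_off) (simp add: far)
  ultimately show ?thesis unfolding test_field_def smooth_on_UNIV_iff
    by (auto intro: bounded_subset[OF bounded_tubular])
qed

text \<open>Near the curve and for \<open>\<xi>\<close> near the tangent,
  \<open>W \<bullet> \<xi>\<close> is about
  \<open>(Z \<bullet> \<tau> - m) (\<xi> \<bullet> \<tau>)\<close>, hence about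
  \<open>Z \<bullet> \<xi> - m (X \<bullet> \<xi>)\<close>. The error is linear in distance and
  angle whereas the defect controls only squares; \<eta> trades one for the other.\<close>

lemma potential_bound:
  assumes h: "continuous_on UNIV h" and h': "continuous_on UNIV h'"
    and per: "\<And>s. h (s + L) = h s" "\<And>s. h' (s + L) = h' s"
    and hb: "\<And>s. \<bar>h s\<bar> \<le> H" and h'_eq: "\<And>s. h' s = Z (g s) \<bullet> \<tau> s - m"
    and Zb: "\<And>x. norm (Z x) \<le> CZ" and Zl: "\<And>x y. norm (Z x - Z y) \<le> LZ * norm (x - y)"
    and xi: "norm \<xi> = 1" and \<eta>: "\<eta> > 0"
  defines "C \<equiv> 5 * b1 * H + LZ + k0 * (CZ + \<bar>m\<bar>) + CZ"
  shows "\<bar>W h h' x \<bullet> \<xi> - Z x \<bullet> \<xi> + m * (X x \<bullet> \<xi>)\<bar>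
     \<le> 4 * C * \<eta> + (2 * C * (2 * r0\<^sup>2 + 12) / \<eta> + CZ) * (1 - X x \<bullet> \<xi>)"
proof -
  note [continuous_intros] = h[THEN continuous_on_compose2, OF _ subset_UNIV] h'[THEN continuous_on_compose2, OF _ subset_UNIV]
  define zx where "zx = Z x \<bullet> \<xi>"
  define b where "b s = \<nu> x s * 2 * f1 (q x s) * h s * ((x - g s) \<bullet> \<xi>)
     + (- 2 * f1 (q x s) * F x s * h s + f (q x s) * h' s) * (\<xi> \<bullet> \<tau> s)
     - \<nu> x s * f (q x s) * zx + m * (\<nu> x s * f (q x s) * (\<xi> \<bullet> \<tau> s))" for s
  have CZ: "CZ \<ge> 0" using Zb[of 0] norm_ge_zero[of "Z 0"] by linarith
  have H: "H \<ge> 0" using hb[of 0] by linarith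
  have zx: "\<bar>zx\<bar> \<le> CZ" unfolding zx_def using Cauchy_Schwarz_ineq2[of "Z x" \<xi>] Zb[of x] by (simp add: xi)
  have "LZ * 1 \<ge> 0"
  proof -
    obtain e :: "real^3" where e: "norm e = 1" using vector_choose_size[of 1] by auto
    show ?thesis using Zl[of e 0] norm_ge_zero[of "Z e - Z 0"] unfolding diff_0_right e by linarith
  qed
  then have LZ: "LZ \<ge> 0" by simp
  have C: "C \<ge> 0" unfolding C_def using CZ LZ H small' Kc_nonneg by simp
  have eq: "integral {0..L} (\<lambda>s. \<rho> (F x s) * b s) = W h h' x \<bullet> \<xi> - zx * Af x + m * (X x \<bullet> \<xi>)"
  proof -
    have 1: "W h h' x \<bullet> \<xi> = integral {0..L} (\<lambda>s. \<rho> (F x s) * (\<nu> x s * 2 * f1 (q x s) * h s * ((x - g s) \<bullet> \<xi>)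
     + (- 2 * f1 (q x s) * F x s * h s + f (q x s) * h' s) * (\<xi> \<bullet> \<tau> s)))"
    proof -
      have "W h h' x \<bullet> \<xi> = integral {0..L} (\<lambda>s. (\<rho> (F x s) *\<^sub>R ((\<nu> x s * 2 * f1 (q x s) * h s) *\<^sub>R (x - g s)
        + (- 2 * f1 (q x s) * F x s * h s + f (q x s) * h' s) *\<^sub>R \<tau> s)) \<bullet> \<xi>)"
        unfolding W_def
        by (rule integral_linear[OF _ bounded_linear_inner_left, unfolded o_def, symmetric])
          (intro integrable_continuous_real continuous_intros)
      then show ?thesis by (simp add: inner_add_left inner_commute[of "\<tau> _" \<xi>])
    qed
    have "W h h' x \<bullet> \<xi> - zx * Af x + m * (X x \<bullet> \<xi>) = integral {0..L} (\<lambda>s. \<rho> (F x s) * (\<nu> x s * 2 * f1 (q x s) * h s * ((x - g s) \<bullet> \<xi>)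
     + (- 2 * f1 (q x s) * F x s * h s + f (q x s) * h' s) * (\<xi> \<bullet> \<tau> s)) - zx * (\<rho> (F x s) * (\<nu> x s * f (q x s)))
      + m * (\<rho> (F x s) * \<nu> x s * (f (q x s) * (\<xi> \<bullet> \<tau> s))))"
      unfolding 1 Af_def X_inner integral_mult_right[symmetric]
      by (subst integral_diff[symmetric], (intro integrable_continuous_real continuous_intros)+,
          subst integral_add[symmetric], (intro integrable_continuous_real continuous_intros)+) simp
    also have "\<dots> = integral {0..L} (\<lambda>s. \<rho> (F x s) * b s)"
      unfolding b_def by (intro integral_cong) (simp add: algebra_simps)
    finally show ?thesis by simp
  qed
  have "\<bar>integral {0..L} (\<lambda>s. \<rho> (F x s) * b s)\<bar> \<le> 4 * C * \<eta> + 2 * C * (2 * r0\<^sup>2 + 12) / \<eta> * (1 - X x \<bullet> \<xi>)"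
  proof (rule weighted_bound[OF _ _ _ _ _ xi])
    show "continuous_on UNIV b" unfolding b_def by (intro continuous_intros)
    show "b (s + L) = b s" for s by (simp add: b_def Fnuq_per tau_per g_per per)
    show "b s = 0" if "r0 \<le> norm (x - g s)" for s using far[OF that] by (simp add: b_def)
    show "4 * C * \<eta> \<ge> 0" "2 * C * (2 * r0\<^sup>2 + 12) / \<eta> \<ge> 0" using C \<eta> by simp_all
    fix s assume near: "norm (x - g s) < r0"
    define d where "d = norm (x - g s)"
    define a where "a = \<xi> \<bullet> \<tau> s"
    define z where "z = norm (\<xi> - a *\<^sub>R \<tau> s)"
    have dz: "d \<ge> 0" "z \<ge> 0" by (simp_all add: d_def z_def)
    have nu: "1 / 2 \<le> \<nu> x s" "\<nu> x s \<le> 3 / 2" using nu_bounds[of x s] near \<delta> by auto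
    have a: "\<bar>a\<bar> \<le> 1" using Cauchy_Schwarz_ineq2[of \<xi> "\<tau> s"] by (simp add: a_def xi unit)
    have p1: "\<bar>(x - g s) \<bullet> \<xi>\<bar> \<le> d" using Cauchy_Schwarz_ineq2[of "x - g s" \<xi>] by (simp add: d_def xi)
    have F: "\<bar>F x s\<bar> \<le> d" using Cauchy_Schwarz_ineq2[of "x - g s" "\<tau> s"] by (simp add: F_def d_def unit)
    have q0: "q x s \<ge> 0" by (simp add: q_eq)
    have fb: "\<bar>f (q x s)\<bar> \<le> 1" "\<bar>f1 (q x s)\<bar> \<le> b1" using f_nonneg f_le_1[OF q0] b1[OF q0] by auto
    have nu1: "\<bar>1 - \<nu> x s\<bar> \<le> d * k0" using nu_near[of x s] by (simp add: d_def abs_minus_commute)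
    \<comment> \<open>\<open>w1\<close> collects the terms with \<open>f1\<close>, which vanish at
      \<open>x = g s\<close>; \<open>w2\<close> compares \<open>Z\<close> at \<open>x\<close> with
      its tangential part on the curve; \<open>w3\<close> comes from \<open>\<nu>\<close> differing
      from 1.\<close>
    define w1 where "w1 = f1 (q x s) * h s * (2 * \<nu> x s * ((x - g s) \<bullet> \<xi>) - 2 * F x s * a)"
    define w2 where "w2 = a * (Z (g s) \<bullet> \<tau> s) - zx"
    define w3 where "w3 = (1 - \<nu> x s) * (zx - m * a)"
    have b_eq: "b s = w1 + f (q x s) * (w2 + w3)"
      unfolding b_def w1_def w2_def w3_def h'_eq a_def[symmetric] by (simp add: algebra_simps)
    have "\<bar>2 * \<nu> x s * ((x - g s) \<bullet> \<xi>)\<bar> \<le> 3 * d" "\<bar>2 * F x s * a\<bar> \<le> 2 * d * 1"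
      using nu F by (intro abs_mult_le p1 a; simp)+
    then have "\<bar>2 * \<nu> x s * ((x - g s) \<bullet> \<xi>) - 2 * F x s * a\<bar> \<le> 5 * d" by linarith
    then have w1: "\<bar>w1\<bar> \<le> b1 * H * (5 * d)" unfolding w1_def by (intro abs_mult_le fb hb)
    have "w2 = Z (g s) \<bullet> (a *\<^sub>R \<tau> s - \<xi>) + (Z (g s) - Z x) \<bullet> \<xi>"
      by (simp add: w2_def zx_def inner_diff_left inner_diff_right)
    moreover have "\<bar>Z (g s) \<bullet> (a *\<^sub>R \<tau> s - \<xi>)\<bar> \<le> CZ * z"
      using order.trans[OF Cauchy_Schwarz_ineq2 mult_right_mono[OF Zb norm_ge_zero], of "g s" "a *\<^sub>R \<tau> s - \<xi>"]
      by (simp add: z_def norm_minus_commute)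
    moreover have "\<bar>(Z (g s) - Z x) \<bullet> \<xi>\<bar> \<le> LZ * d"
      using order.trans[OF Cauchy_Schwarz_ineq2[of "Z (g s) - Z x" \<xi>]] Zl[of "g s" x]
      by (simp add: xi d_def norm_minus_commute)
    ultimately have w2: "\<bar>w2\<bar> \<le> CZ * z + LZ * d" by linarith
    have "\<bar>zx - m * a\<bar> \<le> CZ + \<bar>m\<bar> * 1" by (intro abs_add_le zx abs_mult_le a) simp
    then have w3: "\<bar>w3\<bar> \<le> d * k0 * (CZ + \<bar>m\<bar>)" unfolding w3_def by (intro abs_mult_le nu1) simp
    have "\<bar>b s\<bar> \<le> b1 * H * (5 * d) + 1 * (CZ * z + LZ * d + d * k0 * (CZ + \<bar>m\<bar>))"
      unfolding b_eq by (intro abs_add_le abs_mult_le w1 w2 w3 fb)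
    also have "\<dots> \<le> C * (d + z)"
    proof -
      have "C * (d + z) = b1 * H * (5 * d) + 1 * (CZ * z + LZ * d + d * k0 * (CZ + \<bar>m\<bar>))
          + ((5 * b1 * H + LZ + k0 * (CZ + \<bar>m\<bar>)) * z + CZ * d)"
        by (simp add: C_def algebra_simps)
      moreover have "0 \<le> (5 * b1 * H + LZ + k0 * (CZ + \<bar>m\<bar>)) * z + CZ * d"
        using dz CZ LZ H small' Kc_nonneg by (intro mult_nonneg_nonneg add_nonneg_nonneg) auto
      ultimately show ?thesis by simp
    qed
    also have "\<dots> \<le> C * (2 * \<eta> + (2 * r0\<^sup>2 + 12) * (1 - f (q x s) * a) / \<eta>)"
    proof (rule mult_left_mono[OF _ C])
      \<comment> \<open>Weighted inequality of arithmetic and geometric means, turning a linear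
        error into a controllable square.\<close>
      have small_or: "u \<le> \<eta> + u\<^sup>2 / \<eta>" if "u \<ge> 0" for u
      proof -
        have "0 \<le> (u - \<eta>)\<^sup>2" by simp
        then have "2 * (u * \<eta>) \<le> \<eta> * \<eta> + u\<^sup>2" by (simp add: power2_eq_square algebra_simps)
        moreover have "0 \<le> u * \<eta>" using that \<eta> by simp
        ultimately have "u * \<eta> \<le> \<eta> * \<eta> + u\<^sup>2" by linarith
        then have "u \<le> (\<eta> * \<eta> + u\<^sup>2) / \<eta>" using \<eta> by (simp add: pos_le_divide_eq)
        also have "\<dots> = \<eta> + u\<^sup>2 / \<eta>" using \<eta> by (simp add: add_divide_distrib)
        finally show ?thesis .
      qed
      have "d\<^sup>2 + z\<^sup>2 \<le> (2 * r0\<^sup>2 + 12) * (1 - f (q x s) * a)"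
        using Q_le[OF near xi] a by (simp add: d_def z_def a_def)
      then have "d\<^sup>2 / \<eta> + z\<^sup>2 / \<eta> \<le> (2 * r0\<^sup>2 + 12) * (1 - f (q x s) * a) / \<eta>"
        using \<eta> by (simp add: add_divide_distrib[symmetric] divide_right_mono)
      then show "d + z \<le> 2 * \<eta> + (2 * r0\<^sup>2 + 12) * (1 - f (q x s) * a) / \<eta>"
        using small_or[OF dz(1)] small_or[OF dz(2)] by linarith
    qed
    also have "\<dots> = 1 / 2 * (4 * C * \<eta> + 2 * C * (2 * r0\<^sup>2 + 12) / \<eta> * (1 - f (q x s) * a))"
      by (simp add: algebra_simps)
    also have "\<dots> \<le> \<nu> x s * (4 * C * \<eta> + 2 * C * (2 * r0\<^sup>2 + 12) / \<eta> * (1 - f (q x s) * a))"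
      using abs_fa_le[OF xi, of x s] C \<eta>
      by (intro mult_right_mono nu add_nonneg_nonneg mult_nonneg_nonneg divide_nonneg_nonneg) (auto simp: a_def)
    finally show "\<bar>b s\<bar> \<le> \<nu> x s * (4 * C * \<eta> + 2 * C * (2 * r0\<^sup>2 + 12) / \<eta> * (1 - f (q x s) * (\<xi> \<bullet> \<tau> s)))"
      by (simp add: a_def)
  qed
  \<comment> \<open>Under the integral \<open>zx\<close> is averaged with total weight
    \<open>Af x\<close> instead of 1; the difference is again bounded by the defect.\<close>
  moreover have "\<bar>zx * (1 - Af x)\<bar> \<le> CZ * (1 - X x \<bullet> \<xi>)"
    using Af_bounds[OF xi, of x] by (intro abs_mult_le zx) auto
  moreover have "W h h' x \<bullet> \<xi> - Z x \<bullet> \<xi> + m * (X x \<bullet> \<xi>)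
      = integral {0..L} (\<lambda>s. \<rho> (F x s) * b s) - zx * (1 - Af x)"
    unfolding eq zx_def by (simp add: algebra_simps)
  ultimately show ?thesis by (simp add: distrib_right)
qed

end

section \<open>Smooth flows of curves\<close>

lemma abs_flat_le: "x \<le> 1 \<Longrightarrow> \<bar>flat n x\<bar> \<le> fact (n + 2)"
proof (cases "x > 0")
  case True assume "x \<le> 1"
  then have "x\<^sup>2 \<le> 1" using True by (simp add: power_le_one)
  then have "fact (n + 2) * x\<^sup>2 \<le> fact (n + 2) * (1::real)" by (intro mult_left_mono) auto
  then show ?thesis using flat_le[of n x] by linarith
qed (simp add: flat_def)

lemma smooth_flat_affine: "smooth (\<lambda>z. flat n (1 - z / c))"
proof -
  have "smooth (\<lambda>z::real. 1 - z * (1 / c))" by (intro smooth_intros)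
  from smooth_comp_real[OF smooth_flat this] show ?thesis by simp
qed

text \<open>\<open>f\<close> is \<open>exp (1 - 1 / w)\<close> with
  \<open>w = 1 - z / r0\<^sup>2\<close>, continued by 0. The bound by \<open>w\<close> is
  \<open>exp u \<ge> 1 + u\<close> at \<open>u = 1 / w - 1\<close>; it is the quadratic decay in the
  distance on which \<open>Q_le\<close> rests.\<close>

lemma profile_exists:
  fixes r0 :: real
  assumes r0: "r0 > 0"
  obtains f f1 f2 :: "real \<Rightarrow> real" and b1 b2 :: real where
    "\<And>z. (f has_real_derivative f1 z) (at z)" "\<And>z. (f1 has_real_derivative f2 z) (at z)"
    "smooth f" "smooth f1" "smooth f2" "\<And>z. f z \<ge> 0"
    "\<And>z. \<lbrakk>0 \<le> z; z \<le> r0\<^sup>2\<rbrakk> \<Longrightarrow> f z \<le> 1 - z / r0\<^sup>2" "f 0 = 1"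
    "\<And>z. z \<ge> r0\<^sup>2 \<Longrightarrow> f z = 0 \<and> f1 z = 0 \<and> f2 z = 0"
    "\<And>z. z \<ge> 0 \<Longrightarrow> \<bar>f1 z\<bar> \<le> b1" "\<And>z. z \<ge> 0 \<Longrightarrow> \<bar>f2 z\<bar> \<le> b2"
proof -
  define c where "c = r0\<^sup>2"
  have c: "c > 0" using r0 by (simp add: c_def)
  define f where "f z = exp 1 * flat 0 (1 - z / c)" for z
  define f1 where "f1 z = - (exp 1 / c) * flat 2 (1 - z / c)" for z
  define f2 where "f2 z = exp 1 / c\<^sup>2 * (flat 4 (1 - z / c) - 2 * flat 3 (1 - z / c))" for z
  have fl: "((\<lambda>z. flat n (1 - z / c)) has_real_derivative - (1 / c) * (flat (n + 2) (1 - z / c) - real n * flat (n + 1) (1 - z / c))) (at z)" for n z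
  proof -
    have "((\<lambda>z. 1 - z / c) has_real_derivative - (1 / c)) (at z)" using c by (auto intro!: derivative_eq_intros)
    from DERIV_chain2[OF flat_has_derivative this] show ?thesis by (simp add: mult.commute)
  qed
  show ?thesis
  proof (rule that)
    show "(f has_real_derivative f1 z) (at z)" for z
      unfolding f_def f1_def by (rule DERIV_cong[OF DERIV_cmult[OF fl]]) (simp add: numeral_2_eq_2)
    show "(f1 has_real_derivative f2 z) (at z)" for z
      unfolding f1_def f2_def by (rule DERIV_cong[OF DERIV_cmult[OF fl]]) (simp add: power2_eq_square)
    show "smooth f" "smooth f1" "smooth f2"
      unfolding f_def f1_def f2_def by (intro smooth_mult smooth_diff smooth_const smooth_flat_affine)+
    show "f z \<ge> 0" for z by (simp add: f_def flat_def)
    show "f 0 = 1" by (simp add: f_def flat_def exp_minus)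
    show "f z = 0 \<and> f1 z = 0 \<and> f2 z = 0" if "z \<ge> r0\<^sup>2" for z
    proof -
      have "1 - z / c \<le> 0" using that c by (simp add: c_def)
      then show ?thesis by (simp add: f_def f1_def f2_def flat_def)
    qed
    show "f z \<le> 1 - z / r0\<^sup>2" if z: "0 \<le> z" "z \<le> r0\<^sup>2" for z
    proof (cases "1 - z / c > 0")
      case True
      define w where "w = 1 - z / c"
      have "1 + (inverse w - 1) \<le> exp (inverse w - 1)" by (rule exp_ge_add_one_self)
      then have "exp (1 - inverse w) \<le> w"
        using True exp_minus[of "inverse w - 1"] le_imp_inverse_le[of "inverse w" "exp (inverse w - 1)"]
        by (simp add: w_def)
      then show ?thesis using True
        by (simp add: f_def flat_def w_def c_def exp_add[symmetric])
    next
      case False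
      then show ?thesis using z c by (simp add: f_def flat_def c_def)
    qed
    show "\<bar>f1 z\<bar> \<le> exp 1 / c * fact 4" if "z \<ge> 0" for z
    proof -
      have "\<bar>flat 2 (1 - z / c)\<bar> \<le> fact (2 + 2)" using that c by (intro abs_flat_le) simp
      then show ?thesis unfolding f1_def abs_mult using c by (intro mult_mono) (auto simp: numeral_eq_Suc)
    qed
    show "\<bar>f2 z\<bar> \<le> exp 1 / c\<^sup>2 * (fact 6 + 2 * fact 5)" if "z \<ge> 0" for z
    proof -
      have "1 - z / c \<le> 1" using that c by simp
      from abs_flat_le[OF this, of 4] abs_flat_le[OF this, of 3]
      have "\<bar>flat 4 (1 - z / c) - 2 * flat 3 (1 - z / c)\<bar> \<le> fact 6 + 2 * fact 5" by simp
      then show ?thesis unfolding f2_def abs_mult using c by (intro mult_mono) auto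
    qed
  qed
qed

text \<open>A smooth bump divided by its integral, and its primitive. The size of
  \<open>\<rho>\<close> and \<open>\<rho>1\<close> depends on \<epsilon>, but the bounds on
  \<open>R\<close>, which later estimates use, do not.\<close>

lemma bump_exists:
  fixes \<epsilon> :: real
  assumes \<epsilon>: "\<epsilon> > 0"
  obtains \<rho> \<rho>1 R :: "real \<Rightarrow> real" where
    "smooth \<rho>" "\<And>u. \<rho> u \<ge> 0" "\<And>u. (\<rho> has_real_derivative \<rho>1 u) (at u)" "continuous_on UNIV \<rho>1"
    "\<And>u. (R has_real_derivative \<rho> u) (at u)" "\<And>u. 0 \<le> R u" "\<And>u. R u \<le> 1"
    "\<And>u. u \<le> - \<epsilon> \<Longrightarrow> R u = 0" "\<And>u. u \<ge> \<epsilon> \<Longrightarrow> R u = 1" "\<And>u. \<bar>u\<bar> \<ge> \<epsilon> \<Longrightarrow> \<rho> u = 0"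
proof -
  define p where "p u = flat 0 (1 - (u / \<epsilon>)\<^sup>2)" for u
  have smooth_p: "smooth p"
  proof -
    have "smooth (\<lambda>u::real. 1 - (u * (1 / \<epsilon>)) * (u * (1 / \<epsilon>)))" by (intro smooth_intros)
    from smooth_comp_real[OF smooth_flat[of 0] this] show ?thesis by (simp add: p_def[abs_def] power2_eq_square)
  qed
  have cp: "continuous_on S p" for S by (rule smooth_imp_continuous[OF smooth_p])
  have p0: "p u \<ge> 0" for u by (simp add: p_def flat_def)
  have pout: "p u = 0" if "\<bar>u\<bar> \<ge> \<epsilon>" for u
  proof -
    have "1 \<le> \<bar>u / \<epsilon>\<bar>" using that \<epsilon> by simp
    then have "1\<^sup>2 \<le> \<bar>u / \<epsilon>\<bar>\<^sup>2" by (intro power_mono) auto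
    then have "1 \<le> (u / \<epsilon>)\<^sup>2" by (simp only: power2_abs power_one)
    then show ?thesis by (simp add: p_def flat_def)
  qed
  \<comment> \<open>Starting left of the support puts \<open>- \<epsilon>\<close> inside the domain
    of integration, so no one-sided derivative arises there.\<close>
  define P where "P u = integral {- 2 * \<epsilon>..u} p" for u
  have P_lo: "P u = 0" if "u \<le> - \<epsilon>" for u
  proof -
    have "P u = integral {- 2 * \<epsilon>..u} (\<lambda>x. 0)"
      unfolding P_def using that \<epsilon> by (intro integral_cong pout) auto
    then show ?thesis by simp
  qed
  have P_deriv: "(P has_real_derivative p u) (at u)" for u
  proof (cases "u < - \<epsilon>")
    case True
    have "((\<lambda>u. 0) has_real_derivative p u) (at u)" using pout[of u] True \<epsilon> by simp
    then show ?thesis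
      by (rule has_field_derivative_transform_within_open[where S = "{..<- \<epsilon>}"]) (use True P_lo in auto)
  next
    case False
    have "(P has_real_derivative p u) (at u within {- 2 * \<epsilon>..u + 1})"
      unfolding P_def using False \<epsilon> by (intro integral_has_real_derivative cp) auto
    moreover have "u \<in> interior {- 2 * \<epsilon>..u + 1}" using False \<epsilon> by (simp add: interior_atLeastAtMost_real)
    ultimately show ?thesis by (simp only: at_within_interior)
  qed
  have P_mono: "P u \<le> P v" if "u \<le> v" for u v
    by (rule DERIV_nonneg_imp_nondecreasing[OF that]) (use P_deriv p0 in blast)
  have P_hi: "P u = P \<epsilon>" if "u \<ge> \<epsilon>" for u
  proof -
    have "P u = P \<epsilon> + integral {\<epsilon>..u} p"
      unfolding P_def using that \<epsilon> by (intro Henstock_Kurzweil_Integration.integral_combine[symmetric] integrable_continuous_real cp) auto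
    also have "integral {\<epsilon>..u} p = integral {\<epsilon>..u} (\<lambda>x. 0)"
      using \<epsilon> by (intro integral_cong pout) auto
    finally show ?thesis by simp
  qed
  define M where "M = P \<epsilon>"
  have M: "M > 0"
  proof -
    have "M \<noteq> 0"
    proof
      assume "M = 0"
      then have "p 0 = 0"
        using integral_eq_0_iff[of "-2 * \<epsilon>" \<epsilon> p] cp p0 \<epsilon> by (auto simp: M_def P_def)
      then show False by (simp add: p_def flat_def)
    qed
    moreover have "M \<ge> 0" using P_mono[of "- \<epsilon>" \<epsilon>] P_lo[of "- \<epsilon>"] \<epsilon> by (simp add: M_def)
    ultimately show ?thesis by simp
  qed
  have sm: "smooth (\<lambda>u. p u / M)"
    using smooth_mult[OF smooth_p smooth_const[of "1 / M"]] by simp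
  then have "Ck (Suc 0) (\<lambda>u. p u / M)" by (simp add: smooth_def del: Ck.simps)
  then obtain \<rho>1 where r1: "\<And>u. ((\<lambda>u. p u / M) has_vector_derivative \<rho>1 u) (at u)" "Ck 0 \<rho>1"
    by (rule Ck_SucE_real) blast
  show ?thesis
  proof (rule that[of "\<lambda>u. p u / M" \<rho>1 "\<lambda>u. P u / M"])
    show "((\<lambda>u. P u / M) has_real_derivative p u / M) (at u)" for u
      using P_deriv by (rule DERIV_cdivide)
    show "0 \<le> P u / M" for u
      using P_mono[of "min u (- \<epsilon>)" u] P_lo[of "min u (- \<epsilon>)"] M by simp
    show "P u / M \<le> 1" for u
      using P_mono[of u "max u \<epsilon>"] P_hi[of "max u \<epsilon>"] M by (simp add: M_def)
    show "P u / M = 0" if "u \<le> - \<epsilon>" for u using P_lo[OF that] by simp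
    show "P u / M = 1" if "u \<ge> \<epsilon>" for u using P_hi[OF that] M by (simp add: M_def)
    show "p u / M = 0" if "\<bar>u\<bar> \<ge> \<epsilon>" for u using pout[OF that] by simp
    show "p u / M \<ge> 0" for u using p0 M by simp
    show "((\<lambda>u. p u / M) has_real_derivative \<rho>1 u) (at u)" for u
      using r1(1) by (simp add: has_real_derivative_iff_has_vector_derivative)
    show "continuous_on UNIV \<rho>1" using r1(2) by simp
  qed (rule sm)
qed

section \<open>Periodic curves and uniform constants along a flow\<close>

lemma periodic_int:
  fixes g :: "real \<Rightarrow> 'b"
  assumes "\<And>s. g (s + L) = g s"
  shows "g (s + of_int n * L) = g s"
proof -
  have nat: "g (s + of_nat k * L) = g s" for k s
  proof (induction k)
    case (Suc k)
    have "g (s + of_nat (Suc k) * L) = g ((s + of_nat k * L) + L)" by (simp add: algebra_simps)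
    then show ?case using assms Suc by simp
  qed simp
  show ?thesis
  proof (cases "n \<ge> 0")
    case True then show ?thesis using nat[of s "nat n"] by simp
  next
    case False
    then show ?thesis using nat[of "s + of_int n * L" "nat (- n)"] by (simp add: algebra_simps)
  qed
qed

lemma periodic_reduce:
  fixes L s :: real
  assumes "L > 0"
  obtains n :: int and u where "s = u + of_int n * L" "0 \<le> u" "u < L"
proof (rule that[of "s - of_int \<lfloor>s / L\<rfloor> * L" "\<lfloor>s / L\<rfloor>"])
  have 1: "of_int \<lfloor>s / L\<rfloor> \<le> s / L" and 2: "s / L < of_int \<lfloor>s / L\<rfloor> + 1" by linarith+
  from pos_le_divide_eq[THEN iffD1, OF assms 1] pos_divide_less_eq[THEN iffD1, OF assms 2]
  show "0 \<le> s - of_int \<lfloor>s / L\<rfloor> * L" "s - of_int \<lfloor>s / L\<rfloor> * L < L" by (simp_all add: algebra_simps)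
qed simp

lemma inj_periodic:
  fixes g :: "real \<Rightarrow> 'b"
  assumes L: "L > 0" and per: "\<And>s. g (s + L) = g s" and inj: "inj_on g {0..<L}" and s: "s < s'" "s' < s + L"
  shows "g s \<noteq> g s'"
proof
  assume eq: "g s = g s'"
  obtain n u where u: "s = u + of_int n * L" "0 \<le> u" "u < L" using periodic_reduce[OF L] .
  obtain n' u' where u': "s' = u' + of_int n' * L" "0 \<le> u'" "u' < L" using periodic_reduce[OF L] .
  have "g u = g u'" using eq periodic_int[of g L, OF per] by (simp add: u u')
  then have "u = u'" using inj u u' by (auto simp: inj_on_def)
  then have d: "s' - s = of_int (n' - n) * L" by (simp add: u u' algebra_simps)
  have "0 < of_int (n' - n) * L" "of_int (n' - n) * L < 1 * L" using s d by linarith+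
  then have "(0::real) < of_int (n' - n)" "of_int (n' - n) < (1::real)"
    using L by (simp_all add: zero_less_mult_iff mult_less_cancel_right)
  then have "0 < n' - n" "n' - n < 1" by linarith+
  then show False by simp
qed

text \<open>\<open>K k t\<close> stands for the \<open>k\<close>-th arc length derivative of the curve at time \<open>t\<close>.\<close>
locale smooth_flow =
  fixes I :: "real set" and L :: real and K :: "nat \<Rightarrow> real \<Rightarrow> real \<Rightarrow> real^3"
  assumes I: "is_interval I" and L: "L > 0"
    and K_s: "\<And>k t s. t \<in> I \<Longrightarrow> (K k t has_vector_derivative K (Suc k) t s) (at s)"
    and K_cont: "\<And>k. continuous_on (I \<times> UNIV) (\<lambda>(t, s). K k t s)"
    and per: "\<And>t s. t \<in> I \<Longrightarrow> K 0 t (s + L) = K 0 t s"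
    and unit: "\<And>t s. t \<in> I \<Longrightarrow> norm (K 1 t s) = 1"
    and flow: "\<And>t s. t \<in> I \<Longrightarrow> ((\<lambda>r. K 0 r s) has_vector_derivative cross3 (K 1 t s) (K 2 t s)) (at t within I)"
    and inj: "\<And>t. t \<in> I \<Longrightarrow> inj_on (K 0 t) {0..<L}"
begin

lemma K_cont': "t \<in> I \<Longrightarrow> continuous_on S (K k t)"
  using continuous_on_curry(1)[OF K_cont] continuous_on_subset by blast

lemma K_comp [continuous_intros]:
  assumes "continuous_on S u" "continuous_on S v" "\<And>p. p \<in> S \<Longrightarrow> u p \<in> I"
  shows "continuous_on S (\<lambda>p. K k (u p) (v p))"
proof -
  have "continuous_on S (\<lambda>p. (\<lambda>(t, s). K k t s) (u p, v p))"
    by (rule continuous_on_compose2[OF K_cont]) (use assms in \<open>auto intro: continuous_on_Pair\<close>)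
  then show ?thesis by simp
qed

lemma K_smooth: "t \<in> I \<Longrightarrow> smooth (K k t)"
proof -
  assume t: "t \<in> I"
  have "Ck n (K k t)" for n k
  proof (induction n arbitrary: k)
    case 0 show ?case using K_cont'[OF t] by simp
  next
    case (Suc n) show ?case by (rule Ck_SucI_real[OF K_s[OF t] Suc])
  qed
  then show ?thesis by (simp add: smooth_def)
qed

lemma K_per: "t \<in> I \<Longrightarrow> K k t (s + L) = K k t s"
proof (induction k arbitrary: s)
  case (Suc k)
  show ?case by (rule has_vector_derivative_periodic[OF K_s[OF Suc.prems] Suc.IH[OF Suc.prems]])
qed (rule per)

text \<open>The flow equation differentiated along the curve, where
  \<open>cross3 (K 2 t s) (K 2 t s)\<close> is zero. The exchange of derivatives is needed because
  the locale postulates a time derivative for \<open>K 0\<close> only.\<close>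

lemma K1_t: "t \<in> I \<Longrightarrow> ((\<lambda>r. K 1 r s) has_vector_derivative cross3 (K 1 t s) (K 3 t s)) (at t within I)"
proof (rule has_vector_derivative_swap[OF I, where u = "K 0" and us = "K 1" and w = "\<lambda>t s. cross3 (K 1 t s) (K 2 t s)"
      and ws = "\<lambda>t s. cross3 (K 1 t s) (K 3 t s)"])
  show "(K 0 t has_vector_derivative K 1 t s) (at s)" if "t \<in> I" for t s
    using K_s[OF that, of 0] by simp
  show "((\<lambda>s. cross3 (K 1 t s) (K 2 t s)) has_vector_derivative cross3 (K 1 t s) (K 3 t s)) (at s)" if "t \<in> I" for t s
    using has_vector_derivative_cross3[OF K_s[OF that, of 1 s] K_s[OF that, of 2 s]]
    by (simp add: cross_refl numeral_eq_Suc)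
  show "continuous_on (I \<times> UNIV) (\<lambda>(t, s). cross3 (K 1 t s) (K 3 t s))"
    unfolding case_prod_unfold by (intro continuous_intros continuous_on_cross3) auto
qed (use flow in auto)

definition "K2t t s = cross3 (K 1 t s) (K 4 t s) + cross3 (K 2 t s) (K 3 t s)"

lemma K2_t: "t \<in> I \<Longrightarrow> ((\<lambda>r. K 2 r s) has_vector_derivative K2t t s) (at t within I)"
  unfolding K2t_def
proof (rule has_vector_derivative_swap[OF I, where u = "K 1" and us = "K 2" and w = "\<lambda>t s. cross3 (K 1 t s) (K 3 t s)"
      and ws = "\<lambda>t s. cross3 (K 1 t s) (K 4 t s) + cross3 (K 2 t s) (K 3 t s)"])
  show "(K 1 t has_vector_derivative K 2 t s) (at s)" if "t \<in> I" for t s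
    using K_s[OF that, of 1] by (simp add: numeral_eq_Suc)
  show "((\<lambda>s. cross3 (K 1 t s) (K 3 t s)) has_vector_derivative cross3 (K 1 t s) (K 4 t s) + cross3 (K 2 t s) (K 3 t s)) (at s)"
    if "t \<in> I" for t s
    using has_vector_derivative_cross3[OF K_s[OF that, of 1 s] K_s[OF that, of 3 s]]
    by (simp add: numeral_eq_Suc)
  show "continuous_on (I \<times> UNIV) (\<lambda>(t, s). cross3 (K 1 t s) (K 4 t s) + cross3 (K 2 t s) (K 3 t s))"
    unfolding case_prod_unfold by (intro continuous_intros continuous_on_cross3) auto
qed (use K1_t in auto)

lemma bounded_K:
  assumes J: "compact J" "J \<subseteq> I"
  obtains B where "\<And>t s. t \<in> J \<Longrightarrow> norm (K k t s) \<le> B" "B \<ge> 0"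
proof -
  have "compact ((\<lambda>p. K k (fst p) (snd p)) ` (J \<times> {0..L}))"
  proof (rule compact_continuous_image)
    show "continuous_on (J \<times> {0..L}) (\<lambda>p. K k (fst p) (snd p))"
      by (rule K_comp) (use J in \<open>auto intro: continuous_intros\<close>)
    show "compact (J \<times> {0..L})" using J by (intro compact_Times) auto
  qed
  then have "bounded ((\<lambda>p. K k (fst p) (snd p)) ` (J \<times> {0..L}))" by (rule compact_imp_bounded)
  then obtain B where "\<forall>x\<in>(\<lambda>p. K k (fst p) (snd p)) ` (J \<times> {0..L}). norm x \<le> B"
    unfolding bounded_iff ..
  moreover have "K k t s \<in> (\<lambda>p. K k (fst p) (snd p)) ` (J \<times> {0..L})" if "t \<in> J" "s \<in> {0..L}" for t s
    by (rule image_eqI[of _ _ "(t, s)"]) (use that in auto)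
  ultimately have B: "norm (K k t s) \<le> B" if "t \<in> J" "s \<in> {0..L}" for t s
    using that by blast
  have "norm (K k t s) \<le> max B 0" if t: "t \<in> J" for t s
  proof -
    obtain n u where u: "s = u + of_int n * L" "0 \<le> u" "u < L" using periodic_reduce[OF L] .
    have "K k t s = K k t u" unfolding u(1) by (rule periodic_int) (use K_per t J in auto)
    then show ?thesis using B[OF t, of u] u by auto
  qed
  then show ?thesis using that[of "max B 0"] by simp
qed

text \<open>By injectivity the distance of \<open>K 0 t s\<close> and \<open>K 0 t (s + v)\<close>
  is positive on the compact set of \<open>t\<close> in \<open>J\<close>, \<open>s\<close> in one
  period and \<open>v\<close> in \<open>{\<delta>..L - \<delta>}\<close>; its minimum serves as
  \<open>m\<close>.\<close>

lemma separation:
  assumes J: "compact J" "J \<subseteq> I" and \<delta>: "\<delta> > 0" "\<delta> \<le> L / 2"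
  obtains m where "m > 0" "\<And>t s s'. \<lbrakk>t \<in> J; \<bar>s - s'\<bar> \<le> L / 2; norm (K 0 t s - K 0 t s') < m\<rbrakk> \<Longrightarrow> \<bar>s - s'\<bar> \<le> \<delta>"
proof (cases "J = {}")
  case True
  show ?thesis by (rule that[of 1]) (use True in auto)
next
  case False
  define S where "S = J \<times> {0..L} \<times> {\<delta>..L - \<delta>}"
  define d where "d p = norm (K 0 (fst p) (fst (snd p)) - K 0 (fst p) (fst (snd p) + snd (snd p)))" for p
  have S: "compact S" "S \<noteq> {}" using J False \<delta> L unfolding S_def by (auto intro!: compact_Times)
  have "continuous_on S d" unfolding d_def S_def using J by (intro continuous_intros) auto
  then obtain p0 where p0: "p0 \<in> S" "\<And>p. p \<in> S \<Longrightarrow> d p0 \<le> d p"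
    using continuous_attains_inf[OF S] by blast
  have "d p0 > 0"
  proof -
    have "K 0 (fst p0) (fst (snd p0)) \<noteq> K 0 (fst p0) (fst (snd p0) + snd (snd p0))"
      using p0(1) J \<delta> by (intro inj_periodic[OF L per inj]) (auto simp: S_def)
    then show ?thesis by (simp add: d_def)
  qed
  then show ?thesis
  proof (rule that)
    have main: "v \<le> \<delta>" if t: "t \<in> J" and n: "norm (K 0 t s - K 0 t (s + v)) < d p0" and v: "0 \<le> v" "v \<le> L / 2" for t s v
    proof (rule ccontr)
      assume "\<not> v \<le> \<delta>"
      obtain n u where u: "s = u + of_int n * L" "0 \<le> u" "u < L" using periodic_reduce[OF L] .
      have "K 0 t s = K 0 t u" unfolding u(1) by (rule periodic_int) (use K_per t J in auto)
      moreover have "K 0 t (s + v) = K 0 t (u + v)"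
        using periodic_int[of "K 0 t" L "u + v" n] K_per t J by (simp add: u(1) algebra_simps subset_iff)
      moreover have "d p0 \<le> d (t, u, v)"
        using t u v \<delta> \<open>\<not> v \<le> \<delta>\<close> L by (intro p0(2)) (auto simp: S_def)
      ultimately show False using n by (simp add: d_def)
    qed
    fix t s s' assume *: "t \<in> J" "\<bar>s - s'\<bar> \<le> L / 2" "norm (K 0 t s - K 0 t s') < d p0"
    show "\<bar>s - s'\<bar> \<le> \<delta>"
      using main[of t s "s' - s"] main[of t s' "s - s'"] * by (cases "s \<le> s'") (auto simp: norm_minus_commute)
  qed
qed

text \<open>The order of quantifiers matters: \<open>\<delta>\<close>, \<open>r0\<close>, the bounds
  and the profile are chosen once for all times in \<open>J\<close> and all \<epsilon>, and only the
  bump depends on \<epsilon>. Hence the Gronwall constant survives the limit.\<close>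

lemma calib_exists:
  assumes J: "compact J" "J \<subseteq> I"
  obtains \<delta> r0 k0 k1 b1 b2 f f1 f2 where "\<delta> > 0"
    "\<And>\<epsilon>. \<epsilon> > 0 \<Longrightarrow> \<exists>\<rho> \<rho>1 R. \<forall>t\<in>J. calib (K 0 t) (K 1 t) (K 2 t) (K 3 t) L \<delta> r0 k0 k1 b1 b2 \<epsilon> f f1 f2 \<rho> \<rho>1 R"
proof -
  obtain k0 where k0: "\<And>t s. t \<in> J \<Longrightarrow> norm (K 2 t s) \<le> k0" "k0 \<ge> 0" by (rule bounded_K[OF J, of 2]) blast
  obtain k1 where k1: "\<And>t s. t \<in> J \<Longrightarrow> norm (K 3 t s) \<le> k1" "k1 \<ge> 0" by (rule bounded_K[OF J, of 3]) blast
  \<comment> \<open>The cap \<open>1 / (4 * (k0 + 1))\<close>, used for \<open>r0\<close> as well,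
    yields \<open>(r0 + \<delta>) * k0 \<le> 1 / 2\<close> and makes sense also for
    \<open>k0 = 0\<close>.\<close>
  define \<delta> where "\<delta> = min (L / 2) (1 / (4 * (k0 + 1)))"
  have \<delta>: "\<delta> > 0" "\<delta> \<le> L / 2" using L k0 by (auto simp: \<delta>_def)
  obtain m where m: "m > 0" "\<And>t s s'. \<lbrakk>t \<in> J; \<bar>s - s'\<bar> \<le> L / 2; norm (K 0 t s - K 0 t s') < m\<rbrakk> \<Longrightarrow> \<bar>s - s'\<bar> \<le> \<delta>"
    by (rule separation[OF J \<delta>]) blast
  \<comment> \<open>\<open>m / 3\<close> rather than \<open>m / 2\<close>, since \<open>sep\<close>
    admits distance equal to \<open>2 * r0\<close> while the choice of \<open>m\<close> needs a
    strict inequality.\<close>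
  define r0 where "r0 = min (m / 3) (1 / (4 * (k0 + 1)))"
  have r0: "r0 > 0" using m k0 by (auto simp: r0_def)
  have "(r0 + \<delta>) * k0 \<le> (1 / (4 * (k0 + 1)) + 1 / (4 * (k0 + 1))) * k0"
    using k0 by (intro mult_right_mono add_mono) (auto simp: r0_def \<delta>_def)
  also have "\<dots> \<le> 1 / 2" using k0 by (simp add: field_simps)
  finally have small: "(r0 + \<delta>) * k0 \<le> 1 / 2" .
  obtain f f1 f2 b1 b2 where f: "\<And>z. (f has_real_derivative f1 z) (at z)" "\<And>z. (f1 has_real_derivative f2 z) (at z)"
    "smooth f" "smooth f1" "smooth f2" "\<And>z. f z \<ge> 0"
    "\<And>z. \<lbrakk>0 \<le> z; z \<le> r0\<^sup>2\<rbrakk> \<Longrightarrow> f z \<le> 1 - z / r0\<^sup>2" "f 0 = 1"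
    "\<And>z. z \<ge> r0\<^sup>2 \<Longrightarrow> f z = 0 \<and> f1 z = 0 \<and> f2 z = 0"
    "\<And>z. z \<ge> 0 \<Longrightarrow> \<bar>f1 z\<bar> \<le> b1" "\<And>z. z \<ge> 0 \<Longrightarrow> \<bar>f2 z\<bar> \<le> b2"
    by (rule profile_exists[OF r0], rule that)
  show ?thesis
  proof (rule that[OF \<delta>(1)])
    fix \<epsilon> :: real assume \<epsilon>: "\<epsilon> > 0"
    obtain \<rho> \<rho>1 R where \<rho>: "smooth \<rho>" "\<And>u. \<rho> u \<ge> 0" "\<And>u. (\<rho> has_real_derivative \<rho>1 u) (at u)" "continuous_on UNIV \<rho>1"
      "\<And>u. (R has_real_derivative \<rho> u) (at u)" "\<And>u. 0 \<le> R u" "\<And>u. R u \<le> 1"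
      "\<And>u. u \<le> - \<epsilon> \<Longrightarrow> R u = 0" "\<And>u. u \<ge> \<epsilon> \<Longrightarrow> R u = 1" "\<And>u. \<bar>u\<bar> \<ge> \<epsilon> \<Longrightarrow> \<rho> u = 0"
      by (rule bump_exists[OF \<epsilon>], rule that)
    have "calib (K 0 t) (K 1 t) (K 2 t) (K 3 t) L \<delta> r0 k0 k1 b1 b2 \<epsilon> f f1 f2 \<rho> \<rho>1 R" if t: "t \<in> J" for t
    proof -
      have tI: "t \<in> I" using t J by auto
      have "\<bar>s - s'\<bar> \<le> \<delta>" if "\<bar>s - s'\<bar> \<le> L / 2" "norm (K 0 t s - K 0 t s') \<le> 2 * r0" for s s'
      proof -
        have "r0 \<le> m / 3" by (simp add: r0_def)
        then show ?thesis using m(1) that by (intro m(2)[OF t]) auto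
      qed
      then show ?thesis
        using L K_s[OF tI, of 0] K_s[OF tI, of 1] K_s[OF tI, of 2] K_smooth[OF tI] per[OF tI] unit[OF tI]
          k0(1)[OF t] k1(1)[OF t] r0 \<delta> small f \<rho> \<epsilon>
        by (intro calib.intro) (simp_all add: numeral_eq_Suc)
    qed
    then show "\<exists>\<rho> \<rho>1 R. \<forall>t\<in>J. calib (K 0 t) (K 1 t) (K 2 t) (K 3 t) L \<delta> r0 k0 k1 b1 b2 \<epsilon> f f1 f2 \<rho> \<rho>1 R" by blast
  qed
qed

end

section \<open>Time dependence of the calibrating field\<close>

context calib begin

text \<open>The integrand on the right is that of \<open>X\<close> differentiated in time under the
  flow, weight included; it differs from the integrand of \<open>Y\<close> by the
  \<open>s\<close>-derivative of the periodic function \<open>P\<close>. As in space, this keeps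
  derivatives of \<open>\<rho>\<close> out of \<open>Y\<close>.\<close>

lemma Y_eq_integral:
  assumes k4: "\<And>s. (\<kappa>s has_vector_derivative \<kappa>4 s) (at s)" and cont: "continuous_on UNIV \<kappa>4"
  shows "Y x = integral {0..L} (\<lambda>s. (\<rho>1 (F x s) * Ft x s * \<nu> x s
      - \<rho> (F x s) * ((x - g s) \<bullet> (cross3 (\<tau> s) (\<kappa>4 s) + cross3 (\<kappa> s) (\<kappa>s s)))) *\<^sub>R G1 x s
      + (\<rho> (F x s) * \<nu> x s) *\<^sub>R Gt x s)"
proof -
  note [continuous_intros] = cont[THEN continuous_on_compose2, OF _ subset_UNIV]
  let ?b = "\<lambda>s. (\<rho>1 (F x s) * Ft x s * \<nu> x s
      - \<rho> (F x s) * ((x - g s) \<bullet> (cross3 (\<tau> s) (\<kappa>4 s) + cross3 (\<kappa> s) (\<kappa>s s)))) *\<^sub>R G1 x s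
      + (\<rho> (F x s) * \<nu> x s) *\<^sub>R Gt x s"
  let ?a = "\<lambda>s. \<rho> (F x s) *\<^sub>R (\<nu> x s *\<^sub>R Gt x s + Ft x s *\<^sub>R G1s x s)"
  define P where "P s = (\<rho> (F x s) * Ft x s) *\<^sub>R G1 x s" for s
  have Ft_s: "(Ft x has_vector_derivative (x - g s) \<bullet> (cross3 (\<tau> s) (\<kappa>4 s) + cross3 (\<kappa> s) (\<kappa>s s))) (at s)" for s
    unfolding Ft_def
    by (rule has_vector_derivative_eq_rhs[OF has_vector_derivative_inner[OF y_s has_vector_derivative_cross3[OF tau_deriv k4]]])
      (simp add: dot_cross_self)
  have "(P has_vector_derivative ?a s - ?b s) (at s)" for s
    unfolding P_def
    by (rule has_vector_derivative_eq_rhs[OF has_vector_derivative_scaleR'[OF has_vector_derivative_times[OF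
        has_vector_derivative_compose_real[OF rho_deriv F_s] Ft_s] G1_s]])
      (simp add: algebra_simps)
  then have "((\<lambda>s. ?a s - ?b s) has_integral (P L - P 0)) {0..L}"
    using L by (intro fundamental_theorem_of_calculus) (auto intro: has_vector_derivative_at_within)
  moreover have "P L = P 0" by (simp add: P_def Ft_def G1_def Fnuq_L at_L)
  ultimately have "integral {0..L} (\<lambda>s. ?a s - ?b s) = 0" by (simp add: integral_unique)
  moreover have "integral {0..L} (\<lambda>s. ?a s - ?b s) = integral {0..L} ?a - integral {0..L} ?b"
    unfolding Gt_def Ft_def G1s_def G1_def
    by (rule integral_diff) (intro integrable_continuous_real continuous_intros)+
  ultimately show ?thesis unfolding Y_def by simp
qed

end

text \<open>One profile and one bump serve for all times in \<open>J\<close>, so the field varies in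
  time only through the curve.\<close>

locale calib_flow = smooth_flow +
  fixes J :: "real set" and \<delta> r0 k0 k1 b1 b2 \<epsilon> :: real and f f1 f2 \<rho> \<rho>1 R :: "real \<Rightarrow> real"
  assumes J: "compact J" "J \<subseteq> I" "is_interval J"
    and cal: "\<And>t. t \<in> J \<Longrightarrow> calib (K 0 t) (K 1 t) (K 2 t) (K 3 t) L \<delta> r0 k0 k1 b1 b2 \<epsilon> f f1 f2 \<rho> \<rho>1 R"
begin

definition Xt where "Xt t = calib.X (K 0 t) (K 1 t) (K 2 t) L f \<rho>"
definition Yt where "Yt t = calib.Y (K 0 t) (K 1 t) (K 2 t) (K 3 t) L f f1 \<rho>"

text \<open>The quantities of \<open>calib\<close> with time as a variable, which is frozen in that
  locale. \<open>w\<close> is the integrand of \<open>X\<close> and \<open>wt\<close> its time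
  derivative.\<close>

definition y where "y t x s = x - K 0 t s"
definition FF where "FF t x s = y t x s \<bullet> K 1 t s"
definition nn where "nn t x s = 1 - y t x s \<bullet> K 2 t s"
definition qq where "qq t x s = y t x s \<bullet> y t x s"
definition FFt where "FFt t x s = y t x s \<bullet> cross3 (K 1 t s) (K 3 t s)"
definition w where "w t x s = (\<rho> (FF t x s) * nn t x s) *\<^sub>R (f (qq t x s) *\<^sub>R K 1 t s)"
definition wt where "wt t x s = (\<rho>1 (FF t x s) * FFt t x s * nn t x s
      - \<rho> (FF t x s) * (y t x s \<bullet> (cross3 (K 1 t s) (K 4 t s) + cross3 (K 2 t s) (K 3 t s)))) *\<^sub>R (f (qq t x s) *\<^sub>R K 1 t s)
      + (\<rho> (FF t x s) * nn t x s) *\<^sub>R ((- 2 * f1 (qq t x s) * (y t x s \<bullet> cross3 (K 1 t s) (K 2 t s))) *\<^sub>R K 1 t s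
          + f (qq t x s) *\<^sub>R cross3 (K 1 t s) (K 3 t s))"

lemma Xt_eq: "t \<in> J \<Longrightarrow> Xt t x = integral {0..L} (\<lambda>s. w t x s)"
  unfolding Xt_def calib.X_def[OF cal] calib.A_def[OF cal] calib.G1_def[OF cal] calib.F_def[OF cal] calib.\<nu>_def[OF cal]
    calib.q_def[OF cal] w_def FF_def nn_def qq_def y_def ..

lemma Yt_eq:
  assumes t: "t \<in> J"
  shows "Yt t x = integral {0..L} (\<lambda>s. wt t x s)"
proof -
  have tI: "t \<in> I" using t J by auto
  have "(K 3 t has_vector_derivative K 4 t s) (at s)" for s
    using K_s[OF tI, of 3] by (simp add: numeral_eq_Suc)
  from calib.Y_eq_integral[OF cal[OF t] this K_cont'[OF tI]] show ?thesis
    unfolding Yt_def calib.G1_def[OF cal[OF t]] calib.Gt_def[OF cal[OF t]] calib.Ft_def[OF cal[OF t]] calib.F_def[OF cal[OF t]]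
      calib.\<nu>_def[OF cal[OF t]] calib.q_def[OF cal[OF t]] wt_def FF_def FFt_def nn_def qq_def y_def .
qed

lemma w_t:
  assumes t: "t \<in> J"
  shows "((\<lambda>r. w r x s) has_vector_derivative wt t x s) (at t within J)"
proof -
  have tI: "t \<in> I" using t J by auto
  interpret c: calib "K 0 t" "K 1 t" "K 2 t" "K 3 t" L \<delta> r0 k0 k1 b1 b2 \<epsilon> f f1 f2 \<rho> \<rho>1 R by (rule cal[OF t])
  note sub = has_vector_derivative_within_subset[OF _ J(2)]
  have K0: "((\<lambda>r. K 0 r s) has_vector_derivative cross3 (K 1 t s) (K 2 t s)) (at t within J)" by (rule sub[OF flow[OF tI]])
  have K1: "((\<lambda>r. K 1 r s) has_vector_derivative cross3 (K 1 t s) (K 3 t s)) (at t within J)" by (rule sub[OF K1_t[OF tI]])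
  have K2: "((\<lambda>r. K 2 r s) has_vector_derivative K2t t s) (at t within J)" by (rule sub[OF K2_t[OF tI]])
  have yt: "((\<lambda>r. y r x s) has_vector_derivative - cross3 (K 1 t s) (K 2 t s)) (at t within J)"
    unfolding y_def by (rule has_vector_derivative_eq_rhs[OF has_vector_derivative_diff[OF has_vector_derivative_const K0]]) simp
  have Ft: "((\<lambda>r. FF r x s) has_vector_derivative FFt t x s) (at t within J)"
    unfolding FF_def FFt_def
    by (rule has_vector_derivative_eq_rhs[OF has_vector_derivative_inner[OF yt K1]]) (simp add: dot_cross_self)
  have nt: "((\<lambda>r. nn r x s) has_vector_derivative - (y t x s \<bullet> K2t t s)) (at t within J)"
    unfolding nn_def
    by (rule has_vector_derivative_eq_rhs[OF has_vector_derivative_diff[OF has_vector_derivative_const has_vector_derivative_inner[OF yt K2]]])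
      (simp add: dot_cross_self)
  have qt: "((\<lambda>r. qq r x s) has_vector_derivative - 2 * (y t x s \<bullet> cross3 (K 1 t s) (K 2 t s))) (at t within J)"
    unfolding qq_def
    by (rule has_vector_derivative_eq_rhs[OF has_vector_derivative_inner[OF yt yt]]) (simp add: inner_commute)
  show ?thesis
    unfolding w_def wt_def K2t_def[symmetric]
    by (rule has_vector_derivative_eq_rhs[OF has_vector_derivative_scaleR'[OF
        has_vector_derivative_times[OF has_vector_derivative_compose_real[OF c.rho_deriv Ft] nt]
        has_vector_derivative_scaleR'[OF has_vector_derivative_compose_real[OF c.f_deriv qt] K1]]])
      (simp add: algebra_simps)
qed

lemma wt_cont: "continuous_on (J \<times> UNIV \<times> UNIV) (\<lambda>p. wt (fst p) (fst (snd p)) (snd (snd p)))"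
proof (cases "J = {}")
  case False
  then obtain t0 where "t0 \<in> J" by auto
  then interpret c: calib "K 0 t0" "K 1 t0" "K 2 t0" "K 3 t0" L \<delta> r0 k0 k1 b1 b2 \<epsilon> f f1 f2 \<rho> \<rho>1 R by (rule cal)
  show ?thesis
    unfolding wt_def FF_def FFt_def nn_def qq_def y_def using J(2) by (intro continuous_intros) auto
qed simp

lemma w_cont: "t \<in> J \<Longrightarrow> continuous_on S (w t x)"
proof -
  assume t: "t \<in> J"
  then interpret c: calib "K 0 t" "K 1 t" "K 2 t" "K 3 t" L \<delta> r0 k0 k1 b1 b2 \<epsilon> f f1 f2 \<rho> \<rho>1 R by (rule cal)
  show ?thesis
    unfolding w_def FF_def nn_def qq_def y_def using t J(2) by (intro continuous_intros) auto
qed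

lemma common_support:
  obtains B where "\<And>t x. t \<in> J \<Longrightarrow> norm x > B \<Longrightarrow> Xt t x = 0 \<and> Yt t x = 0"
proof -
  obtain B where B: "\<And>t s. t \<in> J \<Longrightarrow> norm (K 0 t s) \<le> B" "B \<ge> 0" by (rule bounded_K[OF J(1,2), of 0]) blast
  have "Xt t x = 0 \<and> Yt t x = 0" if t: "t \<in> J" and x: "norm x > B + r0" for t x
  proof -
    interpret c: calib "K 0 t" "K 1 t" "K 2 t" "K 3 t" L \<delta> r0 k0 k1 b1 b2 \<epsilon> f f1 f2 \<rho> \<rho>1 R by (rule cal[OF t])
    have "norm (x - K 0 t s) > r0" for s
      using B(1)[OF t, of s] x norm_triangle_ineq2[of x "K 0 t s"] by linarith
    then have "x \<notin> c.tubular" by (auto simp: c.tubular_def not_le)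
    then show ?thesis using c.X_off c.Y_off by (simp add: Xt_def Yt_def)
  qed
  then show ?thesis by (rule that)
qed

text \<open>Uniformity in \<open>x\<close> is essential, because the remainder is later integrated
  against a varifold of which only the mass is controlled. It comes from uniform continuity of
  \<open>wt\<close> on a compact set; outside a common ball all fields vanish.\<close>

lemma Xt_derivative_uniform:
  assumes a: "a \<in> J" and \<eta>: "\<eta> > 0"
  obtains d where "d > 0" "\<And>t x. t \<in> J \<Longrightarrow> \<bar>t - a\<bar> < d \<Longrightarrow> norm (Xt t x - Xt a x - (t - a) *\<^sub>R Yt a x) \<le> \<eta> * \<bar>t - a\<bar>"
proof -
  obtain B where B: "\<And>t x. t \<in> J \<Longrightarrow> norm x > B \<Longrightarrow> Xt t x = 0 \<and> Yt t x = 0" by (rule common_support) blast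
  define C where "C = J \<times> cball (0::real^3) B \<times> {0..L}"
  have "compact C" unfolding C_def using J by (intro compact_Times) auto
  moreover have "continuous_on C (\<lambda>p. wt (fst p) (fst (snd p)) (snd (snd p)))"
    by (rule continuous_on_subset[OF wt_cont]) (auto simp: C_def)
  ultimately have "uniformly_continuous_on C (\<lambda>p. wt (fst p) (fst (snd p)) (snd (snd p)))"
    by (intro compact_uniformly_continuous)
  moreover have "\<eta> / L > 0" using \<eta> L by simp
  ultimately obtain d where d: "d > 0" "\<And>p p'. p \<in> C \<Longrightarrow> p' \<in> C \<Longrightarrow> dist p' p < d \<Longrightarrow>
      dist (wt (fst p') (fst (snd p')) (snd (snd p'))) (wt (fst p) (fst (snd p)) (snd (snd p))) < \<eta> / L"
    unfolding uniformly_continuous_on_def by metis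
  show ?thesis
  proof (rule that[OF d(1)])
    fix t x assume t: "t \<in> J" "\<bar>t - a\<bar> < d"
    show "norm (Xt t x - Xt a x - (t - a) *\<^sub>R Yt a x) \<le> \<eta> * \<bar>t - a\<bar>"
    proof (cases "norm x > B")
      case True
      then show ?thesis using B t a \<eta> by simp
    next
      case False
      define S where "S = closed_segment a t"
      have SJ: "S \<subseteq> J" unfolding S_def using J(3) a t
        by (intro closed_segment_subset) (auto simp: is_interval_convex)
      have Sd: "\<bar>r - a\<bar> < d" if "r \<in> S" for r
        using that t unfolding S_def closed_segment_eq_real_ivl by (auto split: if_splits)
      have "norm (w t x s - w a x s - (t - a) *\<^sub>R wt a x s) \<le> \<eta> / L * \<bar>t - a\<bar>" if s: "s \<in> {0..L}" for s
      proof -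
        \<comment> \<open>Mean value inequality in \<open>r\<close> for the integrand minus its
          linear part at \<open>a\<close>; the derivative \<open>wt r x s - wt a x s\<close> is
          small by uniform continuity.\<close>
        have "norm ((w t x s - (t - a) *\<^sub>R wt a x s) - (w a x s - (a - a) *\<^sub>R wt a x s)) \<le> \<eta> / L * \<bar>t - a\<bar>"
        proof (rule norm_diff_le_within[of S "\<lambda>r. w r x s - (r - a) *\<^sub>R wt a x s" "\<lambda>r. wt r x s - wt a x s"])
          fix r assume r: "r \<in> S"
          have "((\<lambda>r. w r x s) has_vector_derivative wt r x s) (at r within S)"
            using has_vector_derivative_within_subset[OF w_t SJ] r SJ by auto
          then show "((\<lambda>r. w r x s - (r - a) *\<^sub>R wt a x s) has_vector_derivative wt r x s - wt a x s) (at r within S)"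
            by (auto intro!: derivative_eq_intros)
          have "dist (wt r x s) (wt a x s) < \<eta> / L"
            using d(2)[of "(a, x, s)" "(r, x, s)"] r SJ a s False Sd[OF r] by (auto simp: C_def dist_Pair_Pair dist_real_def)
          then show "norm (wt r x s - wt a x s) \<le> \<eta> / L" by (simp add: dist_norm)
        qed (auto simp: S_def)
        then show ?thesis by (simp add: algebra_simps)
      qed
      note le = this
      have ca: "continuous_on {0..L} (wt a x)"
        by (rule continuous_on_compose2[OF wt_cont, of _ "\<lambda>s. (a, x, s)", simplified]) (use a in \<open>auto intro!: continuous_intros\<close>)
      have "Xt t x - Xt a x - (t - a) *\<^sub>R Yt a x = integral {0..L} (\<lambda>s. w t x s - w a x s - (t - a) *\<^sub>R wt a x s)"
        unfolding Xt_eq[OF t(1)] Xt_eq[OF a] Yt_eq[OF a] using t a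
        by (simp add: integral_diff integrable_continuous_real continuous_intros w_cont ca)
      also have "norm \<dots> \<le> \<eta> / L * \<bar>t - a\<bar> * (L - 0)"
        using L t a le by (intro integral_bound) (auto intro!: continuous_intros w_cont ca)
      also have "\<dots> = \<eta> * \<bar>t - a\<bar>" using L by simp
      finally show ?thesis .
    qed
  qed
qed

end

section \<open>Test fields and varifolds\<close>

lemma smooth_pd: "smooth X \<Longrightarrow> smooth (pd X l)"
  unfolding pd_def[abs_def] by (rule smooth_has_derivative(2))

lemma smooth_nth: "smooth X \<Longrightarrow> smooth (\<lambda>x. X x $ k)"
  by (rule smooth_bounded_linear_comp[OF bounded_linear_vec_nth])

lemma vector_3_eq_sum: "(vector [a, b, c] :: real^3) = a *\<^sub>R axis 1 1 + b *\<^sub>R axis 2 1 + c *\<^sub>R axis 3 1"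
  by (simp add: vec_eq_iff forall_3 vector_3 axis_def)

lemma smooth_curl: "smooth X \<Longrightarrow> smooth (curl X)"
  unfolding curl_def[abs_def] vector_3_eq_sum
  by (intro smooth_add smooth_scaleR smooth_diff smooth_const smooth_nth smooth_pd)

lemma has_derivative_pd:
  assumes "smooth X"
  shows "(X has_derivative (\<lambda>v. \<Sum>l\<in>UNIV. v $ l *\<^sub>R pd X l x)) (at x)"
proof -
  note d = smooth_has_derivative(1)[OF assms, of x]
  have lin: "linear (frechet_derivative X (at x))" using d by (rule has_derivative_linear)
  have "frechet_derivative X (at x) v = (\<Sum>l\<in>UNIV. v $ l *\<^sub>R pd X l x)" for v
  proof -
    have "frechet_derivative X (at x) v = frechet_derivative X (at x) (\<Sum>l\<in>UNIV. v $ l *\<^sub>R axis l 1)"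
      by (simp add: basis_expansion scalar_mult_eq_scaleR[symmetric])
    then show ?thesis by (simp add: linear_sum[OF lin] linear_scale[OF lin] pd_def)
  qed
  then show ?thesis using d by (simp add: has_derivative_eq_rhs ext)
qed

lemma test_field_smooth: "test_field X \<Longrightarrow> smooth X"
  by (simp add: test_field_def smooth_on_UNIV_iff)

lemma test_field_vanish:
  assumes "test_field X"
  obtains B where "\<And>x. norm x > B \<Longrightarrow> X x = 0"
proof -
  obtain B where "\<forall>x\<in>{x. X x \<noteq> 0}. norm x \<le> B"
    using assms unfolding test_field_def bounded_iff by blast
  then show ?thesis by (intro that[of B]) force
qed

lemma test_fieldI: "smooth X \<Longrightarrow> (\<And>x. norm x > B \<Longrightarrow> X x = 0) \<Longrightarrow> test_field X"
  unfolding test_field_def smooth_on_UNIV_iff bounded_iff by (auto simp: not_less[symmetric] intro!: exI[of _ B])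

lemma test_field_pd:
  assumes "test_field X"
  shows "test_field (pd X l)"
proof -
  obtain B where B: "\<And>x. norm x > B \<Longrightarrow> X x = 0" by (rule test_field_vanish[OF assms]) blast
  have "pd X l x = 0" if "norm x > B" for x
  proof -
    have "open {x::real^3. B < norm x}" by (intro open_Collect_less continuous_intros)
    then have "(X has_derivative (\<lambda>v. 0)) (at x)"
      using that B by (intro has_derivative_transform_within_open[OF has_derivative_const[of 0], of "{x. B < norm x}"]) auto
    then show ?thesis unfolding pd_def by (simp add: frechet_derivative_at[symmetric])
  qed
  then show ?thesis using smooth_pd[OF test_field_smooth[OF assms]] by (intro test_fieldI)
qed

lemma test_field_curl:
  assumes "test_field X"
  shows "test_field (curl X)"
proof -
  obtain B1 where B1: "\<And>x. norm x > B1 \<Longrightarrow> pd X 1 x = 0" by (rule test_field_vanish[OF test_field_pd[OF assms]]) blast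
  obtain B2 where B2: "\<And>x. norm x > B2 \<Longrightarrow> pd X 2 x = 0" by (rule test_field_vanish[OF test_field_pd[OF assms]]) blast
  obtain B3 where B3: "\<And>x. norm x > B3 \<Longrightarrow> pd X 3 x = 0" by (rule test_field_vanish[OF test_field_pd[OF assms]]) blast
  show ?thesis
    by (rule test_fieldI[OF smooth_curl[OF test_field_smooth[OF assms]], of "max B1 (max B2 B3)"])
      (simp add: curl_def B1 B2 B3 vector_3_eq_sum)
qed

lemma test_field_bounded:
  assumes "test_field X"
  obtains B where "\<And>x. norm (X x) \<le> B" "B \<ge> 0"
proof -
  obtain r where r: "\<And>x. norm x > r \<Longrightarrow> X x = 0" by (rule test_field_vanish[OF assms]) blast
  have "compact (X ` cball 0 r)"
    by (intro compact_continuous_image smooth_imp_continuous test_field_smooth assms) auto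
  then have "bounded (X ` cball 0 r)" by (rule compact_imp_bounded)
  then obtain B where B: "\<forall>x\<in>X ` cball 0 r. norm x \<le> B" unfolding bounded_iff ..
  have "norm (X x) \<le> max B 0" for x
    using B r[of x] by (cases "norm x \<le> r") (auto simp: le_max_iff_disj)
  then show ?thesis by (rule that) simp
qed

lemma test_field_lipschitz:
  assumes "test_field X"
  obtains C where "\<And>x y. norm (X x - X y) \<le> C * norm (x - y)"
proof -
  have "\<exists>B. \<forall>x. norm (pd X l x) \<le> B" for l using test_field_bounded[OF test_field_pd[OF assms]] by metis
  then obtain B where B: "\<And>l x. norm (pd X l x) \<le> B l" by metis
  have "norm (X x - X y) \<le> (\<Sum>l\<in>UNIV. B l) * norm (x - y)" for x y
  proof (rule differentiable_bound[of UNIV X "\<lambda>x v. \<Sum>l\<in>UNIV. v $ l *\<^sub>R pd X l x"])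
    show "(X has_derivative (\<lambda>v. \<Sum>l\<in>UNIV. v $ l *\<^sub>R pd X l x)) (at x within UNIV)" for x
      using has_derivative_pd[OF test_field_smooth[OF assms]] by simp
    show "onorm (\<lambda>v. \<Sum>l\<in>UNIV. v $ l *\<^sub>R pd X l x) \<le> (\<Sum>l\<in>UNIV. B l)" for x
    proof (rule onorm_bound)
      show "0 \<le> (\<Sum>l\<in>UNIV. B l)" by (intro sum_nonneg order.trans[OF norm_ge_zero B])
      show "norm (\<Sum>l\<in>UNIV. v $ l *\<^sub>R pd X l x) \<le> (\<Sum>l\<in>UNIV. B l) * norm v" for v :: "real^3"
        unfolding sum_distrib_right
      proof (rule sum_norm_le)
        fix l :: 3
        have "\<bar>v $ l\<bar> * norm (pd X l x) \<le> norm v * B l"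
          by (intro mult_mono B component_le_norm_cart) auto
        then show "norm (v $ l *\<^sub>R pd X l x) \<le> B l * norm v" by (simp add: mult.commute)
      qed
    qed
  qed auto
  then show ?thesis by (rule that)
qed

lemma Dcurl_xi_bounded:
  assumes "test_field X"
  obtains B where "\<And>x \<xi>. norm \<xi> = 1 \<Longrightarrow> \<bar>Dcurl_xi X x \<xi>\<bar> \<le> B" "B \<ge> 0"
proof -
  have "\<exists>B. \<forall>x. norm (pd (curl X) l x) \<le> B" for l
    using test_field_bounded[OF test_field_pd[OF test_field_curl[OF assms]]] by metis
  then obtain B where B: "\<And>l x. norm (pd (curl X) l x) \<le> B l" by metis
  have "\<bar>Dcurl_xi X x \<xi>\<bar> \<le> (\<Sum>k\<in>(UNIV::3 set). \<Sum>l\<in>UNIV. B l)" if xi: "norm \<xi> = 1" for x \<xi>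
    unfolding Dcurl_xi_def
  proof (intro order.trans[OF sum_abs] sum_mono)
    fix k l :: 3
    have c: "\<bar>\<xi> $ j\<bar> \<le> 1" for j using component_le_norm_cart[of \<xi> j] xi by simp
    have "\<bar>pd (curl X) l x $ k\<bar> \<le> B l" using component_le_norm_cart[of "pd (curl X) l x" k] B[of l x] by linarith
    then have "\<bar>pd (curl X) l x $ k * \<xi> $ k * \<xi> $ l\<bar> \<le> B l * 1 * 1" by (intro abs_mult_le c)
    then show "\<bar>pd (curl X) l x $ k * \<xi> $ k * \<xi> $ l\<bar> \<le> B l" by simp
  qed
  moreover have "0 \<le> (\<Sum>k\<in>(UNIV::3 set). \<Sum>l\<in>UNIV. B l)"
    by (intro sum_nonneg order.trans[OF norm_ge_zero B])
  ultimately show ?thesis by (rule that)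
qed

lemma Dcurl_xi_continuous:
  assumes "smooth X"
  shows "continuous_on UNIV (\<lambda>p. Dcurl_xi X (fst p) (snd p))"
proof -
  have "continuous_on UNIV (\<lambda>p::(real^3)\<times>(real^3). pd (curl X) l (fst p))" for l
    by (rule continuous_on_compose2[OF smooth_imp_continuous[of _ UNIV]])
      (auto intro!: smooth_pd smooth_curl assms continuous_intros)
  then show ?thesis unfolding Dcurl_xi_def by (intro continuous_intros)
qed

text \<open>The induction runs over all fields at once because the derivative of \<open>X\<close>
  along the curve involves the fields \<open>pd X l\<close>.\<close>

lemma smooth_compose_curve:
  fixes c :: "real \<Rightarrow> real^3" and X :: "real^3 \<Rightarrow> real^3"
  assumes c: "\<And>s. (c has_vector_derivative c' s) (at s)" and c': "smooth c'" and X: "smooth X"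
  shows "smooth (\<lambda>s. X (c s))"
  unfolding smooth_def
proof
  fix n show "Ck n (\<lambda>s. X (c s))" using X
  proof (induction n arbitrary: X)
    case 0
    have "continuous_on UNIV c" by (rule smooth_imp_continuous[OF smooth_of_vector_derivative[OF c c']])
    then show ?case using continuous_on_compose2[OF smooth_imp_continuous[OF 0, of UNIV]] by auto
  next
    case (Suc n)
    show ?case
    proof (rule Ck_SucI_real)
      show "((\<lambda>s. X (c s)) has_vector_derivative (\<Sum>l\<in>UNIV. c' s $ l *\<^sub>R pd X l (c s))) (at s)" for s
        unfolding has_vector_derivative_def
        by (rule has_derivative_eq_rhs[OF has_derivative_compose[OF c[unfolded has_vector_derivative_def] has_derivative_pd[OF Suc.prems]]])
          (simp add: scaleR_sum_right)
      have "Ck n (\<lambda>s. c' s $ l)" for l using smooth_nth[OF c'] by (simp add: smooth_def)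
      then show "Ck n (\<lambda>s. \<Sum>l\<in>UNIV. c' s $ l *\<^sub>R pd X l (c s))"
        unfolding sum_3 by (intro Ck_add Ck_scaleR Suc.IH smooth_pd Suc.prems)
    qed
  qed
qed

text \<open>The oriented integral from 0 serves on both sides of 0 at once.\<close>

lemma antiderivative_exists:
  fixes p :: "real \<Rightarrow> real"
  assumes "continuous_on UNIV p"
  obtains P where "\<And>x::real. (P has_real_derivative p x) (at x)"
proof (rule that)
  fix x :: real
  define a b where "a = min x 0 - 1" and "b = max x 0 + 1"
  have "((\<lambda>u. LBINT y=ereal 0..ereal u. p y) has_vector_derivative p x) (at x within {a..b})"
    by (rule interval_integral_FTC2) (auto simp: a_def b_def intro: continuous_on_subset[OF assms])
  moreover have "at x within {a..b} = at x"
    by (rule at_within_interior) (auto simp: a_def b_def interior_atLeastAtMost_real)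
  ultimately show "((\<lambda>u. LBINT y=ereal 0..ereal u. p y) has_real_derivative p x) (at x)"
    by (simp add: has_real_derivative_iff_has_vector_derivative)
qed

lemma varifold_integrable:
  fixes \<phi> :: "(real^3) \<times> (real^3) \<Rightarrow> real"
  assumes V: "oriented_varifold V" and cont: "continuous_on UNIV \<phi>"
    and bound: "\<And>x \<xi>. norm \<xi> = 1 \<Longrightarrow> \<bar>\<phi> (x, \<xi>)\<bar> \<le> B"
  shows "integrable V \<phi>" and "\<bar>\<integral>p. \<phi> p \<partial>V\<bar> \<le> B * vmass V"
proof -
  interpret finite_measure V using V by (simp add: oriented_varifold_def)
  have sp: "space V = varifold_space" "sets V = sets (restrict_space borel varifold_space)"
    using V by (auto simp: oriented_varifold_def varifold_sets_def)
  have b: "\<bar>\<phi> p\<bar> \<le> B" if "p \<in> space V" for p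
    using that bound[of "snd p" "fst p"] by (auto simp: sp varifold_space_def)
  have "\<phi> \<in> borel_measurable (restrict_space borel varifold_space)"
    by (rule measurable_restrict_space1) (rule borel_measurable_continuous_onI[OF cont])
  then have m: "\<phi> \<in> borel_measurable V" using measurable_cong_sets[OF sp(2) refl] by blast
  show i: "integrable V \<phi>"
    by (rule integrable_const_bound[of _ B]) (use b m in auto)
  have "\<bar>\<integral>p. \<phi> p \<partial>V\<bar> \<le> (\<integral>p. \<bar>\<phi> p\<bar> \<partial>V)" by (rule integral_abs_bound)
  also have "\<dots> \<le> (\<integral>p. B \<partial>V)"
    using i b by (intro integral_mono) auto
  also have "\<dots> = B * vmass V" by (simp add: vmass_def mult.commute)
  finally show "\<bar>\<integral>p. \<phi> p \<partial>V\<bar> \<le> B * vmass V" .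
qed

lemma first_moment_integrable:
  assumes V: "oriented_varifold V" and X: "test_field X"
  shows "integrable V (\<lambda>p. X (fst p) \<bullet> snd p)"
proof -
  obtain B where B: "\<And>x. norm (X x) \<le> B" "B \<ge> 0" by (rule test_field_bounded[OF X]) blast
  have c: "continuous_on UNIV (\<lambda>p::(real^3)\<times>(real^3). X (fst p))"
    by (rule continuous_on_compose2[OF smooth_imp_continuous[OF test_field_smooth[OF X], of UNIV]]) (auto intro!: continuous_intros)
  show ?thesis
  proof (rule varifold_integrable(1)[OF V])
    show "continuous_on UNIV (\<lambda>p. X (fst p) \<bullet> snd p)" by (intro continuous_intros c)
    show "\<bar>X (fst (x, \<xi>)) \<bullet> snd (x, \<xi>)\<bar> \<le> B" if "norm \<xi> = 1" for x \<xi>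
      using Cauchy_Schwarz_ineq2[of "X x" \<xi>] B(1)[of x] that by simp
  qed
qed

lemma first_moment_bound:
  assumes V: "oriented_varifold V" and cont: "continuous_on UNIV X" and b: "\<And>x. norm (X x) \<le> B"
  shows "\<bar>first_moment V X\<bar> \<le> B * vmass V"
  unfolding first_moment_def
proof (rule varifold_integrable(2)[OF V])
  have c: "continuous_on UNIV (\<lambda>p::(real^3)\<times>(real^3). X (fst p))"
    by (rule continuous_on_compose2[OF cont]) (auto intro!: continuous_intros)
  show "continuous_on UNIV (\<lambda>p. X (fst p) \<bullet> snd p)" by (intro continuous_intros c)
  show "\<bar>X (fst (x, \<xi>)) \<bullet> snd (x, \<xi>)\<bar> \<le> B" if "norm \<xi> = 1" for x \<xi>
    using Cauchy_Schwarz_ineq2[of "X x" \<xi>] b[of x] that by simp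
qed

lemma Dcurl_integrable:
  assumes V: "oriented_varifold V" and X: "test_field X"
  shows "integrable V (\<lambda>p. Dcurl_xi X (fst p) (snd p))"
proof -
  obtain B where "\<And>x \<xi>. norm \<xi> = 1 \<Longrightarrow> \<bar>Dcurl_xi X x \<xi>\<bar> \<le> B" by (rule Dcurl_xi_bounded[OF X]) blast
  then show ?thesis
    by (intro varifold_integrable(1)[OF V Dcurl_xi_continuous[OF test_field_smooth[OF X]]]) auto
qed

lemma AE_lebesgue_on_negligible:
  assumes "I \<in> sets lebesgue" and "AE t in lebesgue_on I. P t"
  obtains N where "negligible N" "\<And>t. t \<in> I - N \<Longrightarrow> P t"
proof -
  have "AE t in lebesgue. t \<in> I \<longrightarrow> P t"
    using assms by (subst (asm) AE_restrict_space_iff) auto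
  then obtain N where N: "N \<in> null_sets lebesgue" "{t \<in> space lebesgue. \<not> (t \<in> I \<longrightarrow> P t)} \<subseteq> N"
    unfolding eventually_ae_filter by blast
  show ?thesis
    by (rule that[of N]) (use N in \<open>auto simp: negligible_iff_null_sets\<close>)
qed

lemma interval_sets_lebesgue: "is_interval (I::real set) \<Longrightarrow> I \<in> sets borel" "is_interval (I::real set) \<Longrightarrow> I \<in> sets lebesgue"
  using real_interval_borel_measurable by (auto intro: sets_completionI_sets)

text \<open>The affine time dependence \<open>A + (t - c) B\<close> of the test field suffices to differentiate along a
  time dependent field, and avoids exceptional null sets that vary with the field.\<close>
lemma BCF_increment_bound:
  assumes V: "generalized_BCF I V" and I: "is_interval I" and mass: "\<And>t. t \<in> I \<Longrightarrow> vmass (V t) \<le> L"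
    and A: "test_field A" and B: "test_field B" and ab: "a \<in> I" "b \<in> I" "a \<le> b"
    and bound: "\<And>t. t \<in> {a..b} \<Longrightarrow> \<bar>first_moment (V t) B - (\<integral>p. Dcurl_xi A (fst p) (snd p) \<partial>V t)
        - (t - c) * (\<integral>p. Dcurl_xi B (fst p) (snd p) \<partial>V t)\<bar> \<le> M"
  defines "h \<equiv> \<lambda>t. first_moment (V t) A + (t - c) * first_moment (V t) B"
  shows "\<bar>h b - h a\<bar> \<le> M * (b - a)"
proof -
  have sub: "{a..b} \<subseteq> I" by (rule is_interval_Icc_subset[OF I ab(1,2)])
  obtain CA where CA: "CA-lipschitz_on I (\<lambda>t. first_moment (V t) A)" using V A unfolding generalized_BCF_def by blast
  obtain CB where CB: "CB-lipschitz_on I (\<lambda>t. first_moment (V t) B)" using V B unfolding generalized_BCF_def by blast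
  obtain NB where NB: "\<And>x. norm (B x) \<le> NB" "NB \<ge> 0" by (rule test_field_bounded[OF B]) blast
  have ov: "oriented_varifold (V t)" if "t \<in> I" for t using V that by (simp add: generalized_BCF_def)
  have L0: "0 \<le> vmass (V t)" for t by (simp add: vmass_def)
  have fb: "\<bar>first_moment (V t) B\<bar> \<le> NB * L" if "t \<in> I" for t
  proof -
    have "\<bar>first_moment (V t) B\<bar> \<le> NB * vmass (V t)"
      by (rule first_moment_bound[OF ov[OF that] smooth_imp_continuous[OF test_field_smooth[OF B]] NB(1)])
    also have "\<dots> \<le> NB * L" using NB mass that by (intro mult_left_mono) auto
    finally show ?thesis .
  qed
  \<comment> \<open>Bounds \<open>t - c\<close> on \<open>{a..b}\<close>, for the Lipschitz constant
    of the product in \<open>h\<close>.\<close>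
  define D where "D = \<bar>a\<bar> + \<bar>b\<bar> + \<bar>c\<bar>"
  define C where "C = CA + (NB * L + D * CB)"
  have L: "L \<ge> 0" using order.trans[OF L0 mass[OF ab(1)]] .
  have lip: "C-lipschitz_on {a..b} h"
  proof (rule lipschitz_onI)
    show "0 \<le> C" using lipschitz_on_nonneg[OF CA] lipschitz_on_nonneg[OF CB] NB L by (simp add: C_def D_def)
    fix x y assume xy: "x \<in> {a..b}" "y \<in> {a..b}"
    then have xyI: "x \<in> I" "y \<in> I" using sub by auto
    have "h x - h y = (first_moment (V x) A - first_moment (V y) A)
      + ((x - y) * first_moment (V x) B + (y - c) * (first_moment (V x) B - first_moment (V y) B))"
      by (simp add: h_def algebra_simps)
    also have "\<bar>\<dots>\<bar> \<le> CA * \<bar>x - y\<bar> + (\<bar>x - y\<bar> * (NB * L) + D * (CB * \<bar>x - y\<bar>))"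
    proof (intro abs_add_le abs_mult_le fb xyI)
      show "\<bar>first_moment (V x) A - first_moment (V y) A\<bar> \<le> CA * \<bar>x - y\<bar>"
        "\<bar>first_moment (V x) B - first_moment (V y) B\<bar> \<le> CB * \<bar>x - y\<bar>"
        using lipschitz_onD[OF CA xyI] lipschitz_onD[OF CB xyI] by (simp_all add: dist_real_def)
      show "\<bar>y - c\<bar> \<le> D" using xy by (auto simp: D_def)
    qed simp
    also have "\<dots> = C * \<bar>x - y\<bar>" by (simp add: C_def algebra_simps)
    finally show "dist (h x) (h y) \<le> C * dist x y" by (simp add: dist_real_def)
  qed
  note Is = interval_sets_lebesgue(2)[OF I]
  have aeA: "AE t in lebesgue_on I. ((\<lambda>\<tau>. first_moment (V \<tau>) A) has_real_derivative
              - (\<integral>p. Dcurl_xi A (fst p) (snd p) \<partial>(V t))) (at t within I)"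
    and aeB: "AE t in lebesgue_on I. ((\<lambda>\<tau>. first_moment (V \<tau>) B) has_real_derivative
              - (\<integral>p. Dcurl_xi B (fst p) (snd p) \<partial>(V t))) (at t within I)"
    using V A B unfolding generalized_BCF_def by blast+
  obtain N1 where N1: "negligible N1" "\<And>t. t \<in> I - N1 \<Longrightarrow> ((\<lambda>\<tau>. first_moment (V \<tau>) A) has_real_derivative
              - (\<integral>p. Dcurl_xi A (fst p) (snd p) \<partial>(V t))) (at t within I)"
    by (rule AE_lebesgue_on_negligible[OF Is aeA]) blast
  obtain N2 where N2: "negligible N2" "\<And>t. t \<in> I - N2 \<Longrightarrow> ((\<lambda>\<tau>. first_moment (V \<tau>) B) has_real_derivative
              - (\<integral>p. Dcurl_xi B (fst p) (snd p) \<partial>(V t))) (at t within I)"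
    by (rule AE_lebesgue_on_negligible[OF Is aeB]) blast
  have N: "negligible (N1 \<union> N2)" using N1 N2 by (simp add: negligible_Un)
  define h' where "h' t = first_moment (V t) B - (\<integral>p. Dcurl_xi A (fst p) (snd p) \<partial>V t)
        - (t - c) * (\<integral>p. Dcurl_xi B (fst p) (snd p) \<partial>V t)" for t
  have der: "(h has_real_derivative h' t) (at t within {a..b})" if t: "t \<in> {a..b} - (N1 \<union> N2)" for t
  proof -
    have d: "((\<lambda>\<tau>. first_moment (V \<tau>) A) has_real_derivative - (\<integral>p. Dcurl_xi A (fst p) (snd p) \<partial>(V t))) (at t within {a..b})"
      "((\<lambda>\<tau>. first_moment (V \<tau>) B) has_real_derivative - (\<integral>p. Dcurl_xi B (fst p) (snd p) \<partial>(V t))) (at t within {a..b})"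
      using DERIV_subset[OF N1(2) sub, of t] DERIV_subset[OF N2(2) sub, of t] t sub by auto
    have l: "((\<lambda>t. t - c) has_real_derivative 1) (at t within {a..b})"
      by (auto intro!: derivative_eq_intros)
    show ?thesis unfolding h_def h'_def
      by (rule DERIV_cong[OF DERIV_add[OF d(1) DERIV_mult[OF l d(2)]]]) (simp add: algebra_simps)
  qed
  have "h b - h a \<le> M * (b - a)"
  proof (rule lipschitz_ae_derivative_increment_le[OF ab(3) lip N])
    fix t assume t: "t \<in> {a..b} - (N1 \<union> N2)"
    then show "\<exists>D. (h has_real_derivative D) (at t within {a..b}) \<and> D \<le> M"
      using der[OF t] bound[of t] by (auto simp: h'_def)
  qed
  moreover have "(- h b) - (- h a) \<le> M * (b - a)"
  proof (rule lipschitz_ae_derivative_increment_le[OF ab(3) _ N])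
    show "C-lipschitz_on {a..b} (\<lambda>t. - h t)" using lipschitz_on_minus[OF lip] by simp
    fix t assume t: "t \<in> {a..b} - (N1 \<union> N2)"
    then have "((\<lambda>t. - h t) has_real_derivative - h' t) (at t within {a..b})" "- h' t \<le> M"
      using DERIV_minus[OF der[OF t]] bound[of t] by (auto simp: h'_def)
    then show "\<exists>D. ((\<lambda>t. - h t) has_real_derivative D) (at t within {a..b}) \<and> D \<le> M" by blast
  qed
  ultimately show ?thesis by (simp add: abs_le_iff)
qed

section \<open>Weak-strong uniqueness\<close>

lemma first_moment_affine:
  assumes V: "oriented_varifold V" and X: "test_field X" and Y: "test_field Y" and Z: "test_field Z"
  shows "first_moment V (\<lambda>x. X x - Y x - c *\<^sub>R Z x) = first_moment V X - first_moment V Y - c * first_moment V Z"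
  using first_moment_integrable[OF V X] first_moment_integrable[OF V Y] first_moment_integrable[OF V Z]
  by (simp add: first_moment_def inner_diff_left)

section \<open>The calibration gap along a weak flow\<close>

context calib_flow begin

text \<open>\<open>calib.Kcal\<close> written out, to make visible that it is the same for all times
  in \<open>J\<close>.\<close>

definition KK where "KK = 2 * Kc k0 k1 b1 b2 * (2 * r0\<^sup>2 + 12)"

lemma calib_facts:
  assumes t: "t \<in> J"
  shows "test_field (Xt t)" "test_field (Yt t)" "norm (Xt t x) \<le> 1" "KK \<ge> 0"
    "norm \<xi> = 1 \<Longrightarrow> \<bar>Dcurl_xi (Xt t) x \<xi> - Yt t x \<bullet> \<xi>\<bar> \<le> KK * (1 - Xt t x \<bullet> \<xi>)"
    "\<epsilon> \<le> \<delta> / 2 \<Longrightarrow> Xt t (K 0 t s) \<bullet> K 1 t s \<ge> 1 - (4 * b1 * \<epsilon>\<^sup>2 + 2 * k0 * \<epsilon>)"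
proof -
  interpret c: calib "K 0 t" "K 1 t" "K 2 t" "K 3 t" L \<delta> r0 k0 k1 b1 b2 \<epsilon> f f1 f2 \<rho> \<rho>1 R by (rule cal[OF t])
  have KK: "KK = c.Kcal" by (simp add: KK_def c.Kcal_def)
  show "test_field (Xt t)" "test_field (Yt t)" "norm (Xt t x) \<le> 1" "KK \<ge> 0"
    "norm \<xi> = 1 \<Longrightarrow> \<bar>Dcurl_xi (Xt t) x \<xi> - Yt t x \<bullet> \<xi>\<bar> \<le> KK * (1 - Xt t x \<bullet> \<xi>)"
    "\<epsilon> \<le> \<delta> / 2 \<Longrightarrow> Xt t (K 0 t s) \<bullet> K 1 t s \<ge> 1 - (4 * b1 * \<epsilon>\<^sup>2 + 2 * k0 * \<epsilon>)"
    unfolding KK Xt_def Yt_def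
    by (rule c.test_field_X c.test_field_Y c.norm_X_le_1 c.Kcal_nonneg c.evolution_bound c.X_on_curve; assumption)+
qed

text \<open>Near time \<open>a\<close>, \<open>Xt t\<close> is replaced by its Taylor polynomial
  \<open>Xt a + (t - a) Yt a\<close>, whose moment is \<open>h t\<close>. The rate of
  \<open>h\<close> is bounded by \<open>KK\<close> times the total defect, which
  \<open>vmass \<le> L\<close> turns into the gap. Half of \<eta> pays for the variation over the
  time step, half for the Taylor remainder.\<close>

lemma gap_step:
  assumes V: "generalized_BCF I V" and mass: "\<And>t. t \<in> I \<Longrightarrow> vmass (V t) \<le> L"
    and a: "a \<in> J" and \<eta>: "\<eta> > 0"
  defines "G \<equiv> \<lambda>t. L - first_moment (V t) (Xt t)"
  shows "\<exists>d>0. \<forall>t\<in>J. \<bar>t - a\<bar> < d \<longrightarrow> \<bar>G t - G a\<bar> \<le> (KK * G a + \<eta>) * \<bar>t - a\<bar>"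
proof -
  have aI: "a \<in> I" using a J by auto
  note c = calib_facts[OF a]
  have ov: "oriented_varifold (V t)" if "t \<in> I" for t using V that by (simp add: generalized_BCF_def)
  obtain C where C: "C-lipschitz_on I (\<lambda>t. first_moment (V t) (Xt a))" using V c(1) unfolding generalized_BCF_def by blast
  obtain BD where BD: "\<And>x \<xi>. norm \<xi> = 1 \<Longrightarrow> \<bar>Dcurl_xi (Yt a) x \<xi>\<bar> \<le> BD" "BD \<ge> 0"
    by (rule Dcurl_xi_bounded[OF c(2)]) blast
  \<comment> \<open>\<open>KK * C\<close> accounts for the change of the moment of
    \<open>Xt a\<close> between \<open>a\<close> and \<open>r\<close>, and \<open>BD * L\<close> for
    the curl of the linear part \<open>Yt a\<close>.\<close>
  define Q where "Q = KK * C + BD * L"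
  have Q: "Q \<ge> 0" using c(4) lipschitz_on_nonneg[OF C] BD L by (simp add: Q_def)
  have "\<eta> / (2 * L) > 0" using \<eta> L by simp
  then obtain d0 where d0: "d0 > 0" "\<And>t x. t \<in> J \<Longrightarrow> \<bar>t - a\<bar> < d0 \<Longrightarrow>
      norm (Xt t x - Xt a x - (t - a) *\<^sub>R Yt a x) \<le> \<eta> / (2 * L) * \<bar>t - a\<bar>"
    by (rule Xt_derivative_uniform[OF a]) blast
  define d where "d = min d0 (\<eta> / (2 * (Q + 1)))"
  have d: "d > 0" using d0 \<eta> Q by (simp add: d_def)
  define h where "h t = first_moment (V t) (Xt a) + (t - a) * first_moment (V t) (Yt a)" for t
  define M where "M = KK * G a + \<eta> / 2"
  have rate: "\<bar>first_moment (V r) (Yt a) - (\<integral>p. Dcurl_xi (Xt a) (fst p) (snd p) \<partial>V r)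
        - (r - a) * (\<integral>p. Dcurl_xi (Yt a) (fst p) (snd p) \<partial>V r)\<bar> \<le> M" if r: "r \<in> I" "\<bar>r - a\<bar> < d" for r
  proof -
    note ovr = ov[OF r(1)]
    have sp: "norm (snd p) = 1" if "p \<in> space (V r)" for p
      using that ovr by (auto simp: oriented_varifold_def varifold_space_def)
    interpret fm: finite_measure "V r" using ovr by (simp add: oriented_varifold_def)
    note iX = first_moment_integrable[OF ovr c(1)] and iY = first_moment_integrable[OF ovr c(2)]
      and iD = Dcurl_integrable[OF ovr c(1)]
    have "\<bar>first_moment (V r) (Yt a) - (\<integral>p. Dcurl_xi (Xt a) (fst p) (snd p) \<partial>V r)\<bar>
        = \<bar>\<integral>p. Yt a (fst p) \<bullet> snd p - Dcurl_xi (Xt a) (fst p) (snd p) \<partial>V r\<bar>"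
      unfolding first_moment_def using iY iD by simp
    also have "\<dots> \<le> (\<integral>p. \<bar>Yt a (fst p) \<bullet> snd p - Dcurl_xi (Xt a) (fst p) (snd p)\<bar> \<partial>V r)"
      by (rule integral_abs_bound)
    also have "\<dots> \<le> (\<integral>p. KK * (1 - Xt a (fst p) \<bullet> snd p) \<partial>V r)"
      using iX iY iD c(5)[OF sp] by (intro integral_mono) (auto simp: abs_minus_commute)
    also have "\<dots> = KK * (vmass (V r) - first_moment (V r) (Xt a))"
      using iX by (simp add: first_moment_def vmass_def)
    also have "\<dots> \<le> KK * (G a + C * \<bar>r - a\<bar>)"
    proof (rule mult_left_mono[OF _ c(4)])
      show "vmass (V r) - first_moment (V r) (Xt a) \<le> G a + C * \<bar>r - a\<bar>"
        using mass[OF r(1)] lipschitz_onD[OF C r(1) aI] by (simp add: G_def dist_real_def)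
    qed
    finally have 1: "\<bar>first_moment (V r) (Yt a) - (\<integral>p. Dcurl_xi (Xt a) (fst p) (snd p) \<partial>V r)\<bar> \<le> KK * (G a + C * \<bar>r - a\<bar>)" .
    have "\<bar>\<integral>p. Dcurl_xi (Yt a) (fst p) (snd p) \<partial>V r\<bar> \<le> BD * vmass (V r)"
      by (rule varifold_integrable(2)[OF ovr Dcurl_xi_continuous[OF test_field_smooth[OF c(2)]]]) (simp add: BD)
    also have "\<dots> \<le> BD * L" using BD mass[OF r(1)] by (intro mult_left_mono) auto
    finally have 2: "\<bar>(r - a) * (\<integral>p. Dcurl_xi (Yt a) (fst p) (snd p) \<partial>V r)\<bar> \<le> \<bar>r - a\<bar> * (BD * L)"
      by (intro abs_mult_le) simp_all
    have "Q * \<bar>r - a\<bar> \<le> (Q + 1) * (\<eta> / (2 * (Q + 1)))" using r Q by (intro mult_mono) (auto simp: d_def)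
    also have "\<dots> = \<eta> / 2" using Q by (simp add: field_simps)
    finally have 3: "Q * \<bar>r - a\<bar> \<le> \<eta> / 2" .
    have "KK * (G a + C * \<bar>r - a\<bar>) + \<bar>r - a\<bar> * (BD * L) = KK * G a + Q * \<bar>r - a\<bar>"
      by (simp add: Q_def algebra_simps)
    then show ?thesis using abs_add_le(2)[OF 1 2] 3 by (simp add: M_def)
  qed
  show ?thesis
  proof (intro exI[of _ d] conjI ballI impI)
    fix t assume t: "t \<in> J" "\<bar>t - a\<bar> < d"
    then have tI: "t \<in> I" using J by auto
    have "\<bar>h t - h a\<bar> \<le> M * \<bar>t - a\<bar>"
    proof (cases "a \<le> t")
      case True
      have "\<bar>h t - h a\<bar> \<le> M * (t - a)"
        unfolding h_def
        by (rule BCF_increment_bound[OF V I mass c(1,2) aI tI True rate])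
          (use is_interval_Icc_subset[OF I aI tI] t in auto)
      then show ?thesis using True by simp
    next
      case False
      then have le: "t \<le> a" by simp
      have "\<bar>h a - h t\<bar> \<le> M * (a - t)"
        unfolding h_def
        by (rule BCF_increment_bound[OF V I mass c(1,2) tI aI le rate])
          (use is_interval_Icc_subset[OF I tI aI] t in auto)
      then show ?thesis using False by (simp add: abs_minus_commute)
    qed
    moreover have "\<bar>first_moment (V t) (Xt t) - h t\<bar> \<le> \<eta> / 2 * \<bar>t - a\<bar>"
    proof -
      have eq: "first_moment (V t) (Xt t) - h t = first_moment (V t) (\<lambda>x. Xt t x - Xt a x - (t - a) *\<^sub>R Yt a x)"
        unfolding first_moment_affine[OF ov[OF tI] calib_facts(1)[OF t(1)] c(1,2)] h_def by simp
      have "\<bar>first_moment (V t) (\<lambda>x. Xt t x - Xt a x - (t - a) *\<^sub>R Yt a x)\<bar> \<le> \<eta> / (2 * L) * \<bar>t - a\<bar> * vmass (V t)"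
      proof (rule first_moment_bound[OF ov[OF tI]])
        show "continuous_on UNIV (\<lambda>x. Xt t x - Xt a x - (t - a) *\<^sub>R Yt a x)"
          by (intro continuous_intros smooth_imp_continuous test_field_smooth calib_facts(1,2) a t(1))
        show "norm (Xt t x - Xt a x - (t - a) *\<^sub>R Yt a x) \<le> \<eta> / (2 * L) * \<bar>t - a\<bar>" for x
          using t by (intro d0(2)) (auto simp: d_def)
      qed
      also have "\<dots> \<le> \<eta> / (2 * L) * \<bar>t - a\<bar> * L"
        using mass[OF tI] \<eta> L by (intro mult_left_mono) auto
      also have "\<dots> = \<eta> / 2 * \<bar>t - a\<bar>" using L by simp
      finally show ?thesis unfolding eq .
    qed
    moreover have "G t - G a = - (first_moment (V t) (Xt t) - h t) - (h t - h a)" by (simp add: G_def h_def)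
    moreover have "(KK * G a + \<eta>) * \<bar>t - a\<bar> = \<eta> / 2 * \<bar>t - a\<bar> + M * \<bar>t - a\<bar>" by (simp add: M_def algebra_simps)
    ultimately show "\<bar>G t - G a\<bar> \<le> (KK * G a + \<eta>) * \<bar>t - a\<bar>" by linarith
  qed (rule d)
qed

text \<open>The gap is nonnegative because \<open>norm (Xt t x) \<le> 1\<close>, and small initially
  because the initial moment is that of the curve, along which \<open>Xt 0\<close> nearly equals the
  tangent; Gronwall does the rest.\<close>

lemma gap_bound:
  assumes V: "generalized_BCF I V" and mass: "\<And>t. t \<in> I \<Longrightarrow> vmass (V t) \<le> L"
    and init: "\<And>X. test_field X \<Longrightarrow> first_moment (V 0) X = integral {0..L} (\<lambda>s. X (K 0 0 s) \<bullet> K 1 0 s)"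
    and JT: "J = closed_segment 0 T" and eps: "\<epsilon> \<le> \<delta> / 2"
  shows "L - first_moment (V T) (Xt T) \<le> L * (4 * b1 * \<epsilon>\<^sup>2 + 2 * k0 * \<epsilon>) * exp (KK * \<bar>T\<bar>)"
proof -
  have J0: "0 \<in> J" and JT': "T \<in> J" by (simp_all add: JT)
  define G where "G t = L - first_moment (V t) (Xt t)" for t
  have 1: "G T \<le> G 0 * exp (KK * \<bar>T\<bar>)"
  proof (rule gronwall_two_sided)
    show "KK \<ge> 0" by (rule calib_facts(4)[OF J0])
    show "\<exists>d>0. \<forall>t\<in>closed_segment 0 T. \<bar>t - a\<bar> < d \<longrightarrow> \<bar>G t - G a\<bar> \<le> (KK * G a + \<eta>) * \<bar>t - a\<bar>"
      if "a \<in> closed_segment 0 T" "0 < \<eta>" for a \<eta>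
      using gap_step[OF V mass _ that(2)] that(1) unfolding JT G_def by blast
    fix t assume "t \<in> closed_segment 0 T"
    then have t: "t \<in> J" "t \<in> I" using J by (auto simp: JT)
    have "\<bar>first_moment (V t) (Xt t)\<bar> \<le> 1 * vmass (V t)"
      using V t by (intro first_moment_bound smooth_imp_continuous test_field_smooth calib_facts) (auto simp: generalized_BCF_def)
    then show "G t \<ge> 0" using mass[OF t(2)] by (simp add: G_def)
  qed
  have "G 0 \<le> L * (4 * b1 * \<epsilon>\<^sup>2 + 2 * k0 * \<epsilon>)"
  proof -
    have I0: "0 \<in> I" using J0 J by auto
    have "integral {0..L} (\<lambda>s. 1 - (4 * b1 * \<epsilon>\<^sup>2 + 2 * k0 * \<epsilon>)) \<le> integral {0..L} (\<lambda>s. Xt 0 (K 0 0 s) \<bullet> K 1 0 s)"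
    proof (rule integral_le)
      have "continuous_on {0..L} (\<lambda>s. Xt 0 (K 0 0 s))"
        by (rule continuous_on_compose2[OF smooth_imp_continuous[OF test_field_smooth[OF calib_facts(1)[OF J0]], of UNIV]])
          (auto intro: K_cont'[OF I0])
      then show "(\<lambda>s. Xt 0 (K 0 0 s) \<bullet> K 1 0 s) integrable_on {0..L}"
        by (intro integrable_continuous_real continuous_intros K_cont'[OF I0])
    qed (use calib_facts(6)[OF J0 eps] in auto)
    then show ?thesis using L unfolding G_def init[OF calib_facts(1)[OF J0]] by (simp add: algebra_simps)
  qed
  then have 2: "G 0 * exp (KK * \<bar>T\<bar>) \<le> L * (4 * b1 * \<epsilon>\<^sup>2 + 2 * k0 * \<epsilon>) * exp (KK * \<bar>T\<bar>)"
    by (intro mult_right_mono) auto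
  show ?thesis using order.trans[OF 1 2] by (simp only: G_def)
qed

end

lemma le_of_le_vanishing:
  fixes x a b d p q :: real
  assumes "d > 0" and le: "\<And>\<epsilon>. \<lbrakk>0 < \<epsilon>; \<epsilon> \<le> d\<rbrakk> \<Longrightarrow> x \<le> a + b * (p * \<epsilon>\<^sup>2 + q * \<epsilon>)"
  shows "x \<le> a"
proof (rule tendsto_lowerbound)
  have "((\<lambda>\<epsilon>. a + b * (p * \<epsilon>\<^sup>2 + q * \<epsilon>)) \<longlongrightarrow> a + b * (p * 0\<^sup>2 + q * 0)) (at_right 0)"
    by (intro tendsto_intros)
  then show "((\<lambda>\<epsilon>. a + b * (p * \<epsilon>\<^sup>2 + q * \<epsilon>)) \<longlongrightarrow> a) (at_right 0)" by simp
  show "\<forall>\<^sub>F \<epsilon> in at_right 0. x \<le> a + b * (p * \<epsilon>\<^sup>2 + q * \<epsilon>)"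
    unfolding eventually_at_right_field using assms by (intro exI[of _ d]) auto
qed simp

section \<open>Identification of all first moments\<close>

context smooth_flow begin

text \<open>Subtracting the mean \<open>m\<close> makes the integral over one period vanish, so that
  the primitive is periodic.\<close>

lemma periodic_primitive:
  assumes T: "T \<in> I" and Z: "test_field Z"
  defines "m \<equiv> integral {0..L} (\<lambda>s. Z (K 0 T s) \<bullet> K 1 T s) / L"
  obtains h where "\<And>s. (h has_real_derivative Z (K 0 T s) \<bullet> K 1 T s - m) (at s)"
    "smooth h" "smooth (\<lambda>s. Z (K 0 T s) \<bullet> K 1 T s - m)" "\<And>s. h (s + L) = h s" "\<And>s. \<bar>h s\<bar> \<le> (SUP s\<in>{0..L}. \<bar>h s\<bar>)"
proof -
  define z where "z s = Z (K 0 T s) \<bullet> K 1 T s - m" for s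
  have sZ: "smooth (\<lambda>s. Z (K 0 T s))"
    using K_s[OF T, of 0] K_smooth[OF T, of 1] test_field_smooth[OF Z]
    by (intro smooth_compose_curve[of "K 0 T" "K 1 T"]) auto
  have sz: "smooth z" unfolding z_def by (intro smooth_diff smooth_inner smooth_const sZ K_smooth[OF T])
  then obtain h where h: "\<And>s. (h has_real_derivative z s) (at s)"
    using antiderivative_exists[OF smooth_imp_continuous] by metis
  have sh: "smooth h"
    by (rule smooth_of_vector_derivative[OF _ sz]) (use h in \<open>simp add: has_real_derivative_iff_has_vector_derivative\<close>)
  have hL: "h L = h 0"
  proof -
    have "(z has_integral (h L - h 0)) {0..L}"
      using L h by (intro fundamental_theorem_of_calculus)
        (auto simp: has_real_derivative_iff_has_vector_derivative intro: has_vector_derivative_at_within)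
    moreover have "integral {0..L} z = 0"
    proof -
      have "integral {0..L} z = integral {0..L} (\<lambda>s. Z (K 0 T s) \<bullet> K 1 T s) - integral {0..L} (\<lambda>s. m)"
        unfolding z_def
        by (intro integral_diff integrable_continuous_real continuous_intros smooth_imp_continuous[OF sZ] K_cont'[OF T])
      then show ?thesis using L by (simp add: m_def)
    qed
    ultimately show ?thesis by (simp add: integral_unique)
  qed
  have z_per: "z (s + L) = z s" for s by (simp add: z_def K_per[OF T])
  have h_per: "h (s + L) = h s" for s
  proof -
    have "((\<lambda>s. h (s + L) - h s) has_real_derivative 0) (at s)" for s
    proof -
      have "((\<lambda>s. h (s + L)) has_real_derivative z (s + L)) (at s)"
        using h[of "s + L"] by (simp add: DERIV_shift)
      from DERIV_diff[OF this h] show ?thesis by (simp add: z_per)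
    qed
    then have "h (s + L) - h s = h (0 + L) - h 0" by (intro DERIV_isconst_all) blast
    then show ?thesis using hL by simp
  qed
  have "\<bar>h s\<bar> \<le> (SUP s\<in>{0..L}. \<bar>h s\<bar>)" for s
  proof -
    obtain n u where u: "s = u + of_int n * L" "0 \<le> u" "u < L" using periodic_reduce[OF L] .
    have "h s = h u" unfolding u(1) by (rule periodic_int[of h L, OF h_per])
    moreover have "compact ((\<lambda>s. \<bar>h s\<bar>) ` {0..L})"
      by (intro compact_continuous_image continuous_intros smooth_imp_continuous[OF sh]) auto
    then have "bdd_above ((\<lambda>s. \<bar>h s\<bar>) ` {0..L})" by (intro bounded_imp_bdd_above compact_imp_bounded)
    then have "\<bar>h u\<bar> \<le> (SUP s\<in>{0..L}. \<bar>h s\<bar>)" using u by (intro cSUP_upper) auto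
    ultimately show ?thesis by simp
  qed
  then show ?thesis
    by (rule that[OF h[unfolded z_def] sh sz[unfolded z_def[abs_def]] h_per])
qed

lemma unique_moment:
  assumes V: "generalized_BCF I V" and mass: "\<And>t. t \<in> I \<Longrightarrow> vmass (V t) \<le> L"
    and init: "\<And>X. test_field X \<Longrightarrow> first_moment (V 0) X = integral {0..L} (\<lambda>s. X (K 0 0 s) \<bullet> K 1 0 s)"
    and I0: "0 \<in> I" and T: "T \<in> I" and Z: "test_field Z"
  shows "first_moment (V T) Z = integral {0..L} (\<lambda>s. Z (K 0 T s) \<bullet> K 1 T s)"
proof -
  define m where "m = integral {0..L} (\<lambda>s. Z (K 0 T s) \<bullet> K 1 T s) / L"
  define h' where "h' s = Z (K 0 T s) \<bullet> K 1 T s - m" for s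
  obtain h where h: "\<And>s. (h has_real_derivative h' s) (at s)" "smooth h" "smooth h'"
    "\<And>s. h (s + L) = h s" "\<And>s. \<bar>h s\<bar> \<le> (SUP s\<in>{0..L}. \<bar>h s\<bar>)"
    unfolding h'_def m_def by (rule periodic_primitive[OF T Z]) blast
  define H where "H = (SUP s\<in>{0..L}. \<bar>h s\<bar>)"
  obtain CZ where CZ: "\<And>x. norm (Z x) \<le> CZ" "CZ \<ge> 0" by (rule test_field_bounded[OF Z]) blast
  obtain LZ where LZ: "\<And>x y. norm (Z x - Z y) \<le> LZ * norm (x - y)" by (rule test_field_lipschitz[OF Z]) blast
  define J where "J = closed_segment 0 T"
  have J: "compact J" "J \<subseteq> I" "is_interval J" and TJ: "T \<in> J"
    using I I0 T by (auto simp: J_def closed_segment_eq_real_ivl is_interval_convex_1 convex_contains_segment split: if_splits)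
  obtain \<delta> r0 k0 k1 b1 b2 f f1 f2 where \<delta>: "\<delta> > 0"
    and ex: "\<And>\<epsilon>. \<epsilon> > 0 \<Longrightarrow> \<exists>\<rho> \<rho>1 R. \<forall>t\<in>J. calib (K 0 t) (K 1 t) (K 2 t) (K 3 t) L \<delta> r0 k0 k1 b1 b2 \<epsilon> f f1 f2 \<rho> \<rho>1 R"
    by (rule calib_exists[OF J(1,2)]) blast
  define C where "C = 5 * b1 * H + LZ + k0 * (CZ + \<bar>m\<bar>) + CZ"
  define E where "E = L * exp (2 * Kc k0 k1 b1 b2 * (2 * r0\<^sup>2 + 12) * \<bar>T\<bar>)"
  have perL: "h L = h 0" using h(4)[of 0] by simp
  have main: "\<bar>first_moment (V T) Z - m * L\<bar> \<le> 4 * C * \<eta> * L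
      + (2 * C * (2 * r0\<^sup>2 + 12) / \<eta> + CZ + \<bar>m\<bar>) * E * (4 * b1 * \<epsilon>\<^sup>2 + 2 * k0 * \<epsilon>)"
    if \<eta>: "\<eta> > 0" and \<epsilon>: "0 < \<epsilon>" "\<epsilon> \<le> \<delta> / 2" for \<eta> \<epsilon>
  proof -
    obtain \<rho> \<rho>1 R where cal: "\<And>t. t \<in> J \<Longrightarrow> calib (K 0 t) (K 1 t) (K 2 t) (K 3 t) L \<delta> r0 k0 k1 b1 b2 \<epsilon> f f1 f2 \<rho> \<rho>1 R"
      using ex[OF \<epsilon>(1)] by blast
    interpret cf: calib_flow I L K J \<delta> r0 k0 k1 b1 b2 \<epsilon> f f1 f2 \<rho> \<rho>1 R
      by (intro calib_flow.intro smooth_flow_axioms calib_flow_axioms.intro J cal)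
    interpret c: calib "K 0 T" "K 1 T" "K 2 T" "K 3 T" L \<delta> r0 k0 k1 b1 b2 \<epsilon> f f1 f2 \<rho> \<rho>1 R by (rule cal[OF TJ])
    define X where "X = cf.Xt T"
    have Xc: "X = c.X" by (simp add: X_def cf.Xt_def)
    have gap: "L - first_moment (V T) X \<le> E * (4 * b1 * \<epsilon>\<^sup>2 + 2 * k0 * \<epsilon>)"
      using cf.gap_bound[OF V mass init J_def \<epsilon>(2)] by (simp add: X_def E_def cf.KK_def mult_ac)
    have ovT: "oriented_varifold (V T)" using V T by (simp add: generalized_BCF_def)
    interpret fm: finite_measure "V T" using ovT by (simp add: oriented_varifold_def)
    define U where "U = c.W h h'"
    have tU: "test_field U" unfolding U_def by (rule c.test_field_W[OF h(2,3)])
    have grad: "(c.A (\<lambda>x s. f (c.q x s) * h s) has_derivative (\<lambda>v. U x \<bullet> v)) (at x)" for x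
      unfolding U_def by (rule c.W_gradient[OF h(1) smooth_imp_continuous[OF h(3)] perL])
    have DU: "Dcurl_xi U x \<xi> = 0" for x \<xi> by (rule Dcurl_xi_gradient[OF grad test_field_smooth[OF tU]])
    have D0: "Dcurl_xi (\<lambda>x. 0) x \<xi> = 0" for x \<xi>
      by (rule Dcurl_xi_gradient[of "\<lambda>x. 0"]) (auto intro: smooth_const)
    have t0: "test_field (\<lambda>x. 0)" by (simp add: test_field_def smooth_on_UNIV_iff smooth_const)
    \<comment> \<open>\<open>U\<close> is built from the curve at time \<open>T\<close> but is a
      gradient on all of space, so its circulation along the closed initial curve vanishes.\<close>
    have U0: "first_moment (V 0) U = 0"
    proof -
      have "((\<lambda>s. c.A (\<lambda>x s. f (c.q x s) * h s) (K 0 0 s)) has_vector_derivative U (K 0 0 s) \<bullet> K 1 0 s) (at s)" for s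
        using has_derivative_compose[OF K_s[OF I0, of 0 s, unfolded has_vector_derivative_def] grad]
        by (simp add: has_vector_derivative_def)
      then have "((\<lambda>s. U (K 0 0 s) \<bullet> K 1 0 s) has_integral
          (c.A (\<lambda>x s. f (c.q x s) * h s) (K 0 0 L) - c.A (\<lambda>x s. f (c.q x s) * h s) (K 0 0 0))) {0..L}"
        using L by (intro fundamental_theorem_of_calculus) (auto intro: has_vector_derivative_at_within)
      moreover have "K 0 0 L = K 0 0 0" using K_per[OF I0, of 0 0] by simp
      ultimately show ?thesis unfolding init[OF tU] by (simp add: integral_unique)
    qed
    \<comment> \<open>The rate of change of the moment of \<open>U\<close> is an integral of
      \<open>Dcurl_xi U\<close>, which is 0; the increment bound is used with second field 0 and
      \<open>M = 0\<close>.\<close>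
    have UT: "first_moment (V T) U = 0"
    proof (cases "0 \<le> T")
      case True
      from BCF_increment_bound[OF V I mass tU t0 I0 T True, of 0 0] U0 show ?thesis
        by (simp add: DU D0 first_moment_def)
    next
      case False
      then have "T \<le> 0" by simp
      from BCF_increment_bound[OF V I mass tU t0 T I0 this, of 0 0] U0 show ?thesis
        by (simp add: DU D0 first_moment_def)
    qed
    have tX: "test_field X" unfolding Xc by (rule c.test_field_X)
    note iX = first_moment_integrable[OF ovT tX] and iZ = first_moment_integrable[OF ovT Z]
      and iU = first_moment_integrable[OF ovT tU]
    define c1 where "c1 = 2 * C * (2 * r0\<^sup>2 + 12) / \<eta> + CZ"
    have pt: "\<bar>U x \<bullet> \<xi> - Z x \<bullet> \<xi> + m * (X x \<bullet> \<xi>)\<bar> \<le> 4 * C * \<eta> + c1 * (1 - X x \<bullet> \<xi>)" if "norm \<xi> = 1" for x \<xi>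
      unfolding U_def Xc C_def c1_def
      by (rule c.potential_bound[OF smooth_imp_continuous[OF h(2)] smooth_imp_continuous[OF h(3)] h(4) _ _ _ CZ(1) LZ that \<eta>])
        (use h(5) in \<open>auto simp: h'_def K_per[OF T] H_def\<close>)
    have H0: "H \<ge> 0" using h(5)[of 0] by (simp add: H_def)
    have LZ0: "LZ \<ge> 0"
    proof -
      obtain e :: "real^3" where e: "norm e = 1" using vector_choose_size[of 1] by auto
      show ?thesis using LZ[of e 0] norm_ge_zero[of "Z e - Z 0"] unfolding diff_0_right e by linarith
    qed
    have C0: "C \<ge> 0" unfolding C_def using H0 LZ0 CZ c.small' c.Kc_nonneg by simp
    have c10: "c1 \<ge> 0" unfolding c1_def using C0 CZ \<eta> by simp
    have "\<bar>first_moment (V T) U - first_moment (V T) Z + m * first_moment (V T) X\<bar>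
        = \<bar>\<integral>p. U (fst p) \<bullet> snd p - Z (fst p) \<bullet> snd p + m * (X (fst p) \<bullet> snd p) \<partial>V T\<bar>"
      unfolding first_moment_def using iX iZ iU by simp
    also have "\<dots> \<le> (\<integral>p. \<bar>U (fst p) \<bullet> snd p - Z (fst p) \<bullet> snd p + m * (X (fst p) \<bullet> snd p)\<bar> \<partial>V T)"
      by (rule integral_abs_bound)
    also have "\<dots> \<le> (\<integral>p. 4 * C * \<eta> + c1 * (1 - X (fst p) \<bullet> snd p) \<partial>V T)"
    proof (rule integral_mono)
      fix p assume "p \<in> space (V T)"
      then have "norm (snd p) = 1" using ovT by (auto simp: oriented_varifold_def varifold_space_def)
      then show "\<bar>U (fst p) \<bullet> snd p - Z (fst p) \<bullet> snd p + m * (X (fst p) \<bullet> snd p)\<bar> \<le> 4 * C * \<eta> + c1 * (1 - X (fst p) \<bullet> snd p)"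
        by (rule pt)
    qed (use iX iZ iU in auto)
    also have "\<dots> = 4 * C * \<eta> * vmass (V T) + c1 * (vmass (V T) - first_moment (V T) X)"
      using iX by (simp add: first_moment_def vmass_def algebra_simps)
    also have "\<dots> \<le> 4 * C * \<eta> * L + c1 * (L - first_moment (V T) X)"
      using mass[OF T] C0 c10 \<eta> by (intro add_mono mult_left_mono) auto
    finally have 1: "\<bar>first_moment (V T) Z - m * first_moment (V T) X\<bar> \<le> 4 * C * \<eta> * L + c1 * (L - first_moment (V T) X)"
      unfolding UT by (simp add: abs_minus_commute)
    have X_le: "first_moment (V T) X \<le> L"
      using first_moment_bound[OF ovT smooth_imp_continuous[OF test_field_smooth[OF tX]], of 1] c.norm_X_le_1 mass[OF T]
      by (simp add: Xc)
    \<comment> \<open>The gap bound makes the moment of \<open>X\<close> nearly \<open>L\<close>, so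
      \<open>m\<close> times it may be replaced by \<open>m * L\<close>, the value on the smooth
      curve.\<close>
    have 2: "\<bar>m * first_moment (V T) X - m * L\<bar> = \<bar>m\<bar> * (L - first_moment (V T) X)"
      using X_le by (simp add: right_diff_distrib[symmetric] abs_mult)
    have "\<bar>first_moment (V T) Z - m * L\<bar> \<le> 4 * C * \<eta> * L + (c1 + \<bar>m\<bar>) * (L - first_moment (V T) X)"
      using 1 2 by (simp add: distrib_right)
    also have "\<dots> \<le> 4 * C * \<eta> * L + (c1 + \<bar>m\<bar>) * (E * (4 * b1 * \<epsilon>\<^sup>2 + 2 * k0 * \<epsilon>))"
      using gap c10 by (intro add_left_mono mult_left_mono) auto
    finally show ?thesis by (simp add: c1_def mult.assoc)
  qed
  \<comment> \<open>The limit \<epsilon> to 0 comes first, with \<eta> fixed, as the coefficient of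
    the vanishing term contains \<open>1 / \<eta>\<close>.\<close>
  have eta: "\<bar>first_moment (V T) Z - m * L\<bar> \<le> 4 * C * \<eta> * L" if "\<eta> > 0" for \<eta>
    by (rule le_of_le_vanishing[of "\<delta> / 2"]) (use \<delta> main[OF that] in auto)
  have lin: "\<bar>first_moment (V T) Z - m * L\<bar> \<le> 0 + (4 * C * L) * (0 * \<eta>\<^sup>2 + 1 * \<eta>)" if "\<eta> > 0" for \<eta>
    by (rule order.trans[OF eta[OF that]]) simp
  have "\<bar>first_moment (V T) Z - m * L\<bar> \<le> 0"
    by (rule le_of_le_vanishing[OF zero_less_one lin])
  then show ?thesis using L by (simp add: m_def)
qed

end

section \<open>The smooth flow is a weak flow\<close>

text \<open>\<open>c\<close> is \<open>1\<close> or \<open>- 1\<close> and fixes the orientation;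
  these are the padding curves of \<open>integral_current_curve\<close>.\<close>

definition circle :: "real \<Rightarrow> real \<Rightarrow> real \<Rightarrow> real^3" where
  "circle r c s = (r * cos (2 * pi * c * s)) *\<^sub>R axis 1 1 + (r * sin (2 * pi * c * s)) *\<^sub>R axis 2 1"

definition circle' :: "real \<Rightarrow> real \<Rightarrow> real \<Rightarrow> real^3" where
  "circle' r c s = (- 2 * pi * c * r * sin (2 * pi * c * s)) *\<^sub>R axis 1 1 + (2 * pi * c * r * cos (2 * pi * c * s)) *\<^sub>R axis 2 1"

lemma circle_deriv: "(circle r c has_vector_derivative circle' r c s) (at s)"
  unfolding circle_def circle'_def
  by (auto intro!: derivative_eq_intros simp: has_real_derivative_iff_has_vector_derivative[symmetric] mult_ac)

lemma norm_circle': "r \<ge> 0 \<Longrightarrow> \<bar>c\<bar> = 1 \<Longrightarrow> norm (circle' r c s) = 2 * pi * r"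
proof -
  assume r: "r \<ge> 0" and c: "\<bar>c\<bar> = 1"
  then have c2: "c\<^sup>2 = 1" by (metis power2_abs power_one)
  have e: "(norm (u *\<^sub>R axis 1 1 + v *\<^sub>R axis 2 1 :: real^3))\<^sup>2 = u\<^sup>2 + v\<^sup>2" for u v :: real
    unfolding power2_norm_eq_inner by (simp add: inner_add_left inner_add_right inner_axis_axis power2_eq_square)
  have "(norm (circle' r c s))\<^sup>2 = (2 * pi * r)\<^sup>2 * c\<^sup>2 * ((sin (2 * pi * c * s))\<^sup>2 + (cos (2 * pi * c * s))\<^sup>2)"
    unfolding circle'_def e by algebra
  then have "(norm (circle' r c s))\<^sup>2 = (2 * pi * r)\<^sup>2" unfolding c2 by (simp only: sin_cos_squared_add mult_1_right)
  then show ?thesis by (rule power2_eq_imp_eq) (simp_all add: r)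
qed

lemma simple_closed_circle:
  assumes r: "r > 0" and c: "c = 1 \<or> c = -1"
  shows "simple_closed_param (circle r c)"
  unfolding simple_closed_param_def
proof (intro conjI allI)
  have "(2 * pi * r)-lipschitz_on UNIV (circle r c)"
  proof (rule lipschitz_onI)
    fix s t :: real
    have "norm (circle r c s - circle r c t) \<le> 2 * pi * r * \<bar>s - t\<bar>"
      using r c by (intro norm_diff_le_of_vector_derivative[OF circle_deriv]) (auto simp: norm_circle')
    then show "dist (circle r c s) (circle r c t) \<le> 2 * pi * r * dist s t" by (simp add: dist_norm)
  qed (use r in simp)
  then show "\<exists>C. C-lipschitz_on UNIV (circle r c)" by blast
  show "circle r c (s + 1) = circle r c s" for s
  proof -
    have "sin (2 * pi * c * (s + 1)) = sin (2 * pi * c * s) \<and> cos (2 * pi * c * (s + 1)) = cos (2 * pi * c * s)"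
      unfolding sin_cos_eq_iff using c by (auto simp: algebra_simps intro: exI[of _ 1] exI[of _ "-1"])
    then show ?thesis by (simp add: circle_def)
  qed
  show "inj_on (circle r c) {0..<1}"
  proof (rule inj_onI)
    fix s t assume st: "s \<in> {0..<1}" "t \<in> {0..<1}" and eq: "circle r c s = circle r c t"
    have "circle r c s $ 1 = circle r c t $ 1" "circle r c s $ 2 = circle r c t $ 2" using eq by simp_all
    then have "sin (2 * pi * c * s) = sin (2 * pi * c * t) \<and> cos (2 * pi * c * s) = cos (2 * pi * c * t)"
      using r by (simp add: circle_def axis_def)
    then obtain n :: int where "2 * pi * c * s = 2 * pi * c * t + 2 * pi * n" unfolding sin_cos_eq_iff by blast
    then have "2 * pi * (c * s) = 2 * pi * (c * t + n)" by (simp add: algebra_simps)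
    then have "c * s = c * t + n" by simp
    then have "\<bar>real_of_int n\<bar> = \<bar>s - t\<bar>" using c by auto
    also have "\<dots> < 1" using st by auto
    finally have "n = 0" by linarith
    then show "s = t" using \<open>c * s = c * t + n\<close> c by auto
  qed
qed

lemma curve_length_circle: "r \<ge> 0 \<Longrightarrow> \<bar>c\<bar> = 1 \<Longrightarrow> curve_length (circle r c) = 2 * pi * r"
  unfolding curve_length_def vector_derivative_at[OF circle_deriv] by (simp add: norm_circle')

lemma circle_reverse: "circle r (-1) s = circle r 1 (- s)" "circle' r (-1) s = - circle' r 1 (- s)"
  by (simp_all add: circle_def circle'_def)

lemma curve_current_circle_reverse:
  assumes X: "test_field X"
  shows "curve_current (circle r (-1)) X = - curve_current (circle r 1) X"
proof -
  define p where "p s = X (circle r 1 s) \<bullet> circle' r 1 s" for s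
  have cX: "continuous_on UNIV (\<lambda>s. X (circle r 1 s))"
    by (rule continuous_on_compose2[OF smooth_imp_continuous[OF test_field_smooth[OF X], of UNIV]])
      (auto simp: circle_def intro!: continuous_intros)
  have cont: "continuous_on UNIV p"
    unfolding p_def by (intro continuous_intros cX) (auto simp: circle'_def intro!: continuous_intros)
  have trig: "sin (2 * pi * (s + 1)) = sin (2 * pi * s) \<and> cos (2 * pi * (s + 1)) = cos (2 * pi * s)" for s :: real
    unfolding sin_cos_eq_iff by (auto simp: algebra_simps intro: exI[of _ 1])
  have per: "p (s + 1) = p s" for s
    using trig[of s] by (simp add: p_def circle_def circle'_def)
  have "curve_current (circle r (-1)) X = integral {0..1} (\<lambda>s. - p (- s))"
    unfolding curve_current_def vector_derivative_at[OF circle_deriv] by (simp add: p_def circle_reverse)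
  also have "\<dots> = - integral {-1..0} p" using Henstock_Kurzweil_Integration.integral_reflect_real[of 0 "-1" p] by simp
  also have "\<dots> = - integral {0..1} p"
    using integral_periodic_shift[OF cont per, of "-1"] by simp
  also have "\<dots> = - curve_current (circle r 1) X"
    unfolding curve_current_def vector_derivative_at[OF circle_deriv] p_def[abs_def] ..
  finally show ?thesis .
qed

lemma curve_current_circle_bound:
  assumes X: "test_field X" and b: "\<And>x. norm (X x) \<le> B" and r: "r \<ge> 0"
  shows "\<bar>curve_current (circle r 1) X\<bar> \<le> 2 * pi * r * B"
proof -
  have cX: "continuous_on {0..1} (\<lambda>s. X (circle r 1 s))"
    by (rule continuous_on_compose2[OF smooth_imp_continuous[OF test_field_smooth[OF X], of UNIV]])
      (auto simp: circle_def intro!: continuous_intros)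
  have "norm (integral {0..1} (\<lambda>s. X (circle r 1 s) \<bullet> circle' r 1 s)) \<le> B * (2 * pi * r) * (1 - 0)"
  proof (rule integral_bound)
    show "continuous_on {0..1} (\<lambda>s. X (circle r 1 s) \<bullet> circle' r 1 s)"
      by (intro continuous_intros cX) (auto simp: circle'_def intro!: continuous_intros)
    show "norm (X (circle r 1 s) \<bullet> circle' r 1 s) \<le> B * (2 * pi * r)" for s
      using order.trans[OF Cauchy_Schwarz_ineq2[of "X (circle r 1 s)" "circle' r 1 s"] mult_right_mono[OF b norm_ge_zero]]
      by (simp add: norm_circle' r)
  qed simp
  then show ?thesis unfolding curve_current_def vector_derivative_at[OF circle_deriv] by (simp add: mult_ac)
qed

text \<open>The definition asks for infinitely many simple closed curves, so a single curve is completed by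
  shrinking circles that are traversed once in each direction.\<close>
lemma integral_current_curve:
  assumes g: "simple_closed_param g"
  shows "integral_current (curve_current g)"
proof -
  \<comment> \<open>\<open>i div 2\<close> gives the same radius to two consecutive indices, which
    get opposite orientations.\<close>
  define r where "r i = (1 / 2 :: real) ^ (i div 2)" for i :: nat
  define o' where "o' i = (if even i then 1 else - 1 :: real)" for i :: nat
  define gs where "gs j = (case j of 0 \<Rightarrow> g | Suc i \<Rightarrow> circle (r i) (o' i))" for j
  have r: "r i > 0" for i by (simp add: r_def)
  have o': "o' i = 1 \<or> o' i = -1" "\<bar>o' i\<bar> = 1" for i by (simp_all add: o'_def)
  \<comment> \<open>A geometric majorant in \<open>i\<close> itself:
    \<open>1 / 2 \<le> (3 / 4)\<^sup>2\<close>, and the factor 2 covers the odd indices.\<close>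
  have r_le: "r i \<le> 2 * (3 / 4) ^ i" for i
  proof -
    have "(1 / 2 :: real) ^ k \<le> (9 / 16) ^ k" for k :: nat by (intro power_mono) auto
    then have k: "(1 / 2 :: real) ^ k \<le> (3 / 4) ^ (2 * k)" for k :: nat by (simp add: power_mult power2_eq_square)
    have "(3 / 4 :: real) ^ (2 * (i div 2)) \<le> 2 * (3 / 4) ^ i"
    proof (cases "even i")
      case False
      then have "i = Suc (2 * (i div 2))" by simp
      then have "(3 / 4 :: real) ^ i = 3 / 4 * (3 / 4) ^ (2 * (i div 2))" by (metis power_Suc)
      moreover have "0 \<le> (3 / 4 :: real) ^ (2 * (i div 2))" by simp
      ultimately show ?thesis by linarith
    qed simp
    then show ?thesis using k[of "i div 2"] by (simp add: r_def)
  qed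
  have sum_r: "summable r"
    by (rule summable_comparison_test'[of "\<lambda>i. 2 * (3 / 4 :: real) ^ i" 0])
      (use r_le r in \<open>auto intro!: summable_mult summable_geometric simp: abs_of_pos\<close>)
  show ?thesis
    unfolding integral_current_def
  proof (intro exI[of _ gs] conjI allI impI)
    show "simple_closed_param (gs j)" for j
      using g simple_closed_circle[OF r o'(1)] by (simp add: gs_def split: nat.split)
    have "summable (\<lambda>i. curve_length (gs (Suc i)))"
      using summable_mult[OF sum_r, of "2 * pi"] by (simp add: gs_def curve_length_circle r o' less_imp_le)
    then show "summable (\<lambda>j. curve_length (gs j))" by (rule summable_Suc_iff[THEN iffD1])
    fix X assume X: "test_field X"
    obtain B where B: "\<And>x. norm (X x) \<le> B" "B \<ge> 0" by (rule test_field_bounded[OF X]) blast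
    define e where "e i = curve_current (gs (Suc i)) X" for i
    have e_eq: "e i = o' i * curve_current (circle (r i) 1) X" for i
      using curve_current_circle_reverse[OF X] by (simp add: e_def gs_def o'_def)
    have "summable e"
    proof (rule summable_comparison_test'[of "\<lambda>i. 2 * pi * B * r i" 0])
      show "summable (\<lambda>i. 2 * pi * B * r i)" by (intro summable_mult sum_r)
      show "norm (e i) \<le> 2 * pi * B * r i" for i
        using curve_current_circle_bound[OF X B(1), of "r i"] r[of i] o'(2)[of i]
        by (simp add: e_eq abs_mult mult_ac)
    qed
    then have lim: "(\<lambda>n. \<Sum>i<n. e i) \<longlonglongrightarrow> suminf e" by (rule summable_LIMSEQ)
    \<comment> \<open>Pairs cancel in partial sums of even length, so the sum is found along a
      subsequence once summability is known.\<close>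
    have zero: "(\<Sum>i<2 * n. e i) = 0" for n
    proof (induction n)
      case (Suc n)
      have "r (Suc (2 * n)) = r (2 * n)" by (simp add: r_def)
      then show ?case using Suc by (simp add: e_eq o'_def)
    qed simp
    have "strict_mono (\<lambda>n::nat. 2 * n)" by (simp add: strict_mono_def)
    from LIMSEQ_subseq_LIMSEQ[OF lim this] have "(\<lambda>n. 0) \<longlonglongrightarrow> suminf e"
      by (simp add: o_def zero)
    then have "suminf e = 0" using LIMSEQ_unique tendsto_const by blast
    then have "e sums 0" using \<open>summable e\<close> summable_sums by fastforce
    then have "(\<lambda>j. curve_current (gs j) X) sums (0 + curve_current (gs 0) X)"
      unfolding e_def by (rule sums_Suc)
    then show "(\<lambda>j. curve_current (gs j) X) sums curve_current g X" by (simp add: gs_def)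
  qed
qed

lemma integral_current_cong:
  "same_current S T \<Longrightarrow> integral_current S \<longleftrightarrow> integral_current T"
  unfolding integral_current_def same_current_def by metis

text \<open>In dimension three the antisymmetric part of a derivative acts as a cross product with
  the curl.\<close>

lemma inner_derivative_skew:
  assumes X: "smooth X" and D: "(X has_derivative D) (at x)"
  shows "D u \<bullet> v - D v \<bullet> u = curl X x \<bullet> cross3 u v"
proof -
  have D_eq: "D = (\<lambda>v. \<Sum>l\<in>UNIV. v $ l *\<^sub>R pd X l x)"
    by (rule has_derivative_unique[OF D has_derivative_pd[OF X]])
  show ?thesis
    unfolding D_eq curl_def
    by (simp add: inner_vec_def sum_3 cross3_def vector_3 algebra_simps)
qed

lemma cross3_triple: "cross3 (cross3 u v) w = (u \<bullet> w) *\<^sub>R v - (v \<bullet> w) *\<^sub>R u"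
  by (simp add: vec_eq_iff forall_3 cross3_def vector_3 inner_vec_def sum_3 algebra_simps)

section \<open>The varifold carried by the smooth flow\<close>

context smooth_flow begin

definition curr where "curr t X = integral {0..L} (\<lambda>s. X (K 0 t s) \<bullet> K 1 t s)"

lemma comp_cont:
  assumes X: "smooth X" and t: "t \<in> I"
  shows "continuous_on S (\<lambda>s. X (K k t s))"
  by (rule continuous_on_compose2[OF smooth_imp_continuous[OF X, of UNIV]]) (auto intro: K_cont'[OF t])

lemma integral_current_curr:
  assumes t: "t \<in> I"
  shows "integral_current (curr t)"
proof -
  define g where "g s = K 0 t (L * s)" for s
  have gd: "(g has_vector_derivative L *\<^sub>R K 1 t (L * s)) (at s)" for s
  proof -
    have "((\<lambda>s. L * s) has_vector_derivative L) (at s)"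
      by (auto intro!: derivative_eq_intros)
    from vector_diff_chain_at[OF this K_s[OF t, of 0 "L * s"]] show ?thesis
      by (simp add: g_def[abs_def] o_def)
  qed
  have "simple_closed_param g"
    unfolding simple_closed_param_def
  proof (intro conjI allI)
    have "L-lipschitz_on UNIV g"
    proof (rule lipschitz_onI)
      fix s s' :: real
      have "norm (g s - g s') \<le> L * \<bar>s - s'\<bar>"
        by (rule norm_diff_le_of_vector_derivative[OF gd]) (use L unit[OF t] in simp)
      then show "dist (g s) (g s') \<le> L * dist s s'" by (simp add: dist_norm)
    qed (use L in simp)
    then show "\<exists>C. C-lipschitz_on UNIV g" by blast
    show "g (s + 1) = g s" for s using per[OF t, of "L * s"] by (simp add: g_def algebra_simps)
    show "inj_on g {0..<1}"
    proof (rule inj_onI)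
      fix s s' assume s: "s \<in> {0..<1}" "s' \<in> {0..<1}" "g s = g s'"
      then have "L * s \<in> {0..<L}" "L * s' \<in> {0..<L}" using L by auto
      then have "L * s = L * s'" using inj_onD[OF inj[OF t], of "L * s" "L * s'"] s(3) by (simp add: g_def)
      then show "s = s'" using L by simp
    qed
  qed
  moreover have "same_current (curve_current g) (curr t)"
    unfolding same_current_def
  proof (intro allI impI)
    fix X assume X: "test_field X"
    define p where "p s = X (K 0 t s) \<bullet> K 1 t s" for s
    have "continuous_on UNIV p"
      unfolding p_def by (intro continuous_intros comp_cont[OF test_field_smooth[OF X] t] K_cont'[OF t])
    then obtain P where P: "\<And>s. (P has_real_derivative p s) (at s)" using antiderivative_exists by metis
    have "(p has_integral (P L - P 0)) {0..L}"
      using L P by (intro fundamental_theorem_of_calculus)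
        (auto simp: has_real_derivative_iff_has_vector_derivative intro: has_vector_derivative_at_within)
    then have "curr t X = P L - P 0" unfolding curr_def p_def by (simp add: integral_unique)
    moreover have "((\<lambda>s. L * p (L * s)) has_integral (P (L * 1) - P (L * 0))) {0..1}"
    proof (rule fundamental_theorem_of_calculus)
      fix s :: real
      have "((\<lambda>s. P (L * s)) has_real_derivative L * p (L * s)) (at s)"
        by (rule DERIV_cong[OF DERIV_chain2[OF P]]) (auto intro!: derivative_eq_intros)
      then show "((\<lambda>s. P (L * s)) has_vector_derivative L * p (L * s)) (at s within {0..1})"
        by (simp add: has_real_derivative_iff_has_vector_derivative has_vector_derivative_at_within)
    qed simp
    then have "integral {0..1} (\<lambda>s. L * p (L * s)) = P L - P 0" by (simp only: integral_unique mult_1_right mult_zero_right)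
    then have "curve_current g X = P L - P 0"
      unfolding curve_current_def vector_derivative_at[OF gd] inner_scaleR_right p_def g_def .
    ultimately show "curve_current g X = curr t X" by simp
  qed
  ultimately show ?thesis using integral_current_cong integral_current_curve by blast
qed

text \<open>The lift of the curve with multiplicity one: arc length pushed forward under position
  and tangent.\<close>

definition VV where
  "VV t = distr (restrict_space lborel {0..L}) (restrict_space borel varifold_space) (\<lambda>s. (K 0 t s, K 1 t s))"

lemma VV_measurable:
  assumes t: "t \<in> I"
  shows "(\<lambda>s. (K 0 t s, K 1 t s)) \<in> measurable (restrict_space lborel {0..L}) (restrict_space borel varifold_space)"
proof (rule measurable_restrict_space2)
  show "(\<lambda>s. (K 0 t s, K 1 t s)) \<in> space (restrict_space lborel {0..L}) \<rightarrow> varifold_space"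
    using unit[OF t] by (auto simp: varifold_space_def)
  have "continuous_on UNIV (\<lambda>s. (K 0 t s, K 1 t s))" by (intro continuous_intros K_cont'[OF t])
  then have "(\<lambda>s. (K 0 t s, K 1 t s)) \<in> borel_measurable borel" by (rule borel_measurable_continuous_onI)
  then show "(\<lambda>s. (K 0 t s, K 1 t s)) \<in> borel_measurable (restrict_space lborel {0..L})"
    by (intro measurable_restrict_space1) simp
qed

lemma VV_integral:
  fixes \<phi> :: "(real^3) \<times> (real^3) \<Rightarrow> real"
  assumes t: "t \<in> I" and cont: "continuous_on UNIV \<phi>"
  shows "(\<integral>p. \<phi> p \<partial>VV t) = integral {0..L} (\<lambda>s. \<phi> (K 0 t s, K 1 t s))"
proof -
  have m: "\<phi> \<in> borel_measurable (restrict_space borel varifold_space)"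
    by (intro measurable_restrict_space1 borel_measurable_continuous_onI cont)
  have c: "continuous_on {0..L} (\<lambda>s. \<phi> (K 0 t s, K 1 t s))"
    by (rule continuous_on_compose2[OF cont]) (auto intro!: continuous_intros K_cont'[OF t])
  have "(\<integral>p. \<phi> p \<partial>VV t) = (\<integral>s. \<phi> (K 0 t s, K 1 t s) \<partial>restrict_space lborel {0..L})"
    unfolding VV_def by (rule integral_distr[OF VV_measurable[OF t] m])
  also have "\<dots> = (LINT s:{0..L}|lborel. \<phi> (K 0 t s, K 1 t s))"
    by (subst integral_restrict_space) (auto simp: set_lebesgue_integral_def)
  also have "\<dots> = integral {0..L} (\<lambda>s. \<phi> (K 0 t s, K 1 t s))"
    by (rule set_borel_integral_eq_integral(2)[OF borel_integrable_atLeastAtMost'[OF c]])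
  finally show ?thesis .
qed

lemma VV_first_moment:
  assumes t: "t \<in> I" and X: "smooth X"
  shows "first_moment (VV t) X = curr t X"
proof -
  have c: "continuous_on UNIV (\<lambda>p::(real^3)\<times>(real^3). X (fst p) \<bullet> snd p)"
    by (intro continuous_intros continuous_on_compose2[OF smooth_imp_continuous[OF X, of UNIV]]) auto
  show ?thesis unfolding first_moment_def VV_integral[OF t c] curr_def by simp
qed

lemma VV_emeasure:
  assumes t: "t \<in> I" and B: "B \<in> varifold_sets"
  shows "emeasure (VV t) B = emeasure lborel {s \<in> {0..L}. (K 0 t s, K 1 t s) \<in> B}"
proof -
  have "emeasure (VV t) B = emeasure (restrict_space lborel {0..L}) ((\<lambda>s. (K 0 t s, K 1 t s)) -` B \<inter> space (restrict_space lborel {0..L}))"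
    unfolding VV_def using B by (intro emeasure_distr VV_measurable[OF t]) (auto simp: varifold_sets_def)
  also have "(\<lambda>s. (K 0 t s, K 1 t s)) -` B \<inter> space (restrict_space lborel {0..L}) = {s \<in> {0..L}. (K 0 t s, K 1 t s) \<in> B}"
    by (auto simp: space_restrict_space)
  also have "emeasure (restrict_space lborel {0..L}) \<dots> = emeasure lborel {s \<in> {0..L}. (K 0 t s, K 1 t s) \<in> B}"
    by (rule emeasure_restrict_space) auto
  finally show ?thesis .
qed

lemma VV_space: "space (VV t) = varifold_space" "sets (VV t) = varifold_sets"
  by (simp_all add: VV_def varifold_sets_def space_restrict_space)

lemma varifold_space_mem: "varifold_space \<in> varifold_sets"
  unfolding varifold_sets_def using sets.top[of "restrict_space borel varifold_space"] by (simp add: space_restrict_space)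

lemma VV_total:
  assumes t: "t \<in> I"
  shows "emeasure (VV t) (space (VV t)) = ennreal L"
proof -
  have "{s \<in> {0..L}. (K 0 t s, K 1 t s) \<in> varifold_space} = {0..L}"
    using unit[OF t] by (auto simp: varifold_space_def)
  then show ?thesis using VV_emeasure[OF t varifold_space_mem] L by (simp add: VV_space)
qed

lemma VV_oriented:
  assumes t: "t \<in> I"
  shows "oriented_varifold (VV t)" "vmass (VV t) = L"
proof -
  show "vmass (VV t) = L" unfolding vmass_def measure_def VV_total[OF t] using L by simp
  have "finite_measure (VV t)" by (rule finite_measureI) (simp add: VV_total[OF t])
  moreover have "same_current (first_moment (VV t)) (curr t)"
    unfolding same_current_def using VV_first_moment[OF t] test_field_smooth by blast
  then have "integral_current (first_moment (VV t))"
    using integral_current_cong integral_current_curr[OF t] by blast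
  ultimately show "oriented_varifold (VV t)" by (simp add: oriented_varifold_def VV_space)
qed

text \<open>The masses are the measures of the sections of one Borel set in time and parameter, the
  preimage of \<open>B\<close> under the jointly continuous position and tangent; Tonelli gives
  measurability.\<close>

lemma VV_measurable_time:
  assumes B: "B \<in> varifold_sets"
  shows "(\<lambda>t. emeasure (VV t) B) \<in> borel_measurable (lebesgue_on I)"
proof -
  have "closed varifold_space" unfolding varifold_space_def
    by (intro closed_Times closed_UNIV) simp
  then have vb: "varifold_space \<in> sets borel" by simp
  then have Bb: "B \<in> sets borel" using B unfolding varifold_sets_def by (simp add: sets_restrict_space_iff)
  have IL: "I \<times> {0..L} \<in> sets borel"
    using interval_sets_lebesgue(1)[OF I] by (intro borel_Times) auto
  define Q where "Q = (\<lambda>p. (K 0 (fst p) (snd p), K 1 (fst p) (snd p))) -` B \<inter> (I \<times> {0..L})"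
  have "continuous_on (I \<times> {0..L}) (\<lambda>p. (K 0 (fst p) (snd p), K 1 (fst p) (snd p)))"
    by (intro continuous_intros) auto
  then have "(\<lambda>p. (K 0 (fst p) (snd p), K 1 (fst p) (snd p))) \<in> borel_measurable (restrict_space borel (I \<times> {0..L}))"
    by (rule borel_measurable_continuous_on_restrict)
  from measurable_sets[OF this Bb] have "Q \<in> sets (restrict_space borel (I \<times> {0..L}))"
    by (simp add: Q_def space_restrict_space)
  then have "Q \<in> sets borel" using IL by (simp add: sets_restrict_space_iff)
  then have Q: "Q \<in> sets (borel \<Otimes>\<^sub>M lborel)"
    by (metis borel_prod sets_pair_measure_cong sets_lborel)
  have "(\<lambda>t. emeasure lborel (Pair t -` Q)) \<in> borel_measurable borel"
    by (rule lborel.measurable_emeasure_Pair[OF Q])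
  then have m: "(\<lambda>t. emeasure lborel (Pair t -` Q)) \<in> borel_measurable (lebesgue_on I)"
    by (intro measurable_restrict_space1 measurable_completion) simp
  have "emeasure lborel (Pair t -` Q) = emeasure (VV t) B" if "t \<in> space (lebesgue_on I)" for t
  proof -
    have "t \<in> I" using that by (simp add: space_restrict_space)
    moreover then have "Pair t -` Q = {s \<in> {0..L}. (K 0 t s, K 1 t s) \<in> B}" by (auto simp: Q_def)
    ultimately show ?thesis using VV_emeasure[OF _ B] by simp
  qed
  from iffD1[OF measurable_cong[OF this] m] show ?thesis .
qed

text \<open>The time derivative of the integrand and
  \<open>D(curl X) : \<tau> \<otimes> \<tau>\<close> add up to the \<open>s\<close>-derivative of
  the periodic \<open>P\<close>, so their integrals are opposite.\<close>

lemma curr_deriv: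
  assumes t: "t \<in> I" and X: "smooth X"
  shows "((\<lambda>r. curr r X) has_real_derivative - (\<integral>p. Dcurl_xi X (fst p) (snd p) \<partial>VV t)) (at t within I)"
proof -
  define D where "D x = frechet_derivative X (at x)" for x
  have D: "(X has_derivative D x) (at x)" for x unfolding D_def by (rule smooth_has_derivative[OF X])
  have D_eq: "D x v = (\<Sum>l\<in>UNIV. v $ l *\<^sub>R pd X l x)" for x v
    using has_derivative_unique[OF D has_derivative_pd[OF X]] by metis
  define gt where "gt t s = cross3 (K 1 t s) (K 2 t s)" for t s
  define ft where "ft t s = X (K 0 t s) \<bullet> cross3 (K 1 t s) (K 3 t s) + D (K 0 t s) (gt t s) \<bullet> K 1 t s" for t s
  have XK: "continuous_on (I \<times> S) (\<lambda>p. Z (K 0 (fst p) (snd p)))" if "smooth Z" for Z :: "real^3 \<Rightarrow> real^3" and S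
    by (rule continuous_on_compose2[OF smooth_imp_continuous[OF that, of UNIV]]) (auto intro!: continuous_intros)
  have 1: "((\<lambda>r. integral (cbox 0 L) (\<lambda>s. X (K 0 r s) \<bullet> K 1 r s)) has_vector_derivative integral (cbox 0 L) (ft t)) (at t within I)"
  proof (rule leibniz_rule_vector_derivative[OF _ _ _ t])
    show "((\<lambda>r. X (K 0 r s) \<bullet> K 1 r s) has_vector_derivative ft r s) (at r within I)" if "r \<in> I" "s \<in> cbox 0 L" for r s
    proof -
      have "((\<lambda>r. X (K 0 r s)) has_vector_derivative D (K 0 r s) (gt r s)) (at r within I)"
        unfolding has_vector_derivative_def
        by (rule has_derivative_eq_rhs[OF has_derivative_compose[OF flow[OF that(1), unfolded has_vector_derivative_def] D]])
          (simp add: gt_def linear_scale[OF has_derivative_linear[OF D]])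
      from has_vector_derivative_inner[OF this K1_t[OF that(1)]] show ?thesis by (simp add: ft_def)
    qed
    show "(\<lambda>s. X (K 0 r s) \<bullet> K 1 r s) integrable_on cbox 0 L" if "r \<in> I" for r
      by (auto intro!: integrable_continuous_real continuous_intros comp_cont[OF X that] K_cont'[OF that])
    show "continuous_on (I \<times> cbox 0 L) (\<lambda>(r, s). ft r s)"
      unfolding ft_def D_eq gt_def case_prod_unfold
      by (intro continuous_intros continuous_on_cross3 XK X smooth_pd) auto
    show "convex I" using I by (simp add: is_interval_convex_1)
  qed
  have tt: "K 1 t s \<bullet> K 1 t s = 1" for s using unit[OF t, of s] by (simp add: norm_eq_1)
  have tk: "K 1 t s \<bullet> K 2 t s = 0" for s
  proof -
    have "((\<lambda>s. K 1 t s \<bullet> K 1 t s) has_vector_derivative K 1 t s \<bullet> K 2 t s + K 2 t s \<bullet> K 1 t s) (at s)"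
      using has_vector_derivative_inner[OF K_s[OF t, of 1 s] K_s[OF t, of 1 s]] by (simp add: numeral_2_eq_2)
    then have "((\<lambda>s. 1::real) has_vector_derivative K 1 t s \<bullet> K 2 t s + K 2 t s \<bullet> K 1 t s) (at s)"
      unfolding tt .
    from vector_derivative_unique_at[OF this has_vector_derivative_const]
    show ?thesis by (simp add: inner_commute)
  qed
  define P where "P s = X (K 0 t s) \<bullet> gt t s + curl X (K 0 t s) \<bullet> K 1 t s" for s
  have P: "(P has_vector_derivative ft t s + Dcurl_xi X (K 0 t s) (K 1 t s)) (at s)" for s
  proof -
    have d1: "((\<lambda>s. X (K 0 t s)) has_vector_derivative D (K 0 t s) (K 1 t s)) (at s)"
      unfolding has_vector_derivative_def
      by (rule has_derivative_eq_rhs[OF has_derivative_compose[OF K_s[OF t, of 0 s, unfolded has_vector_derivative_def] D]])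
        (simp add: linear_scale[OF has_derivative_linear[OF D]])
    note dC = smooth_has_derivative(1)[OF smooth_curl[OF X], of "K 0 t s"]
    have d2: "((\<lambda>s. curl X (K 0 t s)) has_vector_derivative frechet_derivative (curl X) (at (K 0 t s)) (K 1 t s)) (at s)"
      unfolding has_vector_derivative_def
      by (rule has_derivative_eq_rhs[OF has_derivative_compose[OF K_s[OF t, of 0 s, unfolded has_vector_derivative_def] dC]])
        (simp add: linear_scale[OF has_derivative_linear[OF dC]])
    have d3: "(gt t has_vector_derivative cross3 (K 1 t s) (K 3 t s)) (at s)"
      unfolding gt_def using has_vector_derivative_cross3[OF K_s[OF t, of 1 s] K_s[OF t, of 2 s]]
      by (simp add: cross_refl numeral_eq_Suc)
    have d4: "(K 1 t has_vector_derivative K 2 t s) (at s)" using K_s[OF t, of 1 s] by (simp add: numeral_2_eq_2)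
    \<comment> \<open>Here \<open>cross3 (cross3 \<tau> \<kappa>) \<tau> = \<kappa>\<close>, so the
      antisymmetric part of the derivative of \<open>X\<close> supplies exactly the term
      \<open>curl X \<bullet> \<kappa>\<close> in the derivative of \<open>P\<close>.\<close>
    have "curl X (K 0 t s) \<bullet> cross3 (gt t s) (K 1 t s) = curl X (K 0 t s) \<bullet> K 2 t s"
      unfolding gt_def cross3_triple inner_commute[of "K 2 t s" "K 1 t s"] tt tk by simp
    then have sk: "D (K 0 t s) (gt t s) \<bullet> K 1 t s - D (K 0 t s) (K 1 t s) \<bullet> gt t s = curl X (K 0 t s) \<bullet> K 2 t s"
      using inner_derivative_skew[OF X D] by simp
    show ?thesis
      unfolding P_def
      by (rule has_vector_derivative_eq_rhs[OF has_vector_derivative_add[OF has_vector_derivative_inner[OF d1 d3]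
            has_vector_derivative_inner[OF d2 d4]]])
        (use sk in \<open>simp add: ft_def Dcurl_xi_eq[OF dC] inner_commute\<close>)
  qed
  have "((\<lambda>s. ft t s + Dcurl_xi X (K 0 t s) (K 1 t s)) has_integral (P L - P 0)) {0..L}"
    using L P by (intro fundamental_theorem_of_calculus) (auto intro: has_vector_derivative_at_within)
  moreover have "P L = P 0" using K_per[OF t, of _ 0] by (simp add: P_def gt_def)
  ultimately have "integral {0..L} (\<lambda>s. ft t s + Dcurl_xi X (K 0 t s) (K 1 t s)) = 0"
    by (simp add: integral_unique)
  moreover have "integral {0..L} (\<lambda>s. ft t s + Dcurl_xi X (K 0 t s) (K 1 t s))
      = integral {0..L} (ft t) + integral {0..L} (\<lambda>s. Dcurl_xi X (K 0 t s) (K 1 t s))"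
  proof (rule integral_add)
    show "ft t integrable_on {0..L}"
      unfolding ft_def D_eq gt_def
      by (intro integrable_continuous_real continuous_intros continuous_on_cross3 comp_cont X smooth_pd t K_cont')
    have "continuous_on {0..L} (\<lambda>s. Dcurl_xi X (fst (K 0 t s, K 1 t s)) (snd (K 0 t s, K 1 t s)))"
      by (rule continuous_on_compose2[OF Dcurl_xi_continuous[OF X]]) (auto intro!: continuous_intros K_cont'[OF t])
    then show "(\<lambda>s. Dcurl_xi X (K 0 t s) (K 1 t s)) integrable_on {0..L}" by (simp add: integrable_continuous_real)
  qed
  moreover have "(\<integral>p. Dcurl_xi X (fst p) (snd p) \<partial>VV t) = integral {0..L} (\<lambda>s. Dcurl_xi X (K 0 t s) (K 1 t s))"
    unfolding VV_integral[OF t Dcurl_xi_continuous[OF X]] by simp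
  ultimately have "integral {0..L} (ft t) = - (\<integral>p. Dcurl_xi X (fst p) (snd p) \<partial>VV t)" by simp
  then show ?thesis
    using 1 by (simp add: has_real_derivative_iff_has_vector_derivative curr_def)
qed

lemma VV_lipschitz:
  assumes X: "test_field X"
  obtains C where "C-lipschitz_on I (\<lambda>t. curr t X)"
proof -
  note sX = test_field_smooth[OF X]
  obtain B where B: "\<And>x \<xi>. norm \<xi> = 1 \<Longrightarrow> \<bar>Dcurl_xi X x \<xi>\<bar> \<le> B" "B \<ge> 0" by (rule Dcurl_xi_bounded[OF X]) blast
  have "(B * L)-lipschitz_on I (\<lambda>t. curr t X)"
  proof (rule lipschitz_onI)
    fix s t assume st: "s \<in> I" "t \<in> I"
    have "norm (curr s X - curr t X) \<le> B * L * \<bar>s - t\<bar>"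
    proof (rule norm_diff_le_within[of I "\<lambda>t. curr t X" "\<lambda>t. - (\<integral>p. Dcurl_xi X (fst p) (snd p) \<partial>VV t)"])
      show "convex I" using I by (simp add: is_interval_convex_1)
      show "((\<lambda>t. curr t X) has_vector_derivative - (\<integral>p. Dcurl_xi X (fst p) (snd p) \<partial>VV r)) (at r within I)" if "r \<in> I" for r
        using curr_deriv[OF that sX] by (simp add: has_real_derivative_iff_has_vector_derivative)
      show "norm (- (\<integral>p. Dcurl_xi X (fst p) (snd p) \<partial>VV r)) \<le> B * L" if "r \<in> I" for r
        using varifold_integrable(2)[OF VV_oriented(1)[OF that] Dcurl_xi_continuous[OF sX], of B] B VV_oriented(2)[OF that]
        by simp
    qed (use st in auto)
    then show "dist (curr s X) (curr t X) \<le> B * L * dist s t" by (simp add: dist_norm)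
  qed (use B L in simp)
  then show ?thesis by (rule that)
qed

lemma generalized_BCF_VV: "generalized_BCF I VV"
  unfolding generalized_BCF_def
proof (intro conjI ballI allI impI)
  show "oriented_varifold (VV t)" if "t \<in> I" for t by (rule VV_oriented[OF that])
  show "(\<lambda>t. emeasure (VV t) B) \<in> borel_measurable (lebesgue_on I)" if "B \<in> varifold_sets" for B
    by (rule VV_measurable_time[OF that])
  fix X assume X: "test_field X"
  note fm = VV_first_moment[OF _ test_field_smooth[OF X]]
  obtain C where C: "C-lipschitz_on I (\<lambda>t. curr t X)" by (rule VV_lipschitz[OF X])
  have "C-lipschitz_on I (\<lambda>t. first_moment (VV t) X)"
    by (rule lipschitz_on_transform[OF C]) (simp add: fm)
  then show "\<exists>C. C-lipschitz_on I (\<lambda>t. first_moment (VV t) X)" by blast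
  show "AE t in lebesgue_on I. ((\<lambda>\<tau>. first_moment (VV \<tau>) X) has_real_derivative
            - (\<integral>p. Dcurl_xi X (fst p) (snd p) \<partial>VV t)) (at t within I)"
  proof (rule AE_I2)
    fix t assume "t \<in> space (lebesgue_on I)"
    then have t: "t \<in> I" by (simp add: space_restrict_space)
    show "((\<lambda>\<tau>. first_moment (VV \<tau>) X) has_real_derivative - (\<integral>p. Dcurl_xi X (fst p) (snd p) \<partial>VV t)) (at t within I)"
      using curr_deriv[OF t test_field_smooth[OF X]] t fm
      by (subst has_field_derivative_cong_eventually[where g = "\<lambda>r. curr r X"]) (auto simp: eventually_at_filter)
  qed
qed

section \<open>The mass of the curve; existence and uniqueness\<close>

lemma mass_le:
  assumes t: "t \<in> I"
  shows "mass (curr t) \<le> ereal L"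
  unfolding mass_def
proof (rule SUP_least)
  fix X assume "X \<in> {X. test_field X \<and> (\<forall>x. norm (X x) \<le> 1)}"
  then have X: "test_field X" "\<And>x. norm (X x) \<le> 1" by auto
  have "\<bar>first_moment (VV t) X\<bar> \<le> 1 * vmass (VV t)"
    by (rule first_moment_bound[OF VV_oriented(1)[OF t] smooth_imp_continuous[OF test_field_smooth[OF X(1)]] X(2)])
  then show "ereal (curr t X) \<le> ereal L"
    using VV_oriented(2)[OF t] VV_first_moment[OF t test_field_smooth[OF X(1)]] by simp
qed

lemma le_mass:
  assumes t: "t \<in> I"
  shows "ereal L \<le> mass (curr t)"
proof -
  have J: "compact {t}" "{t} \<subseteq> I" using t by auto
  obtain \<delta> r0 k0 k1 b1 b2 f f1 f2 where \<delta>: "\<delta> > 0"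
    and ex: "\<And>\<epsilon>. \<epsilon> > 0 \<Longrightarrow> \<exists>\<rho> \<rho>1 R. \<forall>t\<in>{t}. calib (K 0 t) (K 1 t) (K 2 t) (K 3 t) L \<delta> r0 k0 k1 b1 b2 \<epsilon> f f1 f2 \<rho> \<rho>1 R"
    by (rule calib_exists[OF J]) blast
  have key: "ereal (L - L * (4 * b1 * \<epsilon>\<^sup>2 + 2 * k0 * \<epsilon>)) \<le> mass (curr t)" if \<epsilon>: "0 < \<epsilon>" "\<epsilon> \<le> \<delta> / 2" for \<epsilon>
  proof -
    obtain \<rho> \<rho>1 R where cal: "calib (K 0 t) (K 1 t) (K 2 t) (K 3 t) L \<delta> r0 k0 k1 b1 b2 \<epsilon> f f1 f2 \<rho> \<rho>1 R"
      using ex[OF \<epsilon>(1)] by blast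
    interpret c: calib "K 0 t" "K 1 t" "K 2 t" "K 3 t" L \<delta> r0 k0 k1 b1 b2 \<epsilon> f f1 f2 \<rho> \<rho>1 R by (rule cal)
    have "integral {0..L} (\<lambda>s. 1 - (4 * b1 * \<epsilon>\<^sup>2 + 2 * k0 * \<epsilon>)) \<le> integral {0..L} (\<lambda>s. c.X (K 0 t s) \<bullet> K 1 t s)"
    proof (rule integral_le)
      show "(\<lambda>s. c.X (K 0 t s) \<bullet> K 1 t s) integrable_on {0..L}"
        by (intro integrable_continuous_real continuous_intros K_cont'[OF t] comp_cont[OF c.smooth_X t])
    qed (use c.X_on_curve[OF \<epsilon>(2)] in auto)
    then have "L - L * (4 * b1 * \<epsilon>\<^sup>2 + 2 * k0 * \<epsilon>) \<le> curr t c.X"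
      using L by (simp add: curr_def algebra_simps)
    moreover have "ereal (curr t c.X) \<le> mass (curr t)"
      unfolding mass_def by (rule SUP_upper) (use c.test_field_X c.norm_X_le_1 in auto)
    ultimately show ?thesis by (meson ereal_less_eq(3) order.trans)
  qed
  show ?thesis
  proof (cases "mass (curr t)")
    case (real r)
    have "L \<le> r"
    proof (rule le_of_le_vanishing[of "\<delta> / 2"])
      show "L \<le> r + L * (4 * b1 * \<epsilon>\<^sup>2 + 2 * k0 * \<epsilon>)" if "0 < \<epsilon>" "\<epsilon> \<le> \<delta> / 2" for \<epsilon>
        using key[OF that] by (simp add: real)
    qed (use \<delta> in simp)
    then show ?thesis by (simp add: real)
  next
    case PInf then show ?thesis by simp
  next
    case MInf
    then show ?thesis using key[of "\<delta> / 2"] \<delta> by simp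
  qed
qed

lemma weak_BCF_curr:
  assumes I0: "0 \<in> I"
  shows "weak_BCF I curr (curr 0)"
  unfolding weak_BCF_def
proof (intro conjI ballI allI impI)
  show "integral_current (curr t)" if "t \<in> I" for t by (rule integral_current_curr[OF that])
  show "continuous_on I (\<lambda>t. curr t X)" if "test_field X" for X
    using VV_lipschitz[OF that] lipschitz_on_continuous_on by metis
  show "same_current (curr 0) (curr 0)" by (simp add: same_current_def)
  have "\<forall>t\<in>I. same_current (first_moment (VV t)) (curr t) \<and> ereal (vmass (VV t)) \<le> mass (curr 0)"
    using VV_first_moment test_field_smooth le_mass[OF I0] VV_oriented(2) by (auto simp: same_current_def)
  then show "\<exists>V. generalized_BCF I V \<and> (\<forall>t\<in>I. same_current (first_moment (V t)) (curr t) \<and> ereal (vmass (V t)) \<le> mass (curr 0))"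
    using generalized_BCF_VV by blast
qed

lemma weak_BCF_unique:
  assumes I0: "0 \<in> I" and S: "weak_BCF I S (curr 0)" and t: "t \<in> I"
  shows "same_current (S t) (curr t)"
proof -
  obtain V where V: "generalized_BCF I V" "\<And>t. t \<in> I \<Longrightarrow> same_current (first_moment (V t)) (S t)"
    "\<And>t. t \<in> I \<Longrightarrow> ereal (vmass (V t)) \<le> mass (curr 0)" and S0: "same_current (S 0) (curr 0)"
    using S unfolding weak_BCF_def by blast
  have mass: "vmass (V t) \<le> L" if "t \<in> I" for t
    using order.trans[OF V(3)[OF that] mass_le[OF I0]] by simp
  have init: "first_moment (V 0) X = integral {0..L} (\<lambda>s. X (K 0 0 s) \<bullet> K 1 0 s)" if "test_field X" for X
    using V(2)[OF I0] S0 that by (simp add: same_current_def curr_def)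
  show ?thesis
    unfolding same_current_def
  proof (intro allI impI)
    fix X assume X: "test_field X"
    have "S t X = first_moment (V t) X" using V(2)[OF t] X by (simp add: same_current_def)
    also have "\<dots> = curr t X" unfolding curr_def by (rule unique_moment[OF V(1) mass init I0 t X])
    finally show "S t X = curr t X" .
  qed
qed

end

theorem theorem2:
  fixes I :: "real set" and L :: real and \<gamma> :: "real \<Rightarrow> real \<Rightarrow> real^3"
  assumes "is_interval I" and "0 \<in> I" and "L > 0"
    and "smooth_on (Sigma I (\<lambda>_. UNIV)) (\<lambda>(t, s). \<gamma> t s)"
    and "\<forall>t\<in>I. \<forall>s. \<gamma> t (s + L) = \<gamma> t s"
    and "\<forall>t\<in>I. \<forall>s. norm (d_s \<gamma> t s) = 1"
    and "\<forall>t\<in>I. \<forall>s. ((\<lambda>\<tau>. \<gamma> \<tau> s) has_vector_derivative (cross3 (d_s \<gamma> t s) (d_ss \<gamma> t s))) (at t within I)"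
    and "\<forall>t\<in>I. inj_on (\<gamma> t) {0..<L}"
  shows "weak_BCF I (curve_current_t \<gamma> L) (curve_current_t \<gamma> L 0) \<and>
         (\<forall>S. weak_BCF I S (curve_current_t \<gamma> L 0) \<longrightarrow>
              (\<forall>t\<in>I. same_current (S t) (curve_current_t \<gamma> L t)))"
proof -
  define U where "U = I \<times> (UNIV :: real set)"
  \<comment> \<open>Derivatives are taken within \<open>U\<close>, because \<open>I\<close> may have
    end points; \<open>(0, 1)\<close> is the direction of arc length, so \<open>D k\<close> is the
    \<open>k\<close>-th \<open>s\<close>-derivative.\<close>
  define D where "D k = iter_deriv U (replicate k (0, 1)) (\<lambda>(t, s). \<gamma> t s)" for k
  define K where "K k t s = D k (t, s)" for k t s
  have sm: "continuous_on U (D k)" "p \<in> U \<Longrightarrow> D k differentiable (at p within U)" for k p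
    using assms(4) unfolding smooth_on_def U_def D_def by auto
  have K0: "K 0 = \<gamma>" by (simp add: K_def D_def fun_eq_iff)
  have K_s: "(K k t has_vector_derivative K (Suc k) t s) (at s)" if t: "t \<in> I" for k t s
  proof -
    define E where "E = frechet_derivative (D k) (at (t, s) within U)"
    have E: "(D k has_derivative E) (at (t, s) within U)"
      unfolding E_def using sm(2)[of "(t, s)" k] t by (simp add: frechet_derivative_works[symmetric] U_def)
    have "((\<lambda>s. (t, s)) has_derivative (\<lambda>h. (0, h))) (at s)" by (intro derivative_intros)
    \<comment> \<open>The line through \<open>(t, s)\<close> in the parameter direction lies in
      \<open>U\<close>, so the derivative within \<open>U\<close> restricts to a full derivative in
      \<open>s\<close>.\<close>
    moreover have "(D k has_derivative E) (at (t, s) within range (\<lambda>s. (t, s)))"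
      by (rule has_derivative_subset[OF E]) (use t in \<open>auto simp: U_def\<close>)
    ultimately have "((\<lambda>s. D k (t, s)) has_derivative (\<lambda>h. E (0, h))) (at s)"
      by (rule has_derivative_in_compose)
    moreover have "E (0, h) = h *\<^sub>R K (Suc k) t s" for h
      using linear_scale[OF has_derivative_linear[OF E], of h "(0, 1)"]
      by (simp add: K_def D_def E_def dir_deriv_def)
    ultimately show ?thesis by (simp add: has_vector_derivative_def K_def[abs_def])
  qed
  have K1: "d_s \<gamma> t = K 1 t" if "t \<in> I" for t
    using vector_derivative_at[OF K_s[OF that, of 0]] by (simp add: d_s_def[abs_def] K0)
  have K2: "d_ss \<gamma> t = K 2 t" if "t \<in> I" for t
    using vector_derivative_at[OF K_s[OF that, of 1]] by (simp add: d_ss_def[abs_def] K1[OF that] numeral_2_eq_2)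
  interpret smooth_flow I L K
  proof
    show "continuous_on (I \<times> UNIV) (\<lambda>(t, s). K k t s)" for k
      using sm(1)[of k] by (simp add: U_def K_def)
  qed (use assms K_s K1 K2 in \<open>simp_all add: K0\<close>)
  have eq: "curve_current_t \<gamma> L t = curr t" if "t \<in> I" for t
    using K1[OF that] by (simp add: fun_eq_iff curve_current_t_def curr_def K0)
  \<comment> \<open>The two families are known to agree for times in \<open>I\<close>, and
    \<open>weak_BCF\<close> evaluates its family at no other time, 0 being in
    \<open>I\<close>.\<close>
  have cong: "weak_BCF I (curve_current_t \<gamma> L) T \<longleftrightarrow> weak_BCF I curr T" for T
    unfolding weak_BCF_def using eq assms(2) by (simp cong: continuous_on_cong)
  show ?thesis
    unfolding cong eq[OF assms(2)]
    using weak_BCF_curr[OF assms(2)] weak_BCF_unique[OF assms(2)] eq by simp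
qed

end
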